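(* Let $p$ be a prime, $G$ a finite Abelian $p$-group and $n\geq 3$ a natural number. Let $G^\ast\to G$ be an arbitrary cover of $G$ and denote by $Z$ the image of the centre $Z(G^\ast)$ inside $G$. (1) If the exponent of $G$ divides $n$, then $\widetilde{\mathcal K}(G,n)$ is (isomorphic to) the direct product of $G$ and $\widetilde{\mathcal K}(G,n-1)$. (2) If $p$ does not divide $n$, then the centre of $\widetilde{\mathcal K}(G,n)$ is isomorphic to the product of $H_2(G,\mathbb Z)$ and $\mathcal K(Z,n)$.
   Context: For a group $G$ and $n\geq 2$, let $G^{\rm ab}=G/[G,G]$ and let $\mathcal K(G,n)$ be the kernel of the homomorphism $G^n\to G^{\rm ab}$, $(g_1,\dots,g_n)\mapsto\overline{g_1\cdots g_n}$. Choose a presentation $G\cong F/N$ with $F$ a free group and $N$ a normal subgroup of $F$. Let $\langle\langle\mathcal K(N,n)\rangle\rangle$ be the normal closure of $\mathcal K(N,n)$ in $F^n$ (it is contained in $\mathcal K(F,n)$), and define $\widetilde{\mathcal K}(G,n):=\mathcal K(F,n)/\langle\langle\mathcal K(N,n)\rangle\rangle$. Up to isomorphism this does not depend on the choice of presentation. A cover of a finite group $G$ is a group $G^\ast$ together with a central short exact sequence $0\to M\to G^\ast\to G\to 1$ such that $M\leq[G^\ast,G^\ast]$ and $M$ is isomorphic to the Schur multiplier $H^2(G,\mathbb C^\ast)$ of $G$ (trivial action), which for finite $G$ is (non-canonically) isomorphic to $H_2(G,\mathbb Z)$. *)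

theory Defs
  imports Complex_Main "HOL-Computational_Algebra.Primes"
    "HOL-Algebra.Generated_Groups" "HOL-Algebra.Multiplicative_Group"
    "HOL-Algebra.Product_Groups" "HOL-Algebra.Free_Abelian_Groups"
begin

definition center :: "('a, 'b) monoid_scheme \<Rightarrow> 'a set" where
  "center G = {z \<in> carrier G. \<forall>x\<in>carrier G. z \<otimes>\<^bsub>G\<^esub> x = x \<otimes>\<^bsub>G\<^esub> z}"

definition normal_closure :: "('a, 'b) monoid_scheme \<Rightarrow> 'a set \<Rightarrow> 'a set" where
  "normal_closure G S = \<Inter>{H. H \<lhd> G \<and> S \<subseteq> H}"

text \<open>The exponent is 0 if the orders of the elements are unbounded.\<close>

definition group_exponent :: "('a, 'b) monoid_scheme \<Rightarrow> nat" where
  "group_exponent G = Lcm (group.ord G ` carrier G)"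

definition abelianization :: "('a, 'b) monoid_scheme \<Rightarrow> 'a set monoid" where
  "abelianization G = G Mod derived G (carrier G)"


subsection \<open>Free groups\<close>

text \<open>A word is a list of letters; \<open>(True, x)\<close> stands for \<open>x\<close> and \<open>(False, x)\<close> for its inverse.
  A group is free on \<open>X\<close> if each element is the value of exactly one reduced word over \<open>X\<close>.\<close>

definition reduced_words :: "'a set \<Rightarrow> (bool \<times> 'a) list set" where
  "reduced_words X =
    {w. snd ` set w \<subseteq> X \<and> successively (\<lambda>(a, x) (b, y). x = y \<longrightarrow> a = b) w}"

definition word_value :: "('a, 'b) monoid_scheme \<Rightarrow> (bool \<times> 'a) list \<Rightarrow> 'a" where
  "word_value F w = foldr (\<otimes>\<^bsub>F\<^esub>) (map (\<lambda>(a, x). if a then x else inv\<^bsub>F\<^esub> x) w) \<one>\<^bsub>F\<^esub>"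

definition free_on :: "('a, 'b) monoid_scheme \<Rightarrow> 'a set \<Rightarrow> bool" where
  "free_on F X \<longleftrightarrow>
    group F \<and> X \<subseteq> carrier F \<and> bij_betw (word_value F) (reduced_words X) (carrier F)"

definition free_group :: "('a, 'b) monoid_scheme \<Rightarrow> bool" where
  "free_group F \<longleftrightarrow> (\<exists>X. free_on F X)"

definition presentation ::
    "('a, 'c) monoid_scheme \<Rightarrow> ('b, 'd) monoid_scheme \<Rightarrow> 'b set \<Rightarrow> bool" where
  "presentation G F N \<longleftrightarrow> free_group F \<and> N \<lhd> F \<and> F Mod N \<cong> G"


subsection \<open>The groups \<open>K(G, n)\<close> and their twisted versions\<close>

definition power_group :: "('a, 'b) monoid_scheme \<Rightarrow> nat \<Rightarrow> (nat \<Rightarrow> 'a) monoid" where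
  "power_group G n = product_group {..<n} (\<lambda>_. G)"

text \<open>The order of the factors matters, as \<open>G\<close> need not be Abelian.\<close>

definition tuple_prod :: "('a, 'b) monoid_scheme \<Rightarrow> nat \<Rightarrow> (nat \<Rightarrow> 'a) \<Rightarrow> 'a" where
  "tuple_prod G n g = foldr (\<otimes>\<^bsub>G\<^esub>) (map g [0..<n]) \<one>\<^bsub>G\<^esub>"

definition K_set :: "('a, 'b) monoid_scheme \<Rightarrow> nat \<Rightarrow> (nat \<Rightarrow> 'a) set" where
  "K_set G n = kernel (power_group G n) (abelianization G)
                 (\<lambda>g. derived G (carrier G) #>\<^bsub>G\<^esub> tuple_prod G n g)"

definition K_group :: "('a, 'b) monoid_scheme \<Rightarrow> nat \<Rightarrow> (nat \<Rightarrow> 'a) monoid" where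
  "K_group G n = (power_group G n)\<lparr>carrier := K_set G n\<rparr>"

text \<open>For a presentation of \<open>G\<close> as \<open>F / N\<close>, this is the group written as \<open>K(G, n)\<close> with a tilde.\<close>

definition K_tilde :: "('a, 'b) monoid_scheme \<Rightarrow> 'a set \<Rightarrow> nat \<Rightarrow> (nat \<Rightarrow> 'a) set monoid" where
  "K_tilde F N n =
    K_group F n Mod normal_closure (power_group F n) (K_set (F\<lparr>carrier := N\<rparr>) n)"


subsection \<open>Second homology and cohomology with trivial action\<close>

text \<open>Both are computed from the inhomogeneous bar resolution.\<close>

definition bar_boundary2 ::
    "('a, 'b) monoid_scheme \<Rightarrow> ('a \<times> 'a \<Rightarrow>\<^sub>0 int) \<Rightarrow> ('a \<Rightarrow>\<^sub>0 int)" where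
  "bar_boundary2 G =
    frag_extend (\<lambda>(x, y). frag_of y - frag_of (x \<otimes>\<^bsub>G\<^esub> y) + frag_of x)"

definition bar_boundary3 ::
    "('a, 'b) monoid_scheme \<Rightarrow> ('a \<times> 'a \<times> 'a \<Rightarrow>\<^sub>0 int) \<Rightarrow> ('a \<times> 'a \<Rightarrow>\<^sub>0 int)" where
  "bar_boundary3 G =
    frag_extend (\<lambda>(x, y, z). frag_of (y, z) - frag_of (x \<otimes>\<^bsub>G\<^esub> y, z)
                              + frag_of (x, y \<otimes>\<^bsub>G\<^esub> z) - frag_of (x, y))"

definition H2_int :: "('a, 'b) monoid_scheme \<Rightarrow> ('a \<times> 'a \<Rightarrow>\<^sub>0 int) set monoid" where
  "H2_int G =
    (let C1 = free_Abelian_group (carrier G);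
         C2 = free_Abelian_group (carrier G \<times> carrier G);
         C3 = free_Abelian_group (carrier G \<times> carrier G \<times> carrier G)
     in C2\<lparr>carrier := kernel C2 C1 (bar_boundary2 G)\<rparr> Mod (bar_boundary3 G ` carrier C3))"

definition coboundary1 :: "('a, 'b) monoid_scheme \<Rightarrow> ('c, 'd) monoid_scheme \<Rightarrow>
    ('a \<Rightarrow> 'c) \<Rightarrow> ('a \<times> 'a \<Rightarrow> 'c)" where
  "coboundary1 G A c =
    (\<lambda>(x, y)\<in>carrier G \<times> carrier G. c y \<otimes>\<^bsub>A\<^esub> inv\<^bsub>A\<^esub> c (x \<otimes>\<^bsub>G\<^esub> y) \<otimes>\<^bsub>A\<^esub> c x)"

definition coboundary2 :: "('a, 'b) monoid_scheme \<Rightarrow> ('c, 'd) monoid_scheme \<Rightarrow>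
    ('a \<times> 'a \<Rightarrow> 'c) \<Rightarrow> ('a \<times> 'a \<times> 'a \<Rightarrow> 'c)" where
  "coboundary2 G A f =
    (\<lambda>(x, y, z)\<in>carrier G \<times> carrier G \<times> carrier G.
       f (y, z) \<otimes>\<^bsub>A\<^esub> inv\<^bsub>A\<^esub> f (x \<otimes>\<^bsub>G\<^esub> y, z) \<otimes>\<^bsub>A\<^esub> f (x, y \<otimes>\<^bsub>G\<^esub> z) \<otimes>\<^bsub>A\<^esub> inv\<^bsub>A\<^esub> f (x, y))"

definition cohomology2 :: "('a, 'b) monoid_scheme \<Rightarrow> ('c, 'd) monoid_scheme \<Rightarrow>
    ('a \<times> 'a \<Rightarrow> 'c) set monoid" where
  "cohomology2 G A =
    (let C1 = product_group (carrier G) (\<lambda>_. A);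
         C2 = product_group (carrier G \<times> carrier G) (\<lambda>_. A);
         C3 = product_group (carrier G \<times> carrier G \<times> carrier G) (\<lambda>_. A)
     in C2\<lparr>carrier := kernel C2 C3 (coboundary2 G A)\<rparr> Mod (coboundary1 G A ` carrier C1))"

definition complex_units :: "complex monoid" where
  "complex_units = \<lparr>carrier = - {0}, monoid.mult = (*), one = 1\<rparr>"

definition schur_multiplier :: "('a, 'b) monoid_scheme \<Rightarrow> ('a \<times> 'a \<Rightarrow> complex) set monoid" where
  "schur_multiplier G = cohomology2 G complex_units"


subsection \<open>Covers\<close>

text \<open>The group \<open>M\<close> of the extension is taken to be the kernel of \<open>\<pi>\<close>.\<close>

definition is_cover ::
    "('a, 'b) monoid_scheme \<Rightarrow> ('e, 'f) monoid_scheme \<Rightarrow> ('e \<Rightarrow> 'a) \<Rightarrow> bool" where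
  "is_cover G E \<pi> \<longleftrightarrow>
    group E \<and> \<pi> \<in> epi E G \<and>
    kernel E G \<pi> \<subseteq> center E \<and>
    kernel E G \<pi> \<subseteq> derived E (carrier E) \<and>
    E\<lparr>carrier := kernel E G \<pi>\<rparr> \<cong> schur_multiplier G"

end

theory Submission
  imports Defs
begin

text \<open>
  Let \<open>G = F / N\<close> be abelian and put \<open>E = F / [F, N]\<close>.  Then \<open>E\<close> is a central extension of \<open>G\<close>
  by \<open>N / [F, N]\<close>, and \<open>[F, F] \<le> N\<close> shows that \<open>H = [E, E] = [F, F] / [F, N]\<close> is central.
  A commutator in \<open>E\<close> depends only on the images of its entries in \<open>G\<close>, so commutators define
  an alternating bimultiplicative pairing \<open>\<omega> : G \<times> G \<rightarrow> H\<close>.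

  The normal closure of \<open>K(N, n)\<close> in \<open>F\<^sup>n\<close> consists of the tuples over \<open>N\<close> whose product lies in
  \<open>[F, N]\<close>.  Hence the class of a tuple \<open>f\<close> of \<open>K(F, n)\<close> is determined by its image \<open>g\<close> in \<open>G\<^sup>n\<close>
  and by the product \<open>h\<close> of its entries in \<open>H\<close>.  Sorting the product of two tuples turns
  the group with the tilde into the set of pairs \<open>(g, h)\<close> with
  \<open>(g, h) (x, k) = (g x, h k c(g, x))\<close>, where \<open>c(g, x)\<close> is the product of the \<open>\<omega>(x\<^sub>j, g\<^sub>i)\<close> over
  \<open>j < i\<close> (\<open>K_tilde_iso_twisted_group\<close>).  From here on everything is about a pairing on a finite
  abelian group.

  Two pairs \<open>(g, h)\<close> and \<open>(x, k)\<close> commute iff the product of the \<open>\<omega>(x\<^sub>i, g\<^sub>i)\<close> is trivial.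

  For the first claim, the diagonal elements \<open>((e, \<dots>, e), h)\<close> are central, and
  \<open>e \<mapsto> ((e, \<dots>, e), q(e))\<close> is a homomorphism as soon as \<open>q(e f) = q(e) q(f) \<omega>(e, f)\<^sup>m\<close> with
  \<open>m = n (n - 1) / 2\<close>.  Since the exponent of \<open>G\<close> divides \<open>n\<close>, the pairing \<open>\<omega>\<^sup>m\<close> has values of
  order at most two, and such a pairing has a quadratic refinement \<open>q\<close>
  (\<open>quadratic_refinement\<close>).  The last coordinate is a retraction onto this copy of \<open>G\<close>, and its
  kernel is the group for \<open>n - 1\<close> (\<open>twisted_group_split\<close>).

  For the second claim, testing \<open>g\<close> against tuples with the two entries \<open>x\<close> and \<open>x\<^sup>-\<^sup>1\<close> shows
  that \<open>\<omega>(x, g\<^sub>i)\<close> does not depend on \<open>i\<close>; its \<open>n\<close>-th power is \<open>\<omega>(x, 1) = 1\<close>, and its order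
  divides that of \<open>G\<close>, which is prime to \<open>n\<close>, so it is trivial.  Thus all entries of a central element lie in the radical
  \<open>Z\<close> of \<open>\<omega>\<close>, where the cocycle is trivial, and the centre is \<open>H \<times> K(Z, n)\<close>
  (\<open>center_twisted_group_iso\<close>).

  It remains to recognise \<open>H\<close> and \<open>Z\<close>.  The group \<open>H\<close> is \<open>H\<^sub>2(G, \<int>)\<close> by the formula of Hopf; the
  decisive injectivity comes from lifting \<open>E\<close> to the extension of \<open>G\<close> by bar chains modulo
  boundaries (\<open>Hopf_formula\<close>).  For a cover \<open>G\<^sup>*\<close> with kernel \<open>M\<close>, freeness of \<open>F\<close> gives a
  homomorphism \<open>E \<rightarrow> G\<^sup>*\<close> over \<open>G\<close>, which maps \<open>H\<close> onto \<open>[G\<^sup>*, G\<^sup>*] = M\<close>.  Characters of \<open>H\<close> embed into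
  \<open>H\<^sup>2(G, \<complex>\<^sup>*)\<close>, which has the cardinality of \<open>M\<close>, and \<open>H\<close> has at least \<open>|H|\<close> characters; so
  \<open>H \<rightarrow> M\<close> is injective, two elements of \<open>G\<close> have commuting lifts in \<open>E\<close> iff they have commuting
  lifts in \<open>G\<^sup>*\<close>, and \<open>Z\<close> is the image of the centre of \<open>G\<^sup>*\<close> (\<open>radical_eq_center_of_cover\<close>).
\<close>


section \<open>Tuples and their products\<close>

lemma tuple_prod_0 [simp]: "tuple_prod G 0 g = \<one>\<^bsub>G\<^esub>"
  by (simp add: tuple_prod_def)

lemma tuple_prod_cong:
  "(\<And>i. i < n \<Longrightarrow> f i = g i) \<Longrightarrow> tuple_prod G n f = tuple_prod G n g"
  unfolding tuple_prod_def by (metis atLeastLessThan_iff map_cong set_upt)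

lemma tuple_prod_subgroup [simp]: "tuple_prod (G\<lparr>carrier := S\<rparr>) n g = tuple_prod G n g"
  by (simp add: tuple_prod_def)

lemma (in monoid) foldr_mult_closed:
  "set xs \<subseteq> carrier G \<Longrightarrow> foldr (\<otimes>) xs \<one> \<in> carrier G"
  by (induction xs) auto

lemma (in monoid) foldr_mult_eq:
  "\<lbrakk>set xs \<subseteq> carrier G; a \<in> carrier G\<rbrakk> \<Longrightarrow> foldr (\<otimes>) xs a = foldr (\<otimes>) xs \<one> \<otimes> a"
  by (induction xs) (auto simp: m_assoc foldr_mult_closed)

lemma (in monoid) tuple_prod_Suc:
  assumes "\<And>i. i \<le> n \<Longrightarrow> g i \<in> carrier G"
  shows "tuple_prod G (Suc n) g = tuple_prod G n g \<otimes> g n"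
proof -
  have "set (map g [0..<n]) \<subseteq> carrier G" using assms by auto
  then show ?thesis
    using foldr_mult_eq[of "map g [0..<n]" "g n"] assms by (simp add: tuple_prod_def)
qed

lemma (in monoid) tuple_prod_closed [simp, intro]:
  "(\<And>i. i < n \<Longrightarrow> g i \<in> carrier G) \<Longrightarrow> tuple_prod G n g \<in> carrier G"
  by (induction n) (auto simp: tuple_prod_Suc)

lemma (in monoid) tuple_prod_one [simp]: "tuple_prod G n (\<lambda>_. \<one>) = \<one>"
  by (induction n) (auto simp: tuple_prod_Suc)

lemma (in monoid) tuple_prod_const:
  "e \<in> carrier G \<Longrightarrow> tuple_prod G n (\<lambda>_. e) = e [^] n"
  by (induction n) (auto simp: tuple_prod_Suc)

lemma (in comm_monoid) tuple_prod_mult: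
  "\<lbrakk>\<And>i. i < n \<Longrightarrow> f i \<in> carrier G; \<And>i. i < n \<Longrightarrow> g i \<in> carrier G\<rbrakk> \<Longrightarrow>
   tuple_prod G n (\<lambda>i. f i \<otimes> g i) = tuple_prod G n f \<otimes> tuple_prod G n g"
  by (induction n) (auto simp: tuple_prod_Suc m_ac)

lemma (in group_hom) hom_tuple_prod:
  "(\<And>i. i < n \<Longrightarrow> g i \<in> carrier G) \<Longrightarrow> h (tuple_prod G n g) = tuple_prod H n (\<lambda>i. h (g i))"
  by (induction n) (auto simp: G.tuple_prod_Suc H.tuple_prod_Suc)

lemma (in monoid) tuple_prod_head:
  assumes "\<And>i. i < n \<Longrightarrow> f i \<in> carrier G" and "a \<in> carrier G" and "0 < n"
  shows "tuple_prod G n (\<lambda>i\<in>{..<n}. if i = 0 then a \<otimes> f i else f i) = a \<otimes> tuple_prod G n f"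
proof -
  have "tuple_prod G k (\<lambda>i. if i = 0 then a \<otimes> f i else f i) =
      (if k = 0 then \<one> else a \<otimes> tuple_prod G k f)" if "k \<le> n" for k
    using that
  proof (induction k)
    case (Suc k)
    then show ?case using assms by (cases "k = 0") (auto simp: tuple_prod_Suc m_assoc)
  qed simp
  from this[of n] have "tuple_prod G n (\<lambda>i. if i = 0 then a \<otimes> f i else f i) = a \<otimes> tuple_prod G n f"
    using assms(3) by simp
  moreover have "tuple_prod G n (\<lambda>i\<in>{..<n}. if i = 0 then a \<otimes> f i else f i) =
      tuple_prod G n (\<lambda>i. if i = 0 then a \<otimes> f i else f i)"
    by (intro tuple_prod_cong) simp
  ultimately show ?thesis by simp
qed

lemma (in monoid) tuple_prod_two_entries:
  assumes "\<And>i. i < n \<Longrightarrow> f i \<in> carrier G" "0 < j" "j < n"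
    "\<And>i. \<lbrakk>i < n; i \<noteq> 0; i \<noteq> j\<rbrakk> \<Longrightarrow> f i = \<one>"
  shows "tuple_prod G n f = f 0 \<otimes> f j"
proof -
  have "tuple_prod G k f = (if k = 0 then \<one> else if k \<le> j then f 0 else f 0 \<otimes> f j)" if "k \<le> n" for k
    using that
  proof (induction k)
    case (Suc k)
    then show ?case
      using assms by (cases "k = 0"; cases "k = j") (auto simp: tuple_prod_Suc)
  qed simp
  from this[of n] show ?thesis using assms(2,3) by simp
qed

lemma power_group_simps [simp]:
  "carrier (power_group G n) = (\<Pi>\<^sub>E i\<in>{..<n}. carrier G)"
  "\<one>\<^bsub>power_group G n\<^esub> = (\<lambda>i\<in>{..<n}. \<one>\<^bsub>G\<^esub>)"
  "(\<otimes>\<^bsub>power_group G n\<^esub>) = (\<lambda>x y. \<lambda>i\<in>{..<n}. x i \<otimes>\<^bsub>G\<^esub> y i)"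
  by (simp_all add: power_group_def)

lemma power_group_group: "group G \<Longrightarrow> group (power_group G n)"
  by (simp add: power_group_def)

lemma power_group_inv:
  "\<lbrakk>group G; x \<in> carrier (power_group G n)\<rbrakk> \<Longrightarrow>
   inv\<^bsub>power_group G n\<^esub> x = (\<lambda>i\<in>{..<n}. inv\<^bsub>G\<^esub> x i)"
  by (simp add: power_group_def)

lemma K_group_simps [simp]:
  "carrier (K_group G n) = K_set G n"
  "\<one>\<^bsub>K_group G n\<^esub> = (\<lambda>i\<in>{..<n}. \<one>\<^bsub>G\<^esub>)"
  "(\<otimes>\<^bsub>K_group G n\<^esub>) = (\<lambda>x y. \<lambda>i\<in>{..<n}. x i \<otimes>\<^bsub>G\<^esub> y i)"
  by (simp_all add: K_group_def)

lemma (in group) K_set_iff: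
  "g \<in> K_set G n \<longleftrightarrow> g \<in> (\<Pi>\<^sub>E i\<in>{..<n}. carrier G) \<and> tuple_prod G n g \<in> derived G (carrier G)"
proof -
  have "subgroup (derived G (carrier G)) G" by (rule derived_is_subgroup) simp
  then have "derived G (carrier G) #> tuple_prod G n g = derived G (carrier G) \<longleftrightarrow>
      tuple_prod G n g \<in> derived G (carrier G)" if "g \<in> (\<Pi>\<^sub>E i\<in>{..<n}. carrier G)"
    using that coset_join1[of "derived G (carrier G)" "tuple_prod G n g"]
      coset_join2[of "tuple_prod G n g" "derived G (carrier G)"]
      tuple_prod_closed[of n g] subgroup.subset
    by (auto simp: PiE_iff)
  then show ?thesis
    by (auto simp: K_set_def kernel_def abelianization_def)
qed

lemma (in comm_group) K_set_comm_iff: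
  "g \<in> K_set G n \<longleftrightarrow> g \<in> (\<Pi>\<^sub>E i\<in>{..<n}. carrier G) \<and> tuple_prod G n g = \<one>"
  by (simp add: K_set_iff derived_eq_singleton)

lemma (in group) K_group_group: "group (K_group G n)"
proof -
  interpret A: comm_group "abelianization G"
    unfolding abelianization_def by (rule derived_quot_is_comm_group)
  interpret N: normal "derived G (carrier G)" G
    by (rule derived_self_is_normal)
  interpret q: group_hom G "abelianization G" "\<lambda>x. derived G (carrier G) #> x"
    using N.r_coset_hom_Mod by unfold_locales (simp add: abelianization_def)
  interpret P: group "power_group G n" by (rule power_group_group[OF is_group])
  interpret group_hom "power_group G n" "abelianization G" "\<lambda>g. derived G (carrier G) #> tuple_prod G n g"
  proof (unfold_locales, rule homI)
    fix x y assume "x \<in> carrier (power_group G n)" "y \<in> carrier (power_group G n)"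
    then show "derived G (carrier G) #> tuple_prod G n (x \<otimes>\<^bsub>power_group G n\<^esub> y) =
        (derived G (carrier G) #> tuple_prod G n x) \<otimes>\<^bsub>abelianization G\<^esub>
        (derived G (carrier G) #> tuple_prod G n y)"
      by (auto simp: q.hom_tuple_prod PiE_iff A.tuple_prod_mult[symmetric] intro!: tuple_prod_cong)
  qed (auto simp: PiE_iff)
  show ?thesis
    unfolding K_group_def K_set_def by (rule P.subgroup_imp_group[OF subgroup_kernel])
qed

section \<open>Extensions defined by cocycles\<close>

text \<open>
  The cocycle need not be normalised, which is why the identity is \<open>(1, f(1, 1)\<^sup>-\<^sup>1)\<close>.  The bar
  cocycle in the proof of the Hopf formula has as \<open>f(1, 1)\<close> the class of the chain \<open>(1, 1)\<close>, which is not
  a boundary.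
\<close>

definition extension_group ::
    "('a, 'm) monoid_scheme \<Rightarrow> ('b, 'n) monoid_scheme \<Rightarrow> ('a \<Rightarrow> 'a \<Rightarrow> 'b) \<Rightarrow> ('a \<times> 'b) monoid" where
  "extension_group K Q f =
    \<lparr>carrier = carrier K \<times> carrier Q,
     monoid.mult = (\<lambda>(x, a) (y, b). (x \<otimes>\<^bsub>K\<^esub> y, a \<otimes>\<^bsub>Q\<^esub> b \<otimes>\<^bsub>Q\<^esub> f x y)),
     one = (\<one>\<^bsub>K\<^esub>, inv\<^bsub>Q\<^esub> f \<one>\<^bsub>K\<^esub> \<one>\<^bsub>K\<^esub>)\<rparr>"

lemma extension_group_simps [simp]:
  "carrier (extension_group K Q f) = carrier K \<times> carrier Q"
  "(x, a) \<otimes>\<^bsub>extension_group K Q f\<^esub> (y, b) = (x \<otimes>\<^bsub>K\<^esub> y, a \<otimes>\<^bsub>Q\<^esub> b \<otimes>\<^bsub>Q\<^esub> f x y)"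
  "\<one>\<^bsub>extension_group K Q f\<^esub> = (\<one>\<^bsub>K\<^esub>, inv\<^bsub>Q\<^esub> f \<one>\<^bsub>K\<^esub> \<one>\<^bsub>K\<^esub>)"
  by (simp_all add: extension_group_def)

proposition extension_group_is_group:
  assumes "group K" and "comm_group Q"
    and f: "\<And>x y. \<lbrakk>x \<in> carrier K; y \<in> carrier K\<rbrakk> \<Longrightarrow> f x y \<in> carrier Q"
    and cocycle: "\<And>x y z. \<lbrakk>x \<in> carrier K; y \<in> carrier K; z \<in> carrier K\<rbrakk> \<Longrightarrow>
      f x y \<otimes>\<^bsub>Q\<^esub> f (x \<otimes>\<^bsub>K\<^esub> y) z = f y z \<otimes>\<^bsub>Q\<^esub> f x (y \<otimes>\<^bsub>K\<^esub> z)"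
  shows "group (extension_group K Q f)"
proof -
  interpret K: group K by fact
  interpret Q: comm_group Q by fact
  have f1: "f \<one>\<^bsub>K\<^esub> y = f \<one>\<^bsub>K\<^esub> \<one>\<^bsub>K\<^esub>" if "y \<in> carrier K" for y
    using cocycle[of "\<one>\<^bsub>K\<^esub>" "\<one>\<^bsub>K\<^esub>" y] that f by simp
  let ?T = "extension_group K Q f"
  show ?thesis
  proof (rule groupI)
    fix s t u assume "s \<in> carrier ?T" "t \<in> carrier ?T" "u \<in> carrier ?T"
    then obtain x a y b z c where t: "s = (x, a)" "t = (y, b)" "u = (z, c)"
      and K: "x \<in> carrier K" "y \<in> carrier K" "z \<in> carrier K"
      and Q: "a \<in> carrier Q" "b \<in> carrier Q" "c \<in> carrier Q" by auto
    have "a \<otimes>\<^bsub>Q\<^esub> b \<otimes>\<^bsub>Q\<^esub> f x y \<otimes>\<^bsub>Q\<^esub> c \<otimes>\<^bsub>Q\<^esub> f (x \<otimes>\<^bsub>K\<^esub> y) z =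
        a \<otimes>\<^bsub>Q\<^esub> b \<otimes>\<^bsub>Q\<^esub> c \<otimes>\<^bsub>Q\<^esub> (f x y \<otimes>\<^bsub>Q\<^esub> f (x \<otimes>\<^bsub>K\<^esub> y) z)"
      using K Q f by (simp add: Q.m_ac)
    also have "\<dots> = a \<otimes>\<^bsub>Q\<^esub> (b \<otimes>\<^bsub>Q\<^esub> c \<otimes>\<^bsub>Q\<^esub> f y z) \<otimes>\<^bsub>Q\<^esub> f x (y \<otimes>\<^bsub>K\<^esub> z)"
      using K Q f by (simp add: cocycle Q.m_ac)
    finally show "s \<otimes>\<^bsub>?T\<^esub> t \<otimes>\<^bsub>?T\<^esub> u = s \<otimes>\<^bsub>?T\<^esub> (t \<otimes>\<^bsub>?T\<^esub> u)"
      using K Q by (simp add: t K.m_assoc)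
  next
    fix t assume "t \<in> carrier ?T"
    then obtain x a where t: "t = (x, a)" "x \<in> carrier K" "a \<in> carrier Q" by auto
    show "\<one>\<^bsub>?T\<^esub> \<otimes>\<^bsub>?T\<^esub> t = t"
      using t f f1[of x] by (simp add: Q.m_ac Q.r_inv)
    define u where
      "u = (inv\<^bsub>K\<^esub> x, inv\<^bsub>Q\<^esub> f \<one>\<^bsub>K\<^esub> \<one>\<^bsub>K\<^esub> \<otimes>\<^bsub>Q\<^esub> inv\<^bsub>Q\<^esub> f (inv\<^bsub>K\<^esub> x) x \<otimes>\<^bsub>Q\<^esub> inv\<^bsub>Q\<^esub> a)"
    have "u \<otimes>\<^bsub>?T\<^esub> t = \<one>\<^bsub>?T\<^esub>" and "u \<in> carrier ?T"
      using t f by (simp_all add: u_def Q.m_assoc)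
    then show "\<exists>s\<in>carrier ?T. s \<otimes>\<^bsub>?T\<^esub> t = \<one>\<^bsub>?T\<^esub>" by (rule bexI)
  qed (use f in auto)
qed

section \<open>Alternating pairings and the twisted groups that they define\<close>

locale alternating_pairing = G: comm_group G + H: comm_group H
  for G :: "('a, 'm) monoid_scheme" (structure) and H :: "('b, 'n) monoid_scheme" +
  fixes \<omega> :: "'a \<Rightarrow> 'a \<Rightarrow> 'b"
  assumes closed [simp, intro]: "\<lbrakk>x \<in> carrier G; y \<in> carrier G\<rbrakk> \<Longrightarrow> \<omega> x y \<in> carrier H"
    and mult_left: "\<lbrakk>x \<in> carrier G; y \<in> carrier G; z \<in> carrier G\<rbrakk> \<Longrightarrow> \<omega> (x \<otimes> y) z = \<omega> x z \<otimes>\<^bsub>H\<^esub> \<omega> y z"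
    and mult_right: "\<lbrakk>x \<in> carrier G; y \<in> carrier G; z \<in> carrier G\<rbrakk> \<Longrightarrow> \<omega> x (y \<otimes> z) = \<omega> x y \<otimes>\<^bsub>H\<^esub> \<omega> x z"
    and alternating [simp]: "x \<in> carrier G \<Longrightarrow> \<omega> x x = \<one>\<^bsub>H\<^esub>"
begin

text \<open>
  The order of the arguments of \<open>\<omega>\<close> is immaterial by antisymmetry; this one is the one in which
  the commutation criterion below tests a tuple \<open>g\<close> against all tuples \<open>x\<close>.
\<close>

definition radical :: "'a set" where
  "radical = {g \<in> carrier G. \<forall>x\<in>carrier G. \<omega> x g = \<one>\<^bsub>H\<^esub>}"

lemma hom_left: "y \<in> carrier G \<Longrightarrow> group_hom G H (\<lambda>x. \<omega> x y)"
  by unfold_locales (simp add: hom_def mult_left)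

lemma hom_right: "x \<in> carrier G \<Longrightarrow> group_hom G H (\<omega> x)"
  by unfold_locales (simp add: hom_def mult_right)

lemma one_left [simp]: "y \<in> carrier G \<Longrightarrow> \<omega> \<one> y = \<one>\<^bsub>H\<^esub>"
  and one_right [simp]: "y \<in> carrier G \<Longrightarrow> \<omega> y \<one> = \<one>\<^bsub>H\<^esub>"
  and inv_left: "\<lbrakk>x \<in> carrier G; y \<in> carrier G\<rbrakk> \<Longrightarrow> \<omega> (inv x) y = inv\<^bsub>H\<^esub> \<omega> x y"
  and inv_right: "\<lbrakk>x \<in> carrier G; y \<in> carrier G\<rbrakk> \<Longrightarrow> \<omega> x (inv y) = inv\<^bsub>H\<^esub> \<omega> x y"
  and pow_left: "\<lbrakk>x \<in> carrier G; y \<in> carrier G\<rbrakk> \<Longrightarrow> \<omega> (x [^] (k::nat)) y = \<omega> x y [^]\<^bsub>H\<^esub> k"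
  and pow_right: "\<lbrakk>x \<in> carrier G; y \<in> carrier G\<rbrakk> \<Longrightarrow> \<omega> x (y [^] (k::nat)) = \<omega> x y [^]\<^bsub>H\<^esub> k"
  using group_hom.hom_one[OF hom_left[of y]] group_hom.hom_one[OF hom_right[of y]]
    group_hom.hom_inv[OF hom_left[of y], of x] group_hom.hom_inv[OF hom_right[of x], of y]
    group_hom.hom_nat_pow[OF hom_left[of y], of x k] group_hom.hom_nat_pow[OF hom_right[of x], of y k]
  by auto

lemma antisymmetric:
  assumes "x \<in> carrier G" "y \<in> carrier G"
  shows "\<omega> x y \<otimes>\<^bsub>H\<^esub> \<omega> y x = \<one>\<^bsub>H\<^esub>"
proof -
  have "\<omega> (x \<otimes> y) (x \<otimes> y) = \<omega> x y \<otimes>\<^bsub>H\<^esub> \<omega> y x"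
    using assms by (simp add: mult_left mult_right del: alternating) (simp add: H.m_comm)
  then show ?thesis using assms by simp
qed

lemma subgroup_radical: "subgroup radical G"
  by (rule G.subgroupI)
    (auto simp: radical_def mult_right inv_right intro: exI[of _ "\<one>"])

end

context alternating_pairing
begin

text \<open>
  Multiplying out, this is the product of the \<open>\<omega>(x\<^sub>j, g\<^sub>i)\<close> over \<open>j < i < n\<close>: the commutators
  that appear in \<open>g\<^sub>0 x\<^sub>0 g\<^sub>1 x\<^sub>1 \<dots>\<close> when the entries of \<open>x\<close> move right past the later entries
  of \<open>g\<close>.  Collecting the factors by \<open>i\<close> makes it a product over \<open>n\<close> indices, so that
  induction on \<open>n\<close> adds a single factor.
\<close>

definition twist :: "nat \<Rightarrow> (nat \<Rightarrow> 'a) \<Rightarrow> (nat \<Rightarrow> 'a) \<Rightarrow> 'b" where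
  "twist n g x = tuple_prod H n (\<lambda>i. \<omega> (tuple_prod G i x) (g i))"

definition twisted_group :: "nat \<Rightarrow> ((nat \<Rightarrow> 'a) \<times> 'b) monoid" where
  "twisted_group n = extension_group (K_group G n) H (twist n)"

lemma twist_closed [simp, intro]:
  "\<lbrakk>\<And>i. i < n \<Longrightarrow> g i \<in> carrier G; \<And>i. i < n \<Longrightarrow> x i \<in> carrier G\<rbrakk> \<Longrightarrow> twist n g x \<in> carrier H"
  unfolding twist_def by (auto intro!: H.tuple_prod_closed closed)

lemma twist_0 [simp]: "twist 0 g x = \<one>\<^bsub>H\<^esub>"
  by (simp add: twist_def)

lemma twist_Suc:
  assumes "\<And>i. i \<le> n \<Longrightarrow> g i \<in> carrier G" "\<And>i. i \<le> n \<Longrightarrow> x i \<in> carrier G"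
  shows "twist (Suc n) g x = twist n g x \<otimes>\<^bsub>H\<^esub> \<omega> (tuple_prod G n x) (g n)"
  unfolding twist_def using assms by (intro H.tuple_prod_Suc) auto

lemma twist_cong:
  "\<lbrakk>\<And>i. i < n \<Longrightarrow> g i = g' i; \<And>i. i < n \<Longrightarrow> x i = x' i\<rbrakk> \<Longrightarrow> twist n g x = twist n g' x'"
  unfolding twist_def by (auto intro!: tuple_prod_cong arg_cong2[where f = \<omega>])

lemma twist_mult_left:
  assumes "\<And>i. i < n \<Longrightarrow> g i \<in> carrier G" "\<And>i. i < n \<Longrightarrow> h i \<in> carrier G"
    "\<And>i. i < n \<Longrightarrow> x i \<in> carrier G"
  shows "twist n (\<lambda>i. g i \<otimes> h i) x = twist n g x \<otimes>\<^bsub>H\<^esub> twist n h x"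
  using assms by (induction n) (auto simp: twist_Suc mult_right H.m_ac)

lemma twist_mult_right:
  assumes "\<And>i. i < n \<Longrightarrow> g i \<in> carrier G" "\<And>i. i < n \<Longrightarrow> x i \<in> carrier G"
    "\<And>i. i < n \<Longrightarrow> y i \<in> carrier G"
  shows "twist n g (\<lambda>i. x i \<otimes> y i) = twist n g x \<otimes>\<^bsub>H\<^esub> twist n g y"
  using assms by (induction n) (auto simp: twist_Suc mult_left G.tuple_prod_mult H.m_ac)

lemma twist_one [simp]: "twist n (\<lambda>_. \<one>) (\<lambda>_. \<one>) = \<one>\<^bsub>H\<^esub>"
  by (induction n) (auto simp: twist_Suc)

lemma twist_restrict [simp]:
  "twist n (restrict g {..<n}) x = twist n g x" "twist n g (restrict x {..<n}) = twist n g x"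
  by (auto intro!: twist_cong)

text \<open>
  There are \<open>n (n - 1) / 2\<close> pairs \<open>j < i\<close>, and each contributes the same factor.
\<close>

lemma twist_const:
  assumes "e \<in> carrier G" "f \<in> carrier G"
  shows "twist n (\<lambda>_. e) (\<lambda>_. f) = \<omega> f e [^]\<^bsub>H\<^esub> (n * (n - 1) div 2)"
proof (induction n)
  case (Suc n)
  have "Suc n * (Suc n - 1) div 2 = n * (n - 1) div 2 + n"
    by (cases n) auto
  then show ?case
    using Suc assms by (simp add: twist_Suc G.tuple_prod_const pow_left H.nat_pow_mult)
qed simp

text \<open>
  The products over \<open>j < i\<close>, over \<open>j = i\<close> and over \<open>j > i\<close> together make up the full double
  product, which is \<open>\<omega>\<close> of the two tuple products; the part over \<open>j > i\<close> is the inverse of the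
  other twist by antisymmetry.  On tuples with trivial product this measures how far two
  elements of the twisted group are from commuting.
\<close>

lemma twist_swap:
  assumes "\<And>i. i < n \<Longrightarrow> g i \<in> carrier G" "\<And>i. i < n \<Longrightarrow> x i \<in> carrier G"
  shows "twist n g x \<otimes>\<^bsub>H\<^esub> tuple_prod H n (\<lambda>i. \<omega> (x i) (g i)) =
    twist n x g \<otimes>\<^bsub>H\<^esub> \<omega> (tuple_prod G n x) (tuple_prod G n g)"
  using assms
proof (induction n)
  case (Suc n)
  let ?S = "tuple_prod H n (\<lambda>i. \<omega> (x i) (g i))"
  define a b where "a = tuple_prod G n x" and "b = tuple_prod G n g"
  have c: "a \<in> carrier G" "b \<in> carrier G" "g n \<in> carrier G" "x n \<in> carrier G"
    "?S \<in> carrier H" "twist n g x \<in> carrier H" "twist n x g \<in> carrier H"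
    using Suc.prems by (auto simp: a_def b_def)
  have IH: "twist n g x \<otimes>\<^bsub>H\<^esub> ?S = twist n x g \<otimes>\<^bsub>H\<^esub> \<omega> a b"
    using Suc by (simp add: a_def b_def)
  have "twist (Suc n) g x \<otimes>\<^bsub>H\<^esub> tuple_prod H (Suc n) (\<lambda>i. \<omega> (x i) (g i)) =
      (twist n g x \<otimes>\<^bsub>H\<^esub> ?S) \<otimes>\<^bsub>H\<^esub> (\<omega> a (g n) \<otimes>\<^bsub>H\<^esub> \<omega> (x n) (g n))"
    using Suc.prems c by (simp add: twist_Suc H.tuple_prod_Suc a_def H.m_ac)
  also have "\<dots> = twist n x g \<otimes>\<^bsub>H\<^esub> \<omega> a b \<otimes>\<^bsub>H\<^esub> (\<omega> a (g n) \<otimes>\<^bsub>H\<^esub> \<omega> (x n) (g n))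
      \<otimes>\<^bsub>H\<^esub> (\<omega> b (x n) \<otimes>\<^bsub>H\<^esub> \<omega> (x n) b)"
    using c by (simp add: IH antisymmetric)
  also have "\<dots> = twist (Suc n) x g \<otimes>\<^bsub>H\<^esub> \<omega> (tuple_prod G (Suc n) x) (tuple_prod G (Suc n) g)"
    using Suc.prems c
    by (simp add: twist_Suc G.tuple_prod_Suc mult_left mult_right H.m_ac flip: a_def b_def)
  finally show ?case .
qed simp

lemma K_set_facts:
  assumes "g \<in> K_set G n"
  shows "i < n \<Longrightarrow> g i \<in> carrier G" "tuple_prod G n g = \<one>" "g \<in> (\<Pi>\<^sub>E i\<in>{..<n}. carrier G)"
  using assms by (auto simp: G.K_set_comm_iff)

lemma twisted_group_simps [simp]:
  "carrier (twisted_group n) = K_set G n \<times> carrier H"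
  "(g, h) \<otimes>\<^bsub>twisted_group n\<^esub> (x, k) =
    (\<lambda>i\<in>{..<n}. g i \<otimes> x i, h \<otimes>\<^bsub>H\<^esub> k \<otimes>\<^bsub>H\<^esub> twist n g x)"
  by (simp_all add: twisted_group_def)

lemma twisted_group_one: "\<one>\<^bsub>twisted_group n\<^esub> = ((\<lambda>i\<in>{..<n}. \<one>), \<one>\<^bsub>H\<^esub>)"
  by (simp add: twisted_group_def)

lemma twisted_group_group: "group (twisted_group n)"
  unfolding twisted_group_def
proof (rule extension_group_is_group[OF G.K_group_group H.comm_group_axioms])
  fix x y z assume "x \<in> carrier (K_group G n)" "y \<in> carrier (K_group G n)" "z \<in> carrier (K_group G n)"
  then show "twist n x y \<otimes>\<^bsub>H\<^esub> twist n (x \<otimes>\<^bsub>K_group G n\<^esub> y) z =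
      twist n y z \<otimes>\<^bsub>H\<^esub> twist n x (y \<otimes>\<^bsub>K_group G n\<^esub> z)"
    using K_set_facts(1) by (simp add: twist_mult_left twist_mult_right H.m_ac)
qed (auto dest: K_set_facts(1))

lemma twisted_group_commute_iff:
  assumes "(g, h) \<in> carrier (twisted_group n)" "(x, k) \<in> carrier (twisted_group n)"
  shows "(g, h) \<otimes>\<^bsub>twisted_group n\<^esub> (x, k) = (x, k) \<otimes>\<^bsub>twisted_group n\<^esub> (g, h) \<longleftrightarrow>
    tuple_prod H n (\<lambda>i. \<omega> (x i) (g i)) = \<one>\<^bsub>H\<^esub>"
proof -
  have g: "\<And>i. i < n \<Longrightarrow> g i \<in> carrier G" "tuple_prod G n g = \<one>"
    and x: "\<And>i. i < n \<Longrightarrow> x i \<in> carrier G" "tuple_prod G n x = \<one>"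
    using assms K_set_facts by auto
  have t: "twist n g x \<in> carrier H" "twist n x g \<in> carrier H"
      "tuple_prod H n (\<lambda>i. \<omega> (x i) (g i)) \<in> carrier H"
    using g x by auto
  have "twist n g x \<otimes>\<^bsub>H\<^esub> tuple_prod H n (\<lambda>i. \<omega> (x i) (g i)) = twist n x g"
    using twist_swap[OF g(1) x(1)] g x t by simp
  then have *: "twist n g x = twist n x g \<longleftrightarrow> tuple_prod H n (\<lambda>i. \<omega> (x i) (g i)) = \<one>\<^bsub>H\<^esub>"
    using t by (simp flip: \<open>twist n g x \<otimes>\<^bsub>H\<^esub> _ = twist n x g\<close>)
  have "(\<lambda>i\<in>{..<n}. g i \<otimes> x i) = (\<lambda>i\<in>{..<n}. x i \<otimes> g i)"
    using g x by (auto simp: G.m_comm)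
  then show ?thesis
    using assms t by (simp add: H.m_comm[of k h] *)
qed

end

section \<open>Splitting off a factor when the exponent divides the length\<close>

lemma (in group) pow_eq_one_if_exponent_dvd:
  assumes "group_exponent G dvd n" and "x \<in> carrier G"
  shows "x [^] n = \<one>"
proof -
  have "ord x dvd n"
    using assms dvd_trans[OF dvd_Lcm] by (auto simp: group_exponent_def)
  then show ?thesis using assms pow_eq_id by blast
qed

text \<open>
  A retraction onto a central subgroup splits the group as the product of that subgroup and the
  kernel.  The kernel is given by an embedding \<open>\<iota>\<close>, since in the application it is an isomorphic
  copy of a group of shorter tuples.
\<close>

lemma iso_DirProd_of_central_retraction:
  assumes "group T" "group G" "group U"
    and s: "s \<in> hom G T" and \<iota>: "\<iota> \<in> hom U T" "inj_on \<iota> (carrier U)" and r: "r \<in> hom T G"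
    and rs: "\<And>e. e \<in> carrier G \<Longrightarrow> r (s e) = e"
    and r\<iota>: "\<And>u. u \<in> carrier U \<Longrightarrow> r (\<iota> u) = \<one>\<^bsub>G\<^esub>"
    and ker: "\<And>t. \<lbrakk>t \<in> carrier T; r t = \<one>\<^bsub>G\<^esub>\<rbrakk> \<Longrightarrow> t \<in> \<iota> ` carrier U"
    and comm: "\<And>e u. \<lbrakk>e \<in> carrier G; u \<in> carrier T\<rbrakk> \<Longrightarrow> s e \<otimes>\<^bsub>T\<^esub> u = u \<otimes>\<^bsub>T\<^esub> s e"
  shows "T \<cong> G \<times>\<times> U"
proof -
  interpret T: group T by fact
  interpret G: group G by fact
  interpret U: group U by fact
  interpret s: group_hom G T s by unfold_locales (rule s)
  interpret \<iota>: group_hom U T \<iota> by unfold_locales (rule \<iota>)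
  interpret r: group_hom T G r by unfold_locales (rule r)
  define f where "f = (\<lambda>(e, u). s e \<otimes>\<^bsub>T\<^esub> \<iota> u)"
  have "f \<in> hom (G \<times>\<times> U) T"
  proof (rule homI)
    fix x y assume "x \<in> carrier (G \<times>\<times> U)" "y \<in> carrier (G \<times>\<times> U)"
    then obtain e u e' u' where x: "x = (e, u)" "e \<in> carrier G" "u \<in> carrier U"
      and y: "y = (e', u')" "e' \<in> carrier G" "u' \<in> carrier U" by (auto simp: DirProd_def)
    have "s e \<otimes>\<^bsub>T\<^esub> s e' \<otimes>\<^bsub>T\<^esub> (\<iota> u \<otimes>\<^bsub>T\<^esub> \<iota> u') = s e \<otimes>\<^bsub>T\<^esub> (s e' \<otimes>\<^bsub>T\<^esub> \<iota> u) \<otimes>\<^bsub>T\<^esub> \<iota> u'"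
      using x y by (simp add: T.m_assoc)
    also have "\<dots> = s e \<otimes>\<^bsub>T\<^esub> \<iota> u \<otimes>\<^bsub>T\<^esub> (s e' \<otimes>\<^bsub>T\<^esub> \<iota> u')"
      using x y comm[of e' "\<iota> u"] by (simp add: T.m_assoc)
    finally show "f (x \<otimes>\<^bsub>G \<times>\<times> U\<^esub> y) = f x \<otimes>\<^bsub>T\<^esub> f y"
      using x y by (simp add: f_def DirProd_def)
  qed (auto simp: f_def DirProd_def)
  moreover have "inj_on f (carrier (G \<times>\<times> U))"
  proof (rule inj_onI)
    fix x y assume "x \<in> carrier (G \<times>\<times> U)" "y \<in> carrier (G \<times>\<times> U)" and eq: "f x = f y"
    then obtain e u e' u' where x: "x = (e, u)" "e \<in> carrier G" "u \<in> carrier U"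
      and y: "y = (e', u')" "e' \<in> carrier G" "u' \<in> carrier U" by (auto simp: DirProd_def)
    have "r (f x) = e" "r (f y) = e'" using x y rs r\<iota> by (simp_all add: f_def)
    then have "e = e'" using eq by simp
    then have "\<iota> u = \<iota> u'" using eq x y by (simp add: f_def)
    then show "x = y" using \<iota>(2) x y \<open>e = e'\<close> by (simp add: inj_on_def)
  qed
  moreover have "carrier T \<subseteq> f ` carrier (G \<times>\<times> U)"
  proof
    fix t assume t: "t \<in> carrier T"
    define e where "e = r t"
    have e: "e \<in> carrier G" using t by (simp add: e_def)
    have "r (inv\<^bsub>T\<^esub> s e \<otimes>\<^bsub>T\<^esub> t) = \<one>\<^bsub>G\<^esub>"
      using t e rs by (simp) (simp add: e_def)
    then obtain u where u: "u \<in> carrier U" "inv\<^bsub>T\<^esub> s e \<otimes>\<^bsub>T\<^esub> t = \<iota> u"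
      using ker[of "inv\<^bsub>T\<^esub> s e \<otimes>\<^bsub>T\<^esub> t"] t e by auto
    have "f (e, u) = t"
      using t e by (simp add: f_def u(2)[symmetric] T.m_assoc[symmetric])
    then show "t \<in> f ` carrier (G \<times>\<times> U)"
      using e u(1) by (force simp: DirProd_def)
  qed
  ultimately have "f \<in> iso (G \<times>\<times> U) T"
    by (auto simp: iso_def bij_betw_def hom_def)
  then have "G \<times>\<times> U \<cong> T" by (auto simp: is_iso_def)
  then show ?thesis
    by (rule group.iso_sym[OF DirProd_group[OF assms(2,3)]])
qed

context alternating_pairing
begin

lemma pow_pairing: "alternating_pairing G H (\<lambda>x y. \<omega> x y [^]\<^bsub>H\<^esub> (k::nat))"
  by unfold_locales (auto simp: mult_left mult_right H.nat_pow_distrib)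

text \<open>
  A quadratic refinement of \<open>\<omega>\<close> on a subgroup that contains all squares.  The condition that \<open>q\<close>
  is trivial on squares is what makes one more generator \<open>x\<close> harmless: the requirement
  \<open>q(x x) = q(x)\<^sup>2 \<omega>(x, x)\<close> then holds with \<open>q(x) = 1\<close>.
\<close>

definition quadratic_on :: "'a set \<Rightarrow> ('a \<Rightarrow> 'b) \<Rightarrow> bool" where
  "quadratic_on B q \<longleftrightarrow> subgroup B G \<and>
    (\<forall>y\<in>carrier G. y \<otimes> y \<in> B \<and> q (y \<otimes> y) = \<one>\<^bsub>H\<^esub>) \<and> (\<forall>b\<in>B. q b \<in> carrier H) \<and>
    (\<forall>b\<in>B. \<forall>c\<in>B. q (b \<otimes> c) = q b \<otimes>\<^bsub>H\<^esub> q c \<otimes>\<^bsub>H\<^esub> \<omega> b c)"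

text \<open>
  As \<open>x\<^sup>2 \<in> B\<close>, the subgroup generated by \<open>B\<close> and \<open>x\<close> is \<open>B \<union> x B\<close>, and \<open>q(x b) = q(b) \<omega>(x, b)\<close> is the
  extension with \<open>q(x) = 1\<close>.  Values of order two make \<open>\<omega>\<close> symmetric, and then all cases of the
  quadratic identity reduce to the one on \<open>B\<close>.
\<close>

lemma quadratic_on_extend:
  assumes sym: "\<And>x y. \<lbrakk>x \<in> carrier G; y \<in> carrier G\<rbrakk> \<Longrightarrow> \<omega> x y \<otimes>\<^bsub>H\<^esub> \<omega> x y = \<one>\<^bsub>H\<^esub>"
    and Bq: "quadratic_on B q" and x: "x \<in> carrier G" "x \<notin> B"
  obtains B' q' where "quadratic_on B' q'" "B \<subseteq> B'" "x \<in> B'"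
proof -
  have B: "subgroup B G"
    and sq: "\<And>y. y \<in> carrier G \<Longrightarrow> y \<otimes> y \<in> B \<and> q (y \<otimes> y) = \<one>\<^bsub>H\<^esub>"
    and qH: "\<And>b. b \<in> B \<Longrightarrow> q b \<in> carrier H"
    and q: "\<And>b c. \<lbrakk>b \<in> B; c \<in> B\<rbrakk> \<Longrightarrow> q (b \<otimes> c) = q b \<otimes>\<^bsub>H\<^esub> q c \<otimes>\<^bsub>H\<^esub> \<omega> b c"
    using Bq by (auto simp: quadratic_on_def)
  interpret B: subgroup B G by (rule B)
  have BG: "b \<in> carrier G" if "b \<in> B" for b using that B.subset by auto
  define B' where "B' = B \<union> (\<otimes>) x ` B"
  \<comment> \<open>For \<open>z = x b\<close> the second branch is \<open>q(b) \<omega>(x, x b) = q(b) \<omega>(x, b)\<close>.\<close>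
  define q' where "q' z = (if z \<in> B then q z else q (inv x \<otimes> z) \<otimes>\<^bsub>H\<^esub> \<omega> x z)" for z
  have coset: "x \<otimes> b \<notin> B" if "b \<in> B" for b
  proof
    assume "x \<otimes> b \<in> B"
    then have "x \<otimes> b \<otimes> inv b \<in> B" using that by blast
    then show False using x that BG by (simp add: G.m_assoc)
  qed
  have q'B: "q' b = q b" if "b \<in> B" for b using that by (simp add: q'_def)
  have q'x: "q' (x \<otimes> b) = q b \<otimes>\<^bsub>H\<^esub> \<omega> x b" if "b \<in> B" for b
    using coset[OF that] x(1) that BG
    by (simp add: q'_def G.m_assoc[symmetric] mult_right)
  have xx: "x \<otimes> x \<in> B" "q (x \<otimes> x) = \<one>\<^bsub>H\<^esub>" using sq x by auto
  have symm: "\<omega> b c = \<omega> c b" if "b \<in> carrier G" "c \<in> carrier G" for b c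
    using H.inv_equality[OF sym[OF that]] H.inv_equality[OF antisymmetric[OF that(2,1)]] that by simp
  have cancel: "\<omega> b c \<otimes>\<^bsub>H\<^esub> (\<omega> b c \<otimes>\<^bsub>H\<^esub> h) = h" if "b \<in> carrier G" "c \<in> carrier G" "h \<in> carrier H" for b c h
    using sym[OF that(1,2)] that by (simp flip: H.m_assoc)
  have swap: "b \<otimes> (x \<otimes> c) = x \<otimes> (b \<otimes> c)"
      "x \<otimes> b \<otimes> c = x \<otimes> (b \<otimes> c)"
      "x \<otimes> b \<otimes> (x \<otimes> c) = x \<otimes> x \<otimes> (b \<otimes> c)"
    if "b \<in> B" "c \<in> B" for b c
    using x(1) BG that by (simp_all add: G.m_ac)
  have q'_mult: "q' (b \<otimes> c) = q' b \<otimes>\<^bsub>H\<^esub> q' c \<otimes>\<^bsub>H\<^esub> \<omega> b c" if "b \<in> B'" "c \<in> B'" for b c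
  proof -
    consider "b \<in> B" "c \<in> B" | c' where "b \<in> B" "c' \<in> B" "c = x \<otimes> c'"
      | b' where "b' \<in> B" "b = x \<otimes> b'" "c \<in> B"
      | b' c' where "b' \<in> B" "b = x \<otimes> b'" "c' \<in> B" "c = x \<otimes> c'"
      using \<open>b \<in> B'\<close> \<open>c \<in> B'\<close> by (auto simp: B'_def)
    then show ?thesis
    proof cases
      case 1 then show ?thesis using q by (simp add: q'B)
    next
      case 2
      then have "q' (b \<otimes> c) = q b \<otimes>\<^bsub>H\<^esub> q c' \<otimes>\<^bsub>H\<^esub> \<omega> b c' \<otimes>\<^bsub>H\<^esub> (\<omega> x b \<otimes>\<^bsub>H\<^esub> \<omega> x c')"
        using x(1) BG by (simp add: swap q'x q mult_right)
      then show ?thesis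
        using 2 x(1) BG qH by (simp add: q'x q'B mult_right symm[of b x] H.m_ac)
    next
      case 3
      then have "q' (b \<otimes> c) = q b' \<otimes>\<^bsub>H\<^esub> q c \<otimes>\<^bsub>H\<^esub> \<omega> b' c \<otimes>\<^bsub>H\<^esub> (\<omega> x b' \<otimes>\<^bsub>H\<^esub> \<omega> x c)"
        using x(1) BG by (simp add: swap q'x q mult_right)
      then show ?thesis
        using 3 x(1) BG qH by (simp add: q'x q'B mult_left H.m_ac)
    next
      case 4
      have "\<omega> (x \<otimes> x) (b' \<otimes> c') = \<one>\<^bsub>H\<^esub>"
        using 4 x(1) BG sym by (simp add: mult_left)
      then have "q' (b \<otimes> c) = q b' \<otimes>\<^bsub>H\<^esub> q c' \<otimes>\<^bsub>H\<^esub> \<omega> b' c'"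
        using 4 x(1) BG xx qH q[of "x \<otimes> x" "b' \<otimes> c'"] by (simp add: swap q'B q)
      then show ?thesis
        using 4 x(1) BG qH
        by (simp add: q'x mult_left mult_right symm[of b' x] H.m_ac cancel sym)
    qed
  qed
  have q'H: "q' b \<in> carrier H" if "b \<in> B'" for b
    using that x(1) BG qH by (auto simp: B'_def q'B q'x)
  have "subgroup B' G"
  proof (rule G.subgroupI)
    show "B' \<subseteq> carrier G" using x(1) BG by (auto simp: B'_def)
    show "B' \<noteq> {}" using xx(1) by (auto simp: B'_def)
    fix b assume "b \<in> B'"
    then consider "b \<in> B" | b' where "b' \<in> B" "b = x \<otimes> b'" by (auto simp: B'_def)
    then show "inv b \<in> B'"
    proof cases
      case 2
      then have "inv b = x \<otimes> (inv (x \<otimes> x) \<otimes> inv b')"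
        using x(1) BG by (simp add: G.inv_mult G.m_assoc[symmetric])
      then show ?thesis using 2 xx by (auto simp: B'_def)
    qed (auto simp: B'_def)
  next
    fix b c assume "b \<in> B'" "c \<in> B'"
    then show "b \<otimes> c \<in> B'"
      using xx by (auto simp: B'_def swap)
  qed
  moreover have "x \<in> B'"
    unfolding B'_def using x(1) by (intro UnI2 image_eqI[OF _ B.one_closed]) simp
  moreover have "B \<subseteq> B'" by (auto simp: B'_def)
  moreover have "quadratic_on B' q'"
    using \<open>subgroup B' G\<close> \<open>B \<subseteq> B'\<close> q'_mult q'H sq q'B by (auto simp: quadratic_on_def)
  ultimately show ?thesis using that by blast
qed

text \<open>
  For two-torsion values \<open>\<omega>\<close> factors through the vector space \<open>G / G\<^sup>2\<close> over the field with two
  elements, where an alternating form has a quadratic refinement.  Extending from the subgroup of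
  squares, one element at a time, replaces the choice of a basis.
\<close>

lemma quadratic_refinement:
  assumes fin: "finite (carrier G)"
    and sym: "\<And>x y. \<lbrakk>x \<in> carrier G; y \<in> carrier G\<rbrakk> \<Longrightarrow> \<omega> x y \<otimes>\<^bsub>H\<^esub> \<omega> x y = \<one>\<^bsub>H\<^esub>"
  obtains q where "\<And>x. x \<in> carrier G \<Longrightarrow> q x \<in> carrier H"
    "\<And>x y. \<lbrakk>x \<in> carrier G; y \<in> carrier G\<rbrakk> \<Longrightarrow> q (x \<otimes> y) = q x \<otimes>\<^bsub>H\<^esub> q y \<otimes>\<^bsub>H\<^esub> \<omega> x y"
proof -
  have trivial: "quadratic_on ((\<lambda>y. y \<otimes> y) ` carrier G) (\<lambda>_. \<one>\<^bsub>H\<^esub>)"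
  proof -
    have "subgroup ((\<lambda>y. y \<otimes> y) ` carrier G) G"
    proof -
      interpret sq: group_hom G G "\<lambda>y. y \<otimes> y"
        by unfold_locales (auto simp: hom_def G.m_ac)
      show ?thesis by (rule sq.img_is_subgroup)
    qed
    then show ?thesis
      using sym by (auto simp: quadratic_on_def mult_left mult_right)
  qed
  have "\<exists>B. (\<exists>q. quadratic_on B q) \<and> (\<forall>C. (\<exists>q. quadratic_on C q) \<longrightarrow> card C \<le> card B)"
  proof (rule ex_has_greatest_nat[where P = "\<lambda>B. \<exists>q. quadratic_on B q" and f = card and b = "Suc (card (carrier G))"])
    show "\<exists>q. quadratic_on ((\<lambda>y. y \<otimes> y) ` carrier G) q" using trivial by blast
    show "\<forall>C. (\<exists>q. quadratic_on C q) \<longrightarrow> card C < Suc (card (carrier G))"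
      using fin by (auto simp: quadratic_on_def less_Suc_eq_le intro!: card_mono subgroup.subset)
  qed
  then obtain B q where B: "quadratic_on B q" and max: "\<And>C q'. quadratic_on C q' \<Longrightarrow> card C \<le> card B"
    by blast
  have "carrier G \<subseteq> B"
  proof (rule ccontr)
    assume "\<not> carrier G \<subseteq> B"
    then obtain x where x: "x \<in> carrier G" "x \<notin> B" by blast
    obtain B' q' where B': "quadratic_on B' q'" "B \<subseteq> B'" "x \<in> B'"
      using quadratic_on_extend[OF sym B x] by blast
    have "finite B'" using B'(1) fin by (auto simp: quadratic_on_def intro: finite_subset dest: subgroup.subset)
    then have "card B < card B'" using B' x by (intro psubset_card_mono) auto
    then show False using max[OF B'(1)] by simp
  qed
  then show ?thesis using B that[of q] by (auto simp: quadratic_on_def subset_iff)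
qed

text \<open>
  The diagonal \<open>e \<mapsto> ((e, \<dots>, e), q(e))\<close> lands in the twisted group because \<open>e\<^sup>n = 1\<close>.  Its elements
  commute with \<open>(x, k)\<close> since the product of the \<open>\<omega>(x\<^sub>i, e)\<close> is \<open>\<omega>(1, e)\<close>.  Dividing by the diagonal
  element with the same last entry leaves a tuple with last entry \<open>1\<close>.
\<close>

proposition twisted_group_split:
  assumes fin: "finite (carrier G)" and exp: "\<And>x. x \<in> carrier G \<Longrightarrow> x [^] Suc m = \<one>"
  shows "twisted_group (Suc m) \<cong> G \<times>\<times> twisted_group m"
proof -
  let ?T = "twisted_group (Suc m)"
  define k where "k = Suc m * m div 2"
  \<comment> \<open>\<open>twist_const\<close> gives the exponent \<open>k\<close>; as \<open>2 k = n (n - 1)\<close>, the values of \<open>\<omega>\<^sup>k\<close> have order at most two.\<close>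
  interpret wk: alternating_pairing G H "\<lambda>x y. \<omega> x y [^]\<^bsub>H\<^esub> k" by (rule pow_pairing)
  have 2: "\<omega> x y [^]\<^bsub>H\<^esub> k \<otimes>\<^bsub>H\<^esub> \<omega> x y [^]\<^bsub>H\<^esub> k = \<one>\<^bsub>H\<^esub>" if "x \<in> carrier G" "y \<in> carrier G" for x y
  proof -
    have "even (Suc m * m)" by simp
    then have "k + k = Suc m * m" unfolding k_def by (metis dvd_mult_div_cancel mult_2)
    then have "\<omega> x y [^]\<^bsub>H\<^esub> k \<otimes>\<^bsub>H\<^esub> \<omega> x y [^]\<^bsub>H\<^esub> k = \<omega> (x [^] Suc m) y [^]\<^bsub>H\<^esub> m"
      using that by (simp only: H.nat_pow_mult closed pow_left H.nat_pow_pow)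
    then show ?thesis using that exp by simp
  qed
  obtain q where qH: "\<And>x. x \<in> carrier G \<Longrightarrow> q x \<in> carrier H"
    and q: "\<And>x y. \<lbrakk>x \<in> carrier G; y \<in> carrier G\<rbrakk> \<Longrightarrow>
      q (x \<otimes> y) = q x \<otimes>\<^bsub>H\<^esub> q y \<otimes>\<^bsub>H\<^esub> (\<omega> x y [^]\<^bsub>H\<^esub> k)"
    using wk.quadratic_refinement[OF fin 2] by blast
  have symk: "\<omega> x y [^]\<^bsub>H\<^esub> k = \<omega> y x [^]\<^bsub>H\<^esub> k" if "x \<in> carrier G" "y \<in> carrier G" for x y
    using H.inv_equality[OF 2[OF that]] H.inv_equality[OF wk.antisymmetric[OF that(2,1)]] that by simp
  interpret T: group "?T" by (rule twisted_group_group)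
  define s where "s e = ((\<lambda>i\<in>{..<Suc m}. e), q e)" for e
  define \<iota> :: "(nat \<Rightarrow> 'a) \<times> 'b \<Rightarrow> (nat \<Rightarrow> 'a) \<times> 'b" where "\<iota> = (\<lambda>(g, h). (g(m := \<one>), h))"
  define r :: "(nat \<Rightarrow> 'a) \<times> 'b \<Rightarrow> 'a" where "r = (\<lambda>(g, h). g m)"
  have const: "(\<lambda>i\<in>{..<Suc m}. e) \<in> K_set G (Suc m)" if "e \<in> carrier G" for e
  proof -
    have "tuple_prod G (Suc m) (\<lambda>i\<in>{..<Suc m}. e) = tuple_prod G (Suc m) (\<lambda>i. e)"
      by (intro tuple_prod_cong) auto
    then show ?thesis using that exp by (simp add: G.K_set_comm_iff G.tuple_prod_const)
  qed
  have ext_prod: "tuple_prod G (Suc m) (g(m := \<one>)) = tuple_prod G m g"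
    if "\<And>i. i < m \<Longrightarrow> g i \<in> carrier G" for g
  proof -
    have "tuple_prod G m (g(m := \<one>)) = tuple_prod G m g" by (intro tuple_prod_cong) auto
    then show ?thesis using that by (simp add: G.tuple_prod_Suc)
  qed
  have ext_twist: "twist (Suc m) (g(m := \<one>)) (x(m := \<one>)) = twist m g x"
    if "\<And>i. i < m \<Longrightarrow> g i \<in> carrier G" "\<And>i. i < m \<Longrightarrow> x i \<in> carrier G" for g x
  proof -
    have "twist m (g(m := \<one>)) (x(m := \<one>)) = twist m g x" by (intro twist_cong) auto
    moreover have "tuple_prod G m (x(m := \<one>)) \<in> carrier G" using that by auto
    ultimately show ?thesis using that by (subst twist_Suc) auto
  qed
  have ext_K: "g(m := \<one>) \<in> K_set G (Suc m)" if "g \<in> K_set G m" for g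
    using K_set_facts[OF that] ext_prod[of g]
    by (auto simp: G.K_set_comm_iff PiE_iff extensional_def)
  show ?thesis
  proof (rule iso_DirProd_of_central_retraction)
    show "group (?T)" "group G" "group (twisted_group m)"
      by (auto intro: twisted_group_group)
    show "s \<in> hom G (?T)"
    proof (rule homI)
      fix e f assume ef: "e \<in> carrier G" "f \<in> carrier G"
      have "twist (Suc m) (\<lambda>i\<in>{..<Suc m}. e) (\<lambda>i\<in>{..<Suc m}. f) = \<omega> e f [^]\<^bsub>H\<^esub> k"
        using ef symk[of f e] twist_const[of e f "Suc m"] by (simp only: twist_restrict k_def diff_Suc_1)
      then show "s (e \<otimes> f) = s e \<otimes>\<^bsub>?T\<^esub> s f"
        using ef by (auto simp: s_def q)
    qed (use const qH in \<open>simp add: s_def\<close>)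
    show "\<iota> \<in> hom (twisted_group m) (?T)"
    proof (rule homI)
      fix t u assume "t \<in> carrier (twisted_group m)" "u \<in> carrier (twisted_group m)"
      then obtain g h x l where t: "t = (g, h)" "u = (x, l)" "g \<in> K_set G m" "x \<in> K_set G m"
        by auto
      have "(\<lambda>i\<in>{..<m}. g i \<otimes> x i)(m := \<one>) =
          (\<lambda>i\<in>{..<Suc m}. (g(m := \<one>)) i \<otimes> (x(m := \<one>)) i)"
        by (auto simp: fun_eq_iff)
      then show "\<iota> (t \<otimes>\<^bsub>twisted_group m\<^esub> u) = \<iota> t \<otimes>\<^bsub>?T\<^esub> \<iota> u"
        using t K_set_facts(1) by (simp add: \<iota>_def ext_twist)
    qed (use ext_K in \<open>auto simp: \<iota>_def\<close>)
    show "inj_on \<iota> (carrier (twisted_group m))"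
    proof (rule inj_onI)
      fix t u assume "t \<in> carrier (twisted_group m)" "u \<in> carrier (twisted_group m)" and eq: "\<iota> t = \<iota> u"
      then obtain g h x l where t: "t = (g, h)" "u = (x, l)" "g \<in> K_set G m" "x \<in> K_set G m"
        by auto
      have "g i = x i" for i
        using eq K_set_facts(3)[OF t(3)] K_set_facts(3)[OF t(4)]
        by (cases "i = m") (auto simp: t \<iota>_def PiE_iff extensional_def fun_eq_iff split: if_splits)
      then show "t = u" using eq t by (auto simp: \<iota>_def)
    qed
    show "r \<in> hom (?T) G"
      by (rule homI) (auto simp: r_def dest: K_set_facts(1))
    show "r (s e) = e" for e by (simp add: r_def s_def)
    show "r (\<iota> u) = \<one>" for u by (simp add: r_def \<iota>_def split: prod.splits)
    show "t \<in> \<iota> ` carrier (twisted_group m)"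
      if t: "t \<in> carrier (?T)" "r t = \<one>" for t
    proof -
      obtain g h where g: "t = (g, h)" "g \<in> K_set G (Suc m)" "h \<in> carrier H" "g m = \<one>"
        using t by (auto simp: r_def)
      define g' where "g' = restrict g {..<m}"
      have "g'(m := \<one>) = g"
        using K_set_facts(3)[OF g(2)] g(4)
        by (auto simp: g'_def fun_eq_iff PiE_iff extensional_def)
      moreover have "g' i \<in> carrier G" if "i < m" for i
        using K_set_facts(1)[OF g(2)] that by (simp add: g'_def)
      ultimately have "g' \<in> K_set G m"
        using K_set_facts[OF g(2)] ext_prod[of g'] by (auto simp: G.K_set_comm_iff g'_def)
      then show ?thesis
        using g \<open>g'(m := \<one>) = g\<close> by (intro image_eqI[of _ _ "(g', h)"]) (auto simp: \<iota>_def)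
    qed
    show "s e \<otimes>\<^bsub>?T\<^esub> u = u \<otimes>\<^bsub>?T\<^esub> s e"
      if e: "e \<in> carrier G" and u: "u \<in> carrier (?T)" for e u
    proof -
      obtain x l where x: "u = (x, l)" "x \<in> K_set G (Suc m)" using u by auto
      interpret we: group_hom G H "\<lambda>x. \<omega> x e" by (rule hom_left[OF e])
      have "tuple_prod H (Suc m) (\<lambda>i. \<omega> (x i) ((\<lambda>i\<in>{..<Suc m}. e) i)) =
          tuple_prod H (Suc m) (\<lambda>i. \<omega> (x i) e)"
        by (intro tuple_prod_cong) auto
      also have "\<dots> = \<one>\<^bsub>H\<^esub>"
        using we.hom_tuple_prod[of "Suc m" x] K_set_facts[OF x(2)] by simp
      finally show ?thesis
        using twisted_group_commute_iff[of "\<lambda>i\<in>{..<Suc m}. e" "q e" "Suc m" x l] const[OF e] qH[OF e] u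
        by (simp add: s_def x(1) del: twisted_group_simps(2)) 
    qed
  qed
qed

end

section \<open>The centre of a twisted group\<close>

context alternating_pairing
begin

text \<open>
  The test tuples for the centre: \<open>x\<close> and its inverse in two positions have trivial product.
\<close>

lemma pairing_two_entries:
  assumes g: "\<And>i. i < n \<Longrightarrow> g i \<in> carrier G" and x: "x \<in> carrier G" and j: "0 < j" "j < n"
  defines "f \<equiv> (\<lambda>i\<in>{..<n}. if i = 0 then x else if i = j then inv x else \<one>)"
  shows "f \<in> K_set G n"
    and "tuple_prod H n (\<lambda>i. \<omega> (f i) (g i)) = \<omega> x (g 0) \<otimes>\<^bsub>H\<^esub> inv\<^bsub>H\<^esub> \<omega> x (g j)"
proof -
  have "tuple_prod G n f = x \<otimes> inv x"
    using x j G.tuple_prod_two_entries[of n f j] by (simp add: f_def)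
  then show "f \<in> K_set G n"
    using x by (auto simp: G.K_set_comm_iff f_def)
  show "tuple_prod H n (\<lambda>i. \<omega> (f i) (g i)) = \<omega> x (g 0) \<otimes>\<^bsub>H\<^esub> inv\<^bsub>H\<^esub> \<omega> x (g j)"
    using x j g by (subst H.tuple_prod_two_entries[of n _ j]) (auto simp: f_def inv_left)
qed

text \<open>
  Coprimality enters once: the common value of the \<open>\<omega>(x, g\<^sub>i)\<close> has order dividing both \<open>n\<close> and
  the order of \<open>G\<close>.
\<close>

proposition center_twisted_group:
  assumes fin: "finite (carrier G)" and n: "n \<ge> 2" and cop: "coprime n (order G)"
  shows "center (twisted_group n) = {g \<in> K_set G n. \<forall>i<n. g i \<in> radical} \<times> carrier H"
proof (intro equalityI subsetI)
  fix t assume t: "t \<in> {g \<in> K_set G n. \<forall>i<n. g i \<in> radical} \<times> carrier H"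
  then obtain g h where g: "t = (g, h)" "g \<in> K_set G n" "\<And>i. i < n \<Longrightarrow> g i \<in> radical" "h \<in> carrier H"
    by auto
  have "(g, h) \<otimes>\<^bsub>twisted_group n\<^esub> u = u \<otimes>\<^bsub>twisted_group n\<^esub> (g, h)"
    if u: "u \<in> carrier (twisted_group n)" for u
  proof -
    obtain x k where x: "u = (x, k)" "x \<in> K_set G n" using u by auto
    have "tuple_prod H n (\<lambda>i. \<omega> (x i) (g i)) = tuple_prod H n (\<lambda>i. \<one>\<^bsub>H\<^esub>)"
      using g(3) K_set_facts(1)[OF x(2)] by (intro tuple_prod_cong) (simp add: radical_def)
    then show ?thesis
      using twisted_group_commute_iff[of g h n x k] u g by (simp add: x(1) del: twisted_group_simps(2))
  qed
  then show "t \<in> center (twisted_group n)"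
    using g by (auto simp: center_def simp del: twisted_group_simps(2))
next
  fix t assume t: "t \<in> center (twisted_group n)"
  then obtain g h where g: "t = (g, h)" "g \<in> K_set G n" "h \<in> carrier H"
    by (auto simp: center_def)
  note gG = K_set_facts[OF g(2)]
  have orth: "tuple_prod H n (\<lambda>i. \<omega> (x i) (g i)) = \<one>\<^bsub>H\<^esub>" if "x \<in> K_set G n" for x
  proof -
    have "(x, \<one>\<^bsub>H\<^esub>) \<in> carrier (twisted_group n)" using that by simp
    then have "(g, h) \<otimes>\<^bsub>twisted_group n\<^esub> (x, \<one>\<^bsub>H\<^esub>) = (x, \<one>\<^bsub>H\<^esub>) \<otimes>\<^bsub>twisted_group n\<^esub> (g, h)"
      using t g(1) unfolding center_def by blast
    then show ?thesis
      using twisted_group_commute_iff[of g h n x "\<one>\<^bsub>H\<^esub>"] g that by (simp del: twisted_group_simps(2))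
  qed
  have eq0: "\<omega> x (g j) = \<omega> x (g 0)" if "x \<in> carrier G" "j < n" for x j
  proof (cases "j = 0")
    case False
    then have j: "0 < j" by simp
    note two = pairing_two_entries[OF gG(1) that(1) j that(2)]
    have "\<omega> x (g 0) \<otimes>\<^bsub>H\<^esub> inv\<^bsub>H\<^esub> \<omega> x (g j) = \<one>\<^bsub>H\<^esub>"
      by (rule trans[OF two(2)[symmetric] orth[OF two(1)]])
    then show ?thesis
      using that gG(1)[of j] gG(1)[of 0] n by (simp add: H.inv_solve_right')
  qed simp
  have "\<omega> x (g j) = \<one>\<^bsub>H\<^esub>" if x: "x \<in> carrier G" and j: "j < n" for x j
  proof -
    have g0: "g 0 \<in> carrier G" using gG(1)[of 0] n by simp
    interpret wx: group_hom G H "\<omega> x" by (rule hom_right[OF x])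
    have "\<omega> x (g 0) [^]\<^bsub>H\<^esub> n = tuple_prod H n (\<lambda>_. \<omega> x (g 0))"
      using x g0 by (simp add: H.tuple_prod_const)
    also have "\<dots> = tuple_prod H n (\<lambda>i. \<omega> x (g i))"
      by (intro tuple_prod_cong) (rule eq0[OF x, symmetric])
    also have "\<dots> = \<one>\<^bsub>H\<^esub>"
      using wx.hom_tuple_prod[of n g] gG x by simp
    finally have "H.ord (\<omega> x (g 0)) dvd n"
      using x g0 by (simp add: H.pow_eq_id)
    moreover have "\<omega> x (g 0) [^]\<^bsub>H\<^esub> order G = \<one>\<^bsub>H\<^esub>"
      using x g0 G.pow_order_eq_1[OF g0] by (simp flip: pow_right)
    then have "H.ord (\<omega> x (g 0)) dvd order G"
      using x g0 by (simp add: H.pow_eq_id)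
    ultimately have "H.ord (\<omega> x (g 0)) = 1"
      using cop by (metis coprime_common_divisor_nat)
    then show ?thesis
      using x g0 eq0[OF x j] H.ord_eq_1 by simp
  qed
  then show "t \<in> {g \<in> K_set G n. \<forall>i<n. g i \<in> radical} \<times> carrier H"
    using g gG(1) by (auto simp: radical_def)
qed

lemma K_set_radical: "K_set (G\<lparr>carrier := radical\<rparr>) n = {g \<in> K_set G n. \<forall>i<n. g i \<in> radical}"
proof -
  interpret Z: comm_group "G\<lparr>carrier := radical\<rparr>"
    by (rule group.group_comm_groupI[OF G.subgroup_imp_group[OF subgroup_radical]])
      (auto simp: radical_def G.m_comm)
  show ?thesis
    unfolding Z.K_set_comm_iff[abs_def] G.K_set_comm_iff set_eq_iff
    using G.subgroupE(1)[OF subgroup_radical]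
    by (auto simp: Z.K_set_comm_iff G.K_set_comm_iff PiE_iff)
qed

proposition center_twisted_group_iso:
  assumes "finite (carrier G)" "n \<ge> 2" "coprime n (order G)"
  shows "(twisted_group n)\<lparr>carrier := center (twisted_group n)\<rparr> \<cong>
    H \<times>\<times> K_group (G\<lparr>carrier := radical\<rparr>) n"
proof -
  have one: "twist n g x = \<one>\<^bsub>H\<^esub>" if "g \<in> K_set (G\<lparr>carrier := radical\<rparr>) n" "x \<in> K_set G n" for g x
  proof -
    have "g i \<in> radical" if "i < n" for i
      using \<open>g \<in> _\<close> that by (simp add: K_set_radical)
    then have "twist n g x = tuple_prod H n (\<lambda>i. \<one>\<^bsub>H\<^esub>)"
      unfolding twist_def using that K_set_facts(1)[OF that(2)]
      by (intro tuple_prod_cong) (auto simp: radical_def intro!: G.tuple_prod_closed)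
    then show ?thesis by simp
  qed
  have "(\<lambda>(g, h). (h, g)) \<in> iso ((twisted_group n)\<lparr>carrier := center (twisted_group n)\<rparr>)
      (H \<times>\<times> K_group (G\<lparr>carrier := radical\<rparr>) n)"
    unfolding iso_def
  proof (intro CollectI conjI)
    show "(\<lambda>(g, h). (h, g)) \<in> hom ((twisted_group n)\<lparr>carrier := center (twisted_group n)\<rparr>)
      (H \<times>\<times> K_group (G\<lparr>carrier := radical\<rparr>) n)"
      using one by (auto simp: hom_def center_twisted_group[OF assms] K_set_radical DirProd_def)
    show "bij_betw (\<lambda>(g, h). (h, g)) (carrier ((twisted_group n)\<lparr>carrier := center (twisted_group n)\<rparr>))
      (carrier (H \<times>\<times> K_group (G\<lparr>carrier := radical\<rparr>) n))"
      by (auto simp: bij_betw_def inj_on_def center_twisted_group[OF assms] K_set_radical DirProd_def)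
  qed
  then show ?thesis by (auto simp: is_iso_def)
qed

end

lemma iso_center:
  assumes "group T" "group U" "T \<cong> U"
  shows "T\<lparr>carrier := center T\<rparr> \<cong> U\<lparr>carrier := center U\<rparr>"
proof -
  interpret T: group T by fact
  interpret U: group U by fact
  obtain f where f: "f \<in> iso T U" using assms by (auto simp: is_iso_def)
  then interpret f: group_hom T U f by unfold_locales (simp add: iso_def)
  have inj: "inj_on f (carrier T)" and img: "f ` carrier T = carrier U"
    using f by (auto simp: iso_def bij_betw_def)
  have center: "f z \<in> center U \<longleftrightarrow> z \<in> center T" if z: "z \<in> carrier T" for z
  proof -
    have "f z \<in> center U \<longleftrightarrow> (\<forall>x\<in>carrier T. f z \<otimes>\<^bsub>U\<^esub> f x = f x \<otimes>\<^bsub>U\<^esub> f z)"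
      using z by (auto simp: center_def img[symmetric])
    also have "\<dots> \<longleftrightarrow> (\<forall>x\<in>carrier T. z \<otimes>\<^bsub>T\<^esub> x = x \<otimes>\<^bsub>T\<^esub> z)"
      using z inj by (simp flip: f.hom_mult add: inj_on_eq_iff)
    finally show ?thesis using z by (simp add: center_def)
  qed
  have sub: "center T \<subseteq> carrier T" "center U \<subseteq> carrier U" by (auto simp: center_def)
  have "f ` center T = center U"
  proof
    show "f ` center T \<subseteq> center U" using center sub by blast
    show "center U \<subseteq> f ` center T"
    proof
      fix u assume u: "u \<in> center U"
      then obtain z where "z \<in> carrier T" "u = f z" using sub img by blast
      then show "u \<in> f ` center T" using u center by blast
    qed
  qed
  then have "f \<in> iso (T\<lparr>carrier := center T\<rparr>) (U\<lparr>carrier := center U\<rparr>)"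
    using inj sub by (auto simp: iso_def bij_betw_def hom_def inj_on_subset subset_iff)
  then show ?thesis by (auto simp: is_iso_def)
qed

section \<open>Central extensions of abelian groups\<close>

text \<open>
  The quotient is abelian, so that all commutators of \<open>E\<close> are central and \<open>E\<close> has class at most
  two.
\<close>

locale central_extension = E: group E + G: comm_group G
  for E :: "('e, 'n) monoid_scheme" (structure) and G :: "('a, 'm) monoid_scheme" +
  fixes \<rho> :: "'e \<Rightarrow> 'a"
  assumes epi: "\<rho> \<in> epi E G" and central: "kernel E G \<rho> \<subseteq> center E"
begin

sublocale group_hom E G \<rho>
  using epi by unfold_locales (simp add: epi_def)

abbreviation commutator_group :: "('e, 'n) monoid_scheme" where
  "commutator_group \<equiv> E\<lparr>carrier := derived E (carrier E)\<rparr>"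

definition section_map :: "'a \<Rightarrow> 'e" where
  "section_map = inv_into (carrier E) \<rho>"

abbreviation commutator :: "'e \<Rightarrow> 'e \<Rightarrow> 'e" where
  "commutator x y \<equiv> x \<otimes> y \<otimes> inv x \<otimes> inv y"

definition pairing :: "'a \<Rightarrow> 'a \<Rightarrow> 'e" where
  "pairing x y = commutator (section_map x) (section_map y)"

lemma section_map: "x \<in> carrier G \<Longrightarrow> section_map x \<in> carrier E \<and> \<rho> (section_map x) = x"
  using epi by (auto simp: section_map_def epi_def inv_into_into f_inv_into_f)

lemma kernel_commute:
  assumes "z \<in> carrier E" "\<rho> z = \<one>\<^bsub>G\<^esub>" "x \<in> carrier E"
  shows "z \<otimes> x = x \<otimes> z"
  using central assms by (auto simp: kernel_def center_def)

lemma derived_sub_kernel: "derived E (carrier E) \<subseteq> kernel E G \<rho>"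
proof -
  have "\<rho> ` derived E (carrier E) = {\<one>\<^bsub>G\<^esub>}"
    using derived_img[of "carrier E"] epi G.derived_eq_singleton[of "carrier G"] by (simp add: epi_def)
  then show ?thesis
    using E.derived_in_carrier[of "carrier E"] by (auto simp: kernel_def)
qed

lemma derived_facts:
  assumes "z \<in> derived E (carrier E)"
  shows "z \<in> carrier E" "\<rho> z = \<one>\<^bsub>G\<^esub>"
  using derived_sub_kernel assms by (auto simp: kernel_def)

lemma commutator_in_derived:
  "\<lbrakk>x \<in> carrier E; y \<in> carrier E\<rbrakk> \<Longrightarrow> commutator x y \<in> derived E (carrier E)"
  unfolding derived_def by (rule generate.incl) auto

lemma derived_subgroup: "subgroup (derived E (carrier E)) E"
  by (rule E.derived_is_subgroup) simp

lemma comm_group_derived: "comm_group commutator_group"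
proof (rule group.group_comm_groupI)
  show "group commutator_group"
    by (rule E.subgroup_imp_group[OF derived_subgroup])
qed (use derived_facts kernel_commute in auto)

lemma commutator_eqI:
  assumes "x \<in> carrier E" "y \<in> carrier E" "z \<in> carrier E" "x \<otimes> y = z \<otimes> (y \<otimes> x)"
  shows "commutator x y = z"
  using assms by (simp add: E.m_assoc E.inv_solve_right' flip: E.inv_mult_group)

lemma commutator_swap:
  assumes "x \<in> carrier E" "y \<in> carrier E"
  shows "x \<otimes> y = commutator x y \<otimes> (y \<otimes> x)"
  using assms by (simp add: E.m_assoc) (simp add: E.m_assoc[symmetric])

lemma commutator_mult_left:
  assumes "x \<in> carrier E" "y \<in> carrier E" "z \<in> carrier E"
  shows "commutator (x \<otimes> y) z = commutator x z \<otimes> commutator y z"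
proof -
  define a b where "a = commutator x z" and "b = commutator y z"
  have ab: "a \<in> carrier E" "b \<in> carrier E" "\<rho> a = \<one>\<^bsub>G\<^esub>" "\<rho> b = \<one>\<^bsub>G\<^esub>"
    using commutator_in_derived assms derived_facts by (auto simp: a_def b_def)
  have "x \<otimes> y \<otimes> z = x \<otimes> (b \<otimes> (z \<otimes> y))"
    using assms commutator_swap[of y z] by (simp add: E.m_assoc b_def)
  also have "\<dots> = b \<otimes> (x \<otimes> z) \<otimes> y"
    using assms ab kernel_commute[of b x] by (simp add: E.m_assoc[symmetric])
  also have "\<dots> = b \<otimes> (a \<otimes> (z \<otimes> x)) \<otimes> y"
    using assms commutator_swap[of x z] by (simp add: a_def)
  also have "\<dots> = a \<otimes> b \<otimes> (z \<otimes> (x \<otimes> y))"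
    using assms ab kernel_commute[of b a] by (simp add: E.m_assoc[symmetric])
  finally have "commutator (x \<otimes> y) z = a \<otimes> b"
    using assms ab by (intro commutator_eqI) auto
  then show ?thesis by (simp add: a_def b_def)
qed

lemma commutator_inverse:
  assumes "x \<in> carrier E" "y \<in> carrier E"
  shows "commutator y x = inv commutator x y"
  using assms by (simp add: E.inv_mult_group E.m_assoc)

lemma commutator_mult_right:
  assumes "x \<in> carrier E" "y \<in> carrier E" "z \<in> carrier E"
  shows "commutator z (x \<otimes> y) = commutator z x \<otimes> commutator z y"
proof -
  have "commutator z (x \<otimes> y) = inv (commutator x z \<otimes> commutator y z)"
    using assms commutator_inverse[of "x \<otimes> y" z] commutator_mult_left by simp
  also have "\<dots> = commutator z y \<otimes> commutator z x"
    using assms by (simp add: E.inv_mult_group E.m_assoc)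
  also have "\<dots> = commutator z x \<otimes> commutator z y"
    using assms derived_facts[OF commutator_in_derived] by (intro kernel_commute) auto
  finally show ?thesis .
qed

lemma commutator_central:
  assumes "x \<in> carrier E" "y \<in> carrier E" "\<rho> x = \<one>\<^bsub>G\<^esub> \<or> \<rho> y = \<one>\<^bsub>G\<^esub>"
  shows "commutator x y = \<one>"
  using assms kernel_commute[of x y] kernel_commute[of y x] by (intro commutator_eqI) auto

lemma section_decomposition:
  assumes "e \<in> carrier E"
  obtains a where "a \<in> carrier E" "\<rho> a = \<one>\<^bsub>G\<^esub>" "e = section_map (\<rho> e) \<otimes> a"
proof
  show "inv section_map (\<rho> e) \<otimes> e \<in> carrier E" "\<rho> (inv section_map (\<rho> e) \<otimes> e) = \<one>\<^bsub>G\<^esub>"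
    "e = section_map (\<rho> e) \<otimes> (inv section_map (\<rho> e) \<otimes> e)"
    using assms section_map[of "\<rho> e"] by (simp_all add: E.m_assoc[symmetric])
qed

text \<open>
  Every element differs from the chosen representative of its image by a central factor, and
  central factors drop out of commutators.
\<close>

lemma pairing_commutator:
  assumes "e \<in> carrier E" "f \<in> carrier E"
  shows "pairing (\<rho> e) (\<rho> f) = commutator e f"
proof -
  obtain a b where a: "a \<in> carrier E" "\<rho> a = \<one>\<^bsub>G\<^esub>" "e = section_map (\<rho> e) \<otimes> a"
    and b: "b \<in> carrier E" "\<rho> b = \<one>\<^bsub>G\<^esub>" "f = section_map (\<rho> f) \<otimes> b"
    using section_decomposition assms by metis
  define s t where st: "s = section_map (\<rho> e)" "t = section_map (\<rho> f)"
  have stE: "s \<in> carrier E" "t \<in> carrier E" using section_map assms by (auto simp: st)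
  have "commutator (s \<otimes> a) (t \<otimes> b) = commutator s (t \<otimes> b)"
    using commutator_mult_left[of s a "t \<otimes> b"] commutator_central[of a "t \<otimes> b"] a b stE by simp
  also have "\<dots> = commutator s t"
    using commutator_mult_right[of t b s] commutator_central[of s b] b stE by simp
  finally show ?thesis
    using a(3) b(3) by (simp add: pairing_def st)
qed

sublocale pairing: alternating_pairing G commutator_group pairing
proof -
  interpret H: comm_group commutator_group by (rule comm_group_derived)
  have lift: "\<exists>e\<in>carrier E. x = \<rho> e" if "x \<in> carrier G" for x
    using section_map[OF that] by metis
  show "alternating_pairing G commutator_group pairing"
  proof
    fix x y assume "x \<in> carrier G" "y \<in> carrier G"
    then show "pairing x y \<in> carrier commutator_group"
      using lift[of x] lift[of y] commutator_in_derived by (auto simp: pairing_commutator)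
  next
    fix x y z assume "x \<in> carrier G" "y \<in> carrier G" "z \<in> carrier G"
    then obtain e f g where efg: "e \<in> carrier E" "f \<in> carrier E" "g \<in> carrier E"
        and xyz: "x = \<rho> e" "y = \<rho> f" "z = \<rho> g"
      using lift by meson
    show "pairing (x \<otimes>\<^bsub>G\<^esub> y) z = pairing x z \<otimes>\<^bsub>commutator_group\<^esub> pairing y z"
      using efg pairing_commutator[of "e \<otimes> f" g] by (simp add: xyz pairing_commutator commutator_mult_left)
    show "pairing x (y \<otimes>\<^bsub>G\<^esub> z) = pairing x y \<otimes>\<^bsub>commutator_group\<^esub> pairing x z"
      using efg pairing_commutator[of e "f \<otimes> g"] by (simp add: xyz pairing_commutator commutator_mult_right)
  next
    fix x assume "x \<in> carrier G"
    then show "pairing x x = \<one>\<^bsub>commutator_group\<^esub>"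
      using lift[of x] commutator_eqI[of _ _ "\<one>"] by (auto simp: pairing_commutator)
  qed
qed

text \<open>
  This is how the centre of a cover enters: it is visible in the commutator pairing alone.
\<close>

lemma radical_eq_image_center: "pairing.radical = \<rho> ` center E"
proof
  show "\<rho> ` center E \<subseteq> pairing.radical"
  proof clarify
    fix z assume z: "z \<in> center E"
    have "pairing x (\<rho> z) = \<one>" if "x \<in> carrier G" for x
      using z that section_map[of x] pairing_commutator[of "section_map x" z]
        commutator_eqI[of "section_map x" z "\<one>"]
      by (auto simp: center_def)
    then show "\<rho> z \<in> pairing.radical"
      using z by (auto simp: pairing.radical_def center_def)
  qed
  show "pairing.radical \<subseteq> \<rho> ` center E"
  proof
    fix g assume g: "g \<in> pairing.radical"
    then have gG: "g \<in> carrier G" by (simp add: pairing.radical_def)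
    define z where "z = section_map g"
    have z: "z \<in> carrier E" "\<rho> z = g" using section_map[OF gG] by (auto simp: z_def)
    have "x \<otimes> z = z \<otimes> x" if x: "x \<in> carrier E" for x
    proof -
      have "commutator x z = \<one>"
        using g x z pairing_commutator[of x z] by (auto simp: pairing.radical_def)
      then show ?thesis using commutator_swap[of x z] x z by simp
    qed
    then have "z \<in> center E" using z by (auto simp: center_def)
    then show "g \<in> \<rho> ` center E" using z by blast
  qed
qed

abbreviation commutators :: "'e set" where
  "commutators \<equiv> {pairing x y |x y. x \<in> carrier G \<and> y \<in> carrier G}"

lemma derived_generated_by_pairing:
  "derived E (carrier E) = generate E commutators"
proof -
  have "derived_set E (carrier E) = commutators"
  proof safe
    fix e f assume "e \<in> carrier E" "f \<in> carrier E"
    then show "\<exists>x y. commutator e f = pairing x y \<and> x \<in> carrier G \<and> y \<in> carrier G"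
      by (intro exI[of _ "\<rho> e"] exI[of _ "\<rho> f"]) (simp add: pairing_commutator)
  next
    fix x y assume "x \<in> carrier G" "y \<in> carrier G"
    then show "pairing x y \<in> derived_set E (carrier E)"
      unfolding pairing_def using section_map by blast
  qed
  then show ?thesis by (simp add: derived_def)
qed

end

context central_extension
begin

abbreviation kernel_group :: "('e, 'n) monoid_scheme" where
  "kernel_group \<equiv> E\<lparr>carrier := kernel E G \<rho>\<rparr>"

lemma comm_group_kernel: "comm_group kernel_group"
  by (rule group.group_comm_groupI[OF E.subgroup_imp_group[OF subgroup_kernel]])
    (auto simp: kernel_def kernel_commute)

end

text \<open>
  In \<open>e\<^sub>0 f\<^sub>0 e\<^sub>1 f\<^sub>1 \<dots>\<close> the entries of \<open>f\<close> are moved to the right of those of \<open>e\<close>; each exchange costs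
  a central commutator, and together they form the twist.
\<close>

lemma (in central_extension) tuple_prod_mult_twist:
  assumes "\<And>i. i < n \<Longrightarrow> e i \<in> carrier E" "\<And>i. i < n \<Longrightarrow> f i \<in> carrier E"
  shows "tuple_prod E n (\<lambda>i. e i \<otimes> f i) =
    tuple_prod E n e \<otimes> tuple_prod E n f \<otimes> pairing.twist n (\<lambda>i. \<rho> (e i)) (\<lambda>i. \<rho> (f i))"
  using assms
proof (induction n)
  case (Suc n)
  define P Q c a b where "P = tuple_prod E n e" and "Q = tuple_prod E n f"
    and "c = pairing.twist n (\<lambda>i. \<rho> (e i)) (\<lambda>i. \<rho> (f i))" and "a = e n" and "b = f n"
  have car: "P \<in> carrier E" "Q \<in> carrier E" "a \<in> carrier E" "b \<in> carrier E"
    using Suc.prems by (auto simp: P_def Q_def a_def b_def)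
  have "c \<in> derived E (carrier E)"
    using pairing.twist_closed[of n "\<lambda>i. \<rho> (e i)" "\<lambda>i. \<rho> (f i)"] Suc.prems by (simp add: c_def)
  then have c: "c \<in> carrier E" "\<rho> c = \<one>\<^bsub>G\<^esub>" using derived_facts by auto
  define d where "d = commutator Q a"
  have d: "d \<in> carrier E" "\<rho> d = \<one>\<^bsub>G\<^esub>"
    using derived_facts[OF commutator_in_derived[OF car(2,3)]] by (auto simp: d_def)
  have Qa: "Q \<otimes> a = d \<otimes> (a \<otimes> Q)"
    unfolding d_def by (rule commutator_swap[OF car(2,3)])
  have \<rho>Q: "tuple_prod G n (\<lambda>i. \<rho> (f i)) = \<rho> Q"
    using Suc.prems hom_tuple_prod[of n f] by (simp add: Q_def)
  have "pairing.twist (Suc n) (\<lambda>i. \<rho> (e i)) (\<lambda>i. \<rho> (f i)) = c \<otimes> d"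
    using Suc.prems pairing.twist_Suc[of n "\<lambda>i. \<rho> (e i)" "\<lambda>i. \<rho> (f i)"]
    by (simp add: \<rho>Q c_def d_def a_def Q_def pairing_commutator)
  moreover have "tuple_prod E (Suc n) (\<lambda>i. e i \<otimes> f i) = P \<otimes> Q \<otimes> c \<otimes> (a \<otimes> b)"
    using Suc by (simp add: E.tuple_prod_Suc P_def Q_def c_def a_def b_def)
  moreover have "P \<otimes> Q \<otimes> c \<otimes> (a \<otimes> b) = P \<otimes> (Q \<otimes> a) \<otimes> b \<otimes> c"
    using car c kernel_commute[of c "a \<otimes> b"] by (simp add: E.m_assoc)
  moreover have "P \<otimes> (Q \<otimes> a) \<otimes> b \<otimes> c = P \<otimes> (d \<otimes> (a \<otimes> Q \<otimes> b)) \<otimes> c"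
    unfolding Qa using car c d by (simp add: E.m_assoc)
  moreover have "\<dots> = (P \<otimes> a) \<otimes> (Q \<otimes> b) \<otimes> (c \<otimes> d)"
    using car c d kernel_commute[of d "a \<otimes> Q \<otimes> b"] kernel_commute[of d c]
    by (simp add: E.m_assoc)
  ultimately show ?case
    using Suc.prems by (simp add: E.tuple_prod_Suc P_def Q_def a_def b_def)
qed simp

section \<open>The twisted group of a presentation\<close>

lemma (in group) normal_closure_normal:
  assumes "S \<subseteq> carrier G"
  shows "normal_closure G S \<lhd> G"
proof -
  have "{H. H \<lhd> G \<and> S \<subseteq> H} \<noteq> {}"
    using assms normal_self by blast
  then show ?thesis
    unfolding normal_closure_def normal_inv_iff
    by (auto intro!: subgroups_Inter)
qed

lemma normal_closure_incl: "S \<subseteq> normal_closure G S"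
  by (auto simp: normal_closure_def)

lemma normal_closure_minimal: "\<lbrakk>H \<lhd> G; S \<subseteq> H\<rbrakk> \<Longrightarrow> normal_closure G S \<subseteq> H"
  by (auto simp: normal_closure_def)

definition mixed_commutators :: "('a, 'm) monoid_scheme \<Rightarrow> 'a set \<Rightarrow> 'a set" where
  "mixed_commutators F N = {f \<otimes>\<^bsub>F\<^esub> x \<otimes>\<^bsub>F\<^esub> inv\<^bsub>F\<^esub> f \<otimes>\<^bsub>F\<^esub> inv\<^bsub>F\<^esub> x |f x. f \<in> carrier F \<and> x \<in> N}"

text \<open>
  For normal \<open>N\<close> this is \<open>[F, N]\<close>, as the mixed commutators generate a normal subgroup.  Taking the
  normal closure makes it the least normal subgroup that contains them by definition.
\<close>

definition mixed_commutator_subgroup :: "('a, 'm) monoid_scheme \<Rightarrow> 'a set \<Rightarrow> 'a set" where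
  "mixed_commutator_subgroup F N = normal_closure F (mixed_commutators F N)"

text \<open>
  The quotient \<open>E\<close> of \<open>F\<close> by \<open>[F, N]\<close>, given by its projection \<open>\<eta>\<close> rather than as a group of
  cosets.
\<close>

locale central_presentation = central_extension E G \<rho> + F: group F
  for E :: "('e, 'n) monoid_scheme" (structure) and G :: "('a, 'm) monoid_scheme" and \<rho> :: "'e \<Rightarrow> 'a"
    and F :: "('f, 'k) monoid_scheme" +
  fixes \<eta> :: "'f \<Rightarrow> 'e" and N :: "'f set"
  assumes \<eta>_epi: "\<eta> \<in> epi F E"
    and N_def: "N = kernel F G (\<lambda>f. \<rho> (\<eta> f))"
    and kernel_\<eta>: "kernel F E \<eta> = mixed_commutator_subgroup F N"
begin

sublocale \<eta>: group_hom F E \<eta>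
  using \<eta>_epi by unfold_locales (simp add: epi_def)

sublocale \<rho>\<eta>: group_hom F G "\<lambda>f. \<rho> (\<eta> f)"
  by unfold_locales (auto simp: hom_def)

abbreviation C :: "'f set" where "C \<equiv> kernel F E \<eta>"

lemma \<eta>_surj: "\<eta> ` carrier F = carrier E"
  using \<eta>_epi by (simp add: epi_def)

lemma N_normal: "N \<lhd> F"
  unfolding N_def by (rule \<rho>\<eta>.normal_kernel)

lemma N_iff: "x \<in> N \<longleftrightarrow> x \<in> carrier F \<and> \<rho> (\<eta> x) = \<one>\<^bsub>G\<^esub>"
  by (auto simp: N_def kernel_def)

lemma C_iff: "x \<in> C \<longleftrightarrow> x \<in> carrier F \<and> \<eta> x = \<one>"
  by (auto simp: kernel_def)

lemma mixed_commutators_sub_C: "mixed_commutators F N \<subseteq> C"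
  unfolding kernel_\<eta> mixed_commutator_subgroup_def by (rule normal_closure_incl)

lemma C_minimal: "\<lbrakk>H \<lhd> F; mixed_commutators F N \<subseteq> H\<rbrakk> \<Longrightarrow> C \<subseteq> H"
  unfolding kernel_\<eta> mixed_commutator_subgroup_def by (rule normal_closure_minimal)

lemma C_sub_derived: "C \<subseteq> derived F (carrier F)"
proof (rule C_minimal[OF F.derived_self_is_normal])
  show "mixed_commutators F N \<subseteq> derived F (carrier F)"
    unfolding mixed_commutators_def derived_def by (auto intro!: generate.incl simp: N_iff)
qed

lemma \<eta>_derived: "\<eta> ` derived F (carrier F) = derived E (carrier E)"
  using \<eta>.derived_img[of "carrier F"] by (simp add: \<eta>_surj)

definition relator_tuples :: "nat \<Rightarrow> (nat \<Rightarrow> 'f) set" where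
  "relator_tuples n = {x \<in> (\<Pi>\<^sub>E i\<in>{..<n}. N). tuple_prod F n x \<in> C}"

lemma \<eta>_tuple_prod:
  "(\<And>i. i < n \<Longrightarrow> x i \<in> carrier F) \<Longrightarrow> \<eta> (tuple_prod F n x) = tuple_prod E n (\<lambda>i. \<eta> (x i))"
  by (rule \<eta>.hom_tuple_prod)

text \<open>
  The image of \<open>N\<close> in \<open>E\<close> is central.  So on tuples over \<open>N\<close> the product in \<open>E\<close> is multiplicative,
  and it is unchanged by conjugation in \<open>F\<^sup>n\<close>.
\<close>

lemma relator_tuples_normal: "relator_tuples n \<lhd> power_group F n"
proof -
  let ?P = "power_group F n"
  interpret P: group "?P" by (rule power_group_group[OF F.is_group])
  interpret N: subgroup N F using N_normal by (rule normal_imp_subgroup)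
  define A where "A = kernel_group"
  interpret A: comm_group A unfolding A_def by (rule comm_group_kernel)
  have AE: "tuple_prod A n x = tuple_prod E n x" for x by (simp add: A_def)
  have A: "\<eta> x \<in> carrier A" if "x \<in> N" for x using that by (auto simp: A_def kernel_def N_iff)
  have R: "x \<in> relator_tuples n \<longleftrightarrow> x \<in> (\<Pi>\<^sub>E i\<in>{..<n}. N) \<and> tuple_prod A n (\<lambda>i. \<eta> (x i)) = \<one>" for x
    using N.subset by (auto simp: relator_tuples_def C_iff \<eta>_tuple_prod AE PiE_iff subset_iff)
  have restr: "tuple_prod A n (\<lambda>i. \<eta> ((\<lambda>i\<in>{..<n}. f i) i)) = tuple_prod A n (\<lambda>i. \<eta> (f i))" for f
    by (intro tuple_prod_cong) simp
  show ?thesis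
  proof (rule P.normal_invI)
    show "subgroup (relator_tuples n) (?P)"
    proof (rule P.subgroupI)
      show "relator_tuples n \<subseteq> carrier (?P)"
        using N.subset by (auto simp: relator_tuples_def PiE_iff extensional_def)
      have "\<one>\<^bsub>?P\<^esub> \<in> relator_tuples n"
        using A.tuple_prod_one[of n] unfolding R by (simp add: A_def restr cong: tuple_prod_cong)
      then show "relator_tuples n \<noteq> {}" by blast
    next
      fix x assume x: "x \<in> relator_tuples n"
      then have xN: "\<And>i. i < n \<Longrightarrow> x i \<in> N" and xF: "x \<in> carrier (?P)"
        using N.subset by (auto simp: relator_tuples_def PiE_iff)
      have "tuple_prod A n (\<lambda>i. \<eta> (x i)) \<otimes>\<^bsub>A\<^esub> tuple_prod A n (\<lambda>i. \<eta> (inv\<^bsub>F\<^esub> x i)) =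
          tuple_prod A n (\<lambda>i. \<eta> (x i) \<otimes>\<^bsub>A\<^esub> \<eta> (inv\<^bsub>F\<^esub> x i))"
        using xN A N.m_inv_closed by (subst A.tuple_prod_mult) (auto simp del: \<eta>.hom_inv)
      also have "\<dots> = tuple_prod A n (\<lambda>i. \<one>\<^bsub>A\<^esub>)"
        using xN by (intro tuple_prod_cong) (simp add: A_def N_iff)
      finally have "\<one> \<otimes> tuple_prod E n (\<lambda>i. \<eta> (inv\<^bsub>F\<^esub> x i)) = \<one>"
        using x unfolding R by (simp add: A_def)
      moreover have "tuple_prod E n (\<lambda>i. \<eta> (inv\<^bsub>F\<^esub> x i)) \<in> carrier E"
        using xN by (intro E.tuple_prod_closed) (auto simp: N_iff)
      ultimately show "inv\<^bsub>?P\<^esub> x \<in> relator_tuples n"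
        unfolding R power_group_inv[OF F.is_group xF] restr using xN by (auto simp: AE)
    next
      fix x y assume x: "x \<in> relator_tuples n" and y: "y \<in> relator_tuples n"
      then have xN: "\<And>i. i < n \<Longrightarrow> x i \<in> N \<and> y i \<in> N"
        by (auto simp: relator_tuples_def PiE_iff)
      have "tuple_prod A n (\<lambda>i. \<eta> (x i \<otimes>\<^bsub>F\<^esub> y i)) = tuple_prod A n (\<lambda>i. \<eta> (x i) \<otimes>\<^bsub>A\<^esub> \<eta> (y i))"
        using xN by (intro tuple_prod_cong) (simp add: A_def N_iff)
      also have "\<dots> = \<one>"
        using xN A x y by (subst A.tuple_prod_mult) (auto simp: R A_def)
      finally show "x \<otimes>\<^bsub>?P\<^esub> y \<in> relator_tuples n"
        unfolding R power_group_simps restr using xN by auto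
    qed
  next
    fix x r assume xF: "x \<in> carrier (?P)" and r: "r \<in> relator_tuples n"
    then have x: "\<And>i. i < n \<Longrightarrow> x i \<in> carrier F" and rN: "\<And>i. i < n \<Longrightarrow> r i \<in> N"
      by (auto simp: relator_tuples_def PiE_iff)
    have conj: "x \<otimes>\<^bsub>?P\<^esub> r \<otimes>\<^bsub>?P\<^esub> inv\<^bsub>?P\<^esub> x =
        (\<lambda>i\<in>{..<n}. x i \<otimes>\<^bsub>F\<^esub> r i \<otimes>\<^bsub>F\<^esub> inv\<^bsub>F\<^esub> x i)"
      unfolding power_group_inv[OF F.is_group xF] by auto
    have "tuple_prod A n (\<lambda>i. \<eta> (x i \<otimes>\<^bsub>F\<^esub> r i \<otimes>\<^bsub>F\<^esub> inv\<^bsub>F\<^esub> x i)) = tuple_prod A n (\<lambda>i. \<eta> (r i))"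
    proof (intro tuple_prod_cong)
      fix i assume i: "i < n"
      have "\<eta> (x i) \<otimes> \<eta> (r i) = \<eta> (r i) \<otimes> \<eta> (x i)"
        using x[OF i] rN[OF i] kernel_commute[of "\<eta> (r i)" "\<eta> (x i)"] by (simp add: N_iff)
      then show "\<eta> (x i \<otimes>\<^bsub>F\<^esub> r i \<otimes>\<^bsub>F\<^esub> inv\<^bsub>F\<^esub> x i) = \<eta> (r i)"
        using x[OF i] rN[OF i] by (simp add: N_iff E.m_assoc)
    qed
    then show "x \<otimes>\<^bsub>?P\<^esub> r \<otimes>\<^bsub>?P\<^esub> inv\<^bsub>?P\<^esub> x \<in> relator_tuples n"
      using r x rN normal.inv_op_closed2[OF N_normal] unfolding conj R restr by auto
  qed
qed

lemma K_set_N_iff: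
  "x \<in> K_set (F\<lparr>carrier := N\<rparr>) n \<longleftrightarrow> x \<in> (\<Pi>\<^sub>E i\<in>{..<n}. N) \<and> tuple_prod F n x \<in> derived F N"
proof -
  have N: "subgroup N F" using N_normal by (rule normal_imp_subgroup)
  interpret N: group "F\<lparr>carrier := N\<rparr>" by (rule F.subgroup_imp_group[OF N])
  show ?thesis
    using F.derived_consistent[OF subset_refl N] by (simp add: N.K_set_iff)
qed

text \<open>
  The elements \<open>f\<close> with \<open>(f, 1, \<dots>, 1) \<in> H\<close> form a normal subgroup of \<open>F\<close>.  It contains \<open>[f, x]\<close> for
  \<open>x \<in> N\<close>: this is the commutator of \<open>(f, 1, \<dots>)\<close> with \<open>(x, x\<^sup>-\<^sup>1, 1, \<dots>) \<in> K(N, n)\<close>.  The second entry is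
  the reason for \<open>n \<ge> 2\<close>.
\<close>

lemma C_first_entry_in_normal_subgroup:
  assumes H: "H \<lhd> power_group F n" and K: "K_set (F\<lparr>carrier := N\<rparr>) n \<subseteq> H" and n: "n \<ge> 2" and c: "c \<in> C"
  shows "(\<lambda>i\<in>{..<n}. if i = 0 then c else \<one>\<^bsub>F\<^esub>) \<in> H"
proof -
  let ?P = "power_group F n"
  interpret P: group "?P" by (rule power_group_group[OF F.is_group])
  interpret H: normal H "?P" by (rule H)
  interpret N: subgroup N F using N_normal by (rule normal_imp_subgroup)
  define \<iota> where "\<iota> f = (\<lambda>i\<in>{..<n}. if i = 0 then f else \<one>\<^bsub>F\<^esub>)" for f
  interpret \<iota>: group_hom F "?P" \<iota>
    by unfold_locales (auto simp: hom_def \<iota>_def)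
  have "C \<subseteq> {f \<in> carrier F. \<iota> f \<in> H}"
  proof (rule C_minimal)
    have "subgroup {f \<in> carrier F. \<iota> f \<in> H} F"
      by (rule F.subgroupI) (auto intro: exI[of _ "\<one>\<^bsub>F\<^esub>"] simp del: power_group_simps)
    then show "{f \<in> carrier F. \<iota> f \<in> H} \<lhd> F"
      using H.inv_op_closed2 by (intro F.normal_invI) (auto simp del: power_group_simps)
    show "mixed_commutators F N \<subseteq> {f \<in> carrier F. \<iota> f \<in> H}"
      unfolding mixed_commutators_def
    proof clarify
      fix f x assume f: "f \<in> carrier F" and x: "x \<in> N"
      then have xF: "x \<in> carrier F" using N.subset by auto
      define u where "u = (\<lambda>i\<in>{..<n}. if i = 0 then x else if i = 1 then inv\<^bsub>F\<^esub> x else \<one>\<^bsub>F\<^esub>)"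
      have "tuple_prod F n u = x \<otimes>\<^bsub>F\<^esub> inv\<^bsub>F\<^esub> x"
        using xF n F.tuple_prod_two_entries[of n u 1] by (simp add: u_def)
      then have "tuple_prod F n u = \<one>\<^bsub>F\<^esub>" using xF by simp
      moreover have "\<one>\<^bsub>F\<^esub> \<in> derived F N"
        by (rule subgroup.one_closed[OF F.derived_is_subgroup[OF N.subset]])
      ultimately have uH: "u \<in> H"
        using K x by (auto simp: K_set_N_iff u_def)
      then have uP: "u \<in> carrier (?P)" using H.subset by blast
      have "\<iota> f \<otimes>\<^bsub>?P\<^esub> u \<otimes>\<^bsub>?P\<^esub> inv\<^bsub>?P\<^esub> \<iota> f
          \<otimes>\<^bsub>?P\<^esub> inv\<^bsub>?P\<^esub> u \<in> H"
        using H.inv_op_closed2[OF \<iota>.hom_closed[OF f] uH] uH by blast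
      moreover have "\<iota> f \<otimes>\<^bsub>?P\<^esub> u \<otimes>\<^bsub>?P\<^esub> inv\<^bsub>?P\<^esub> \<iota> f
          \<otimes>\<^bsub>?P\<^esub> inv\<^bsub>?P\<^esub> u =
          \<iota> (f \<otimes>\<^bsub>F\<^esub> x \<otimes>\<^bsub>F\<^esub> inv\<^bsub>F\<^esub> f \<otimes>\<^bsub>F\<^esub> inv\<^bsub>F\<^esub> x)"
        unfolding power_group_inv[OF F.is_group uP] power_group_inv[OF F.is_group \<iota>.hom_closed[OF f]]
        using f xF by (auto simp: \<iota>_def u_def fun_eq_iff)
      ultimately show "f \<otimes>\<^bsub>F\<^esub> x \<otimes>\<^bsub>F\<^esub> inv\<^bsub>F\<^esub> f \<otimes>\<^bsub>F\<^esub> inv\<^bsub>F\<^esub> x \<in> carrier F \<and>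
          \<iota> (f \<otimes>\<^bsub>F\<^esub> x \<otimes>\<^bsub>F\<^esub> inv\<^bsub>F\<^esub> f \<otimes>\<^bsub>F\<^esub> inv\<^bsub>F\<^esub> x) \<in> H"
        using f xF by simp
    qed
  qed
  then show ?thesis using c unfolding \<iota>_def by blast
qed

text \<open>
  A tuple \<open>x\<close> over \<open>N\<close> with product \<open>c \<in> [F, N]\<close> is \<open>(c, 1, \<dots>, 1)\<close> times a tuple with product \<open>1\<close>, and
  both factors lie in the normal closure.
\<close>

proposition normal_closure_K_set:
  assumes n: "n \<ge> 2"
  shows "normal_closure (power_group F n) (K_set (F\<lparr>carrier := N\<rparr>) n) = relator_tuples n"
proof
  let ?P = "power_group F n"
  have N: "subgroup N F" using N_normal by (rule normal_imp_subgroup)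
  then have NF: "N \<subseteq> carrier F" by (rule subgroup.subset)
  have CF: "C \<lhd> F" by (rule \<eta>.normal_kernel)
  have C: "subgroup C F" by (rule \<eta>.subgroup_kernel)
  have "derived_set F N \<subseteq> mixed_commutators F N"
    using NF by (fastforce simp: mixed_commutators_def)
  then have DC: "derived F N \<subseteq> C"
    unfolding derived_def using mixed_commutators_sub_C
    by (intro F.generate_subgroup_incl[OF _ C]) blast
  then show "normal_closure (?P) (K_set (F\<lparr>carrier := N\<rparr>) n) \<subseteq> relator_tuples n"
    by (intro normal_closure_minimal relator_tuples_normal) (auto simp: K_set_N_iff relator_tuples_def)
  have KP: "K_set (F\<lparr>carrier := N\<rparr>) n \<subseteq> carrier (?P)"
    using NF by (auto simp: K_set_N_iff PiE_iff extensional_def)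
  interpret P: group "?P" by (rule power_group_group[OF F.is_group])
  let ?H = "normal_closure (?P) (K_set (F\<lparr>carrier := N\<rparr>) n)"
  interpret H: normal ?H "?P" by (rule P.normal_closure_normal[OF KP])
  show "relator_tuples n \<subseteq> ?H"
  proof
    fix x assume "x \<in> relator_tuples n"
    then have x: "x \<in> (\<Pi>\<^sub>E i\<in>{..<n}. N)" and c: "tuple_prod F n x \<in> C"
      by (auto simp: relator_tuples_def)
    define c where "c = tuple_prod F n x"
    define y where "y = (\<lambda>i\<in>{..<n}. if i = 0 then inv\<^bsub>F\<^esub> c \<otimes>\<^bsub>F\<^esub> x i else x i)"
    have xF: "x i \<in> carrier F" if "i < n" for i using x NF that by auto
    have cF: "c \<in> carrier F" and cN: "c \<in> N"
      using c by (auto simp: c_def C_iff N_iff)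
    have "tuple_prod F n y = inv\<^bsub>F\<^esub> c \<otimes>\<^bsub>F\<^esub> c"
      unfolding y_def c_def[symmetric] using xF cF n by (subst F.tuple_prod_head) (auto simp: c_def)
    moreover have "\<one>\<^bsub>F\<^esub> \<in> derived F N"
      by (rule subgroup.one_closed[OF F.derived_is_subgroup[OF NF]])
    ultimately have "y \<in> K_set (F\<lparr>carrier := N\<rparr>) n"
      using x cF cN subgroup.m_closed[OF N] subgroup.m_inv_closed[OF N]
      by (auto simp: K_set_N_iff y_def PiE_iff)
    then have "y \<in> ?H" by (rule subsetD[OF normal_closure_incl])
    moreover have "(\<lambda>i\<in>{..<n}. if i = 0 then c else \<one>\<^bsub>F\<^esub>) \<in> ?H"
      using C_first_entry_in_normal_subgroup[OF H.normal_axioms normal_closure_incl n] c by (simp add: c_def)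
    ultimately have "(\<lambda>i\<in>{..<n}. if i = 0 then c else \<one>\<^bsub>F\<^esub>) \<otimes>\<^bsub>?P\<^esub> y \<in> ?H"
      by (rule H.m_closed[rotated])
    moreover have "(\<lambda>i\<in>{..<n}. if i = 0 then c else \<one>\<^bsub>F\<^esub>) \<otimes>\<^bsub>?P\<^esub> y = x"
    proof
      fix i
      show "((\<lambda>i\<in>{..<n}. if i = 0 then c else \<one>\<^bsub>F\<^esub>) \<otimes>\<^bsub>?P\<^esub> y) i = x i"
      proof (cases "i < n")
        case True
        have "c \<otimes>\<^bsub>F\<^esub> (inv\<^bsub>F\<^esub> c \<otimes>\<^bsub>F\<^esub> x i) = x i"
          using xF[OF True] cF by (simp add: F.m_assoc[symmetric])
        then show ?thesis
          using True xF[OF True] by (cases "i = 0") (simp_all add: y_def)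
      next
        case False
        then show ?thesis using PiE_arb[OF x, of i] by simp
      qed
    qed
    ultimately show "x \<in> ?H" by simp
  qed
qed

text \<open>
  The map sends a tuple to its image in \<open>G\<^sup>n\<close> together with its product in \<open>[E, E]\<close>.  It is
  multiplicative by \<open>tuple_prod_mult_twist\<close>, and its kernel is the normal closure.
\<close>

proposition K_tilde_iso_twisted_group:
  assumes n: "n \<ge> 2"
  shows "group (K_tilde F N n)" and "K_tilde F N n \<cong> pairing.twisted_group n"
proof -
  let ?T = "pairing.twisted_group n"
  define \<kappa> where "\<kappa> f = ((\<lambda>i\<in>{..<n}. \<rho> (\<eta> (f i))), tuple_prod E n (\<lambda>i. \<eta> (f i)))" for f
  have fF: "f i \<in> carrier F" if "f \<in> K_set F n" "i < n" for f i
    using that by (auto simp: F.K_set_iff)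
  have \<rho>_prod: "tuple_prod G n (\<lambda>i\<in>{..<n}. \<rho> (\<eta> (f i))) = \<rho> (tuple_prod E n (\<lambda>i. \<eta> (f i)))"
    if "\<And>i. i < n \<Longrightarrow> f i \<in> carrier F" for f
  proof -
    have "tuple_prod G n (\<lambda>i\<in>{..<n}. \<rho> (\<eta> (f i))) = tuple_prod G n (\<lambda>i. \<rho> (\<eta> (f i)))"
      by (intro tuple_prod_cong) simp
    then show ?thesis using that hom_tuple_prod[of n "\<lambda>i. \<eta> (f i)"] by simp
  qed
  have \<kappa>2: "tuple_prod E n (\<lambda>i. \<eta> (f i)) \<in> derived E (carrier E)" if "f \<in> K_set F n" for f
  proof -
    have "\<eta> (tuple_prod F n f) \<in> derived E (carrier E)"
      using that unfolding \<eta>_derived[symmetric] by (auto simp: F.K_set_iff)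
    then show ?thesis using fF[OF that] \<eta>_tuple_prod[of n f] by simp
  qed
  have closed: "\<kappa> f \<in> carrier ?T" if "f \<in> K_set F n" for f
    using \<kappa>2[OF that] derived_facts fF[OF that] \<rho>_prod[of f]
    by (auto simp: \<kappa>_def G.K_set_comm_iff)
  have "\<kappa> \<in> hom (K_group F n) ?T"
  proof (rule homI)
    fix f g assume "f \<in> carrier (K_group F n)" "g \<in> carrier (K_group F n)"
    then have f: "\<And>i. i < n \<Longrightarrow> f i \<in> carrier F" and g: "\<And>i. i < n \<Longrightarrow> g i \<in> carrier F"
      using fF by auto
    have "tuple_prod E n (\<lambda>i. \<eta> ((\<lambda>i\<in>{..<n}. f i \<otimes>\<^bsub>F\<^esub> g i) i)) =
        tuple_prod E n (\<lambda>i. \<eta> (f i) \<otimes> \<eta> (g i))"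
      using f g by (intro tuple_prod_cong) simp
    then show "\<kappa> (f \<otimes>\<^bsub>K_group F n\<^esub> g) = \<kappa> f \<otimes>\<^bsub>?T\<^esub> \<kappa> g"
      using f g by (auto simp: \<kappa>_def tuple_prod_mult_twist)
  qed (use closed in simp)
  then interpret \<kappa>: group_hom "K_group F n" ?T \<kappa>
    by (intro group_hom.intro group_hom_axioms.intro F.K_group_group pairing.twisted_group_group)
  have ker: "kernel (K_group F n) ?T \<kappa> = relator_tuples n"
  proof (intro equalityI subsetI)
    fix f assume "f \<in> kernel (K_group F n) ?T \<kappa>"
    then have f: "f \<in> K_set F n" and 1: "(\<lambda>i\<in>{..<n}. \<rho> (\<eta> (f i))) = (\<lambda>i\<in>{..<n}. \<one>\<^bsub>G\<^esub>)"
        "tuple_prod E n (\<lambda>i. \<eta> (f i)) = \<one>"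
      by (auto simp: kernel_def \<kappa>_def pairing.twisted_group_one)
    have "\<rho> (\<eta> (f i)) = \<one>\<^bsub>G\<^esub>" if "i < n" for i
      using fun_cong[OF 1(1), of i] that by simp
    then show "f \<in> relator_tuples n"
      using f fF[OF f] 1(2) \<eta>_tuple_prod[of n f]
      by (auto simp: relator_tuples_def N_iff C_iff F.K_set_iff PiE_iff)
  next
    fix f assume f: "f \<in> relator_tuples n"
    then have "f \<in> K_set F n"
      using C_sub_derived by (auto simp: relator_tuples_def F.K_set_iff N_iff PiE_iff)
    then show "f \<in> kernel (K_group F n) ?T \<kappa>"
      using f fF[of f] \<eta>_tuple_prod[of n f]
      by (auto simp: kernel_def \<kappa>_def pairing.twisted_group_one relator_tuples_def N_iff C_iff PiE_iff)
  qed
  then have K_tilde: "K_tilde F N n = K_group F n Mod kernel (K_group F n) ?T \<kappa>"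
    by (simp add: K_tilde_def normal_closure_K_set[OF n])
  show "group (K_tilde F N n)"
    unfolding K_tilde by (rule normal.factorgroup_is_group[OF \<kappa>.normal_kernel])
  have "\<kappa> ` carrier (K_group F n) = carrier ?T"
  proof
    show "\<kappa> ` carrier (K_group F n) \<subseteq> carrier ?T" by (intro image_subsetI closed) simp
    show "carrier ?T \<subseteq> \<kappa> ` carrier (K_group F n)"
    proof
      fix t assume "t \<in> carrier ?T"
      then obtain g h where t: "t = (g, h)" and g: "g \<in> K_set G n" and h: "h \<in> derived E (carrier E)"
        by auto
      have "\<exists>f\<in>carrier F. \<rho> (\<eta> f) = x" if "x \<in> carrier G" for x
        using section_map[OF that] \<eta>_surj by (metis imageE)
      then obtain l where l: "\<And>x. x \<in> carrier G \<Longrightarrow> l x \<in> carrier F \<and> \<rho> (\<eta> (l x)) = x" by metis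
      obtain d where d: "d \<in> derived F (carrier F)" "h = \<eta> d" using h \<eta>_derived by auto
      have dF: "d \<in> carrier F" using d(1) F.derived_in_carrier by blast
      have gG: "g i \<in> carrier G" if "i < n" for i using pairing.K_set_facts(1)[OF g that] .
      define f where "f i = l (g i)" for i
      have fi: "f i \<in> carrier F" "\<rho> (\<eta> (f i)) = g i" if "i < n" for i
        using l gG[OF that] by (auto simp: f_def)
      define P where "P = tuple_prod F n f"
      have PF: "P \<in> carrier F" using fi by (auto simp: P_def)
      have "tuple_prod G n (\<lambda>i\<in>{..<n}. \<rho> (\<eta> (f i))) = tuple_prod G n g"
        using fi by (intro tuple_prod_cong) simp
      then have \<rho>P: "\<rho> (\<eta> P) = \<one>\<^bsub>G\<^esub>"
        using \<rho>_prod[of f] fi pairing.K_set_facts(2)[OF g] \<eta>_tuple_prod[of n f] by (simp add: P_def)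
      have \<rho>d: "\<rho> (\<eta> d) = \<one>\<^bsub>G\<^esub>" using h d(2) derived_facts by simp
      \<comment> \<open>An arbitrary lift of \<open>g\<close> is corrected in its first entry to have product \<open>d\<close>.\<close>
      define f' where "f' = (\<lambda>i\<in>{..<n}. if i = 0 then (d \<otimes>\<^bsub>F\<^esub> inv\<^bsub>F\<^esub> P) \<otimes>\<^bsub>F\<^esub> f i else f i)"
      have "tuple_prod F n f' = (d \<otimes>\<^bsub>F\<^esub> inv\<^bsub>F\<^esub> P) \<otimes>\<^bsub>F\<^esub> P"
        unfolding f'_def P_def[symmetric] using fi dF PF n by (subst F.tuple_prod_head) (auto simp: P_def)
      then have f'd: "tuple_prod F n f' = d" using dF PF by (simp add: F.m_assoc)
      have f'F: "f' i \<in> carrier F" if "i < n" for i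
        using fi[OF that] dF PF that by (auto simp: f'_def)
      have f'K: "f' \<in> K_set F n"
        using f'd d(1) f'F by (auto simp: F.K_set_iff f'_def PiE_iff)
      moreover have "\<rho> (\<eta> (f' i)) = g i" if "i < n" for i
        using fi[OF that] dF PF that \<rho>d \<rho>P gG[OF that] by (auto simp: f'_def)
      then have "\<kappa> f' = t"
        using pairing.K_set_facts(3)[OF g] f'd \<eta>_tuple_prod[of n f'] f'F d(2)
        by (auto simp: \<kappa>_def t fun_eq_iff PiE_iff extensional_def)
      ultimately show "t \<in> \<kappa> ` carrier (K_group F n)" by force
    qed
  qed
  then show "K_tilde F N n \<cong> ?T"
    unfolding K_tilde by (rule \<kappa>.FactGroup_iso)
qed

end

section \<open>Lifting homomorphisms from free groups\<close>

text \<open>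
  \<open>word_value\<close> with the letters evaluated along \<open>f\<close>; the same word can then be read in two groups.
\<close>

definition letter_product ::
    "('b, 'm) monoid_scheme \<Rightarrow> ('a \<Rightarrow> 'b) \<Rightarrow> (bool \<times> 'a) list \<Rightarrow> 'b" where
  "letter_product M f w =
    foldr (\<lambda>(a, x) m. (if a then f x else inv\<^bsub>M\<^esub> f x) \<otimes>\<^bsub>M\<^esub> m) w \<one>\<^bsub>M\<^esub>"

lemma letter_product_Nil: "letter_product M f [] = \<one>\<^bsub>M\<^esub>"
  and letter_product_Cons: "letter_product M f ((a, x) # w) =
    (if a then f x else inv\<^bsub>M\<^esub> f x) \<otimes>\<^bsub>M\<^esub> letter_product M f w"
  by (simp_all add: letter_product_def)

lemma word_value_eq_letter_product: "word_value F w = letter_product F (\<lambda>x. x) w"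
  by (induction w) (auto simp: word_value_def letter_product_def)

lemma (in group) letter_product_closed:
  "\<lbrakk>f ` X \<subseteq> carrier G; snd ` set w \<subseteq> X\<rbrakk> \<Longrightarrow> letter_product G f w \<in> carrier G"
  by (induction w) (auto simp: letter_product_Nil letter_product_Cons)

lemma (in group_hom) hom_letter_product:
  assumes "f ` X \<subseteq> carrier G" and "snd ` set w \<subseteq> X"
  shows "h (letter_product G f w) = letter_product H (h \<circ> f) w"
  using assms(2)
proof (induction w)
  case (Cons l w)
  moreover obtain a x where "l = (a, x)" by (cases l)
  ultimately show ?case
    using assms(1) G.letter_product_closed[OF assms(1), of w]
    by (auto simp: letter_product_Cons image_subset_iff)
qed (simp add: letter_product_Nil)

lemma letter_product_cong:
  "(\<And>x. x \<in> snd ` set w \<Longrightarrow> f x = g x) \<Longrightarrow> letter_product M f w = letter_product M g w"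
  by (induction w) (auto simp: letter_product_Nil letter_product_Cons)

text \<open>
  Multiplication by a letter on reduced words: it either cancels the first letter or is put in
  front.
\<close>

fun reduced_Cons :: "bool \<times> 'a \<Rightarrow> (bool \<times> 'a) list \<Rightarrow> (bool \<times> 'a) list" where
  "reduced_Cons (a, x) [] = [(a, x)]"
| "reduced_Cons (a, x) ((b, y) # w) = (if x = y \<and> a \<noteq> b then w else (a, x) # (b, y) # w)"

lemma reduced_Cons_reduced:
  assumes "w \<in> reduced_words X" and "x \<in> X"
  shows "reduced_Cons (a, x) w \<in> reduced_words X"
proof (cases w)
  case Nil
  then show ?thesis using assms by (simp add: reduced_words_def)
next
  case (Cons l v)
  then show ?thesis using assms
    by (cases l; cases v) (auto simp: reduced_words_def)
qed

lemma (in group) letter_product_reduced_Cons: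
  assumes f: "f ` X \<subseteq> carrier G" and "snd ` set w \<subseteq> X" and "x \<in> X"
  shows "letter_product G f (reduced_Cons (a, x) w) =
    (if a then f x else inv f x) \<otimes> letter_product G f w"
proof (cases w)
  case Nil
  then show ?thesis by (simp add: letter_product_Cons)
next
  case (Cons l v)
  obtain b y where l: "l = (b, y)" by (cases l)
  have v: "letter_product G f v \<in> carrier G" and x: "f x \<in> carrier G"
    using letter_product_closed[OF f, of v] assms Cons by auto
  show ?thesis
  proof (cases "x = y \<and> a \<noteq> b")
    case True
    then show ?thesis
      using v x by (cases a; cases b) (simp_all add: Cons l letter_product_Cons m_assoc[symmetric])
  qed (auto simp: Cons l letter_product_Cons)
qed

text \<open>
  The homomorphism evaluates the reduced word of an element.  It is compatible with left
  multiplication by a letter, because \<open>reduced_Cons\<close> computes that multiplication in every group;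
  multiplicativity follows by induction on the word of the left factor.
\<close>

proposition free_on_universal:
  assumes "free_on F X" and "group L" and f: "f ` X \<subseteq> carrier L"
  obtains \<phi> where "\<phi> \<in> hom F L" and "\<And>x. x \<in> X \<Longrightarrow> \<phi> x = f x"
proof -
  interpret F: group F using assms by (simp add: free_on_def)
  interpret L: group L by fact
  have X: "(\<lambda>x. x) ` X \<subseteq> carrier F"
    and bij: "bij_betw (letter_product F (\<lambda>x. x)) (reduced_words X) (carrier F)"
    using assms by (auto simp: free_on_def word_value_eq_letter_product[abs_def])
  define red where "red = inv_into (reduced_words X) (letter_product F (\<lambda>x. x))"
  have red: "red u \<in> reduced_words X" "letter_product F (\<lambda>x. x) (red u) = u"
    if "u \<in> carrier F" for u
    using bij that by (auto simp: red_def bij_betw_def inv_into_into f_inv_into_f)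
  have red_eq: "red (letter_product F (\<lambda>x. x) w) = w" if "w \<in> reduced_words X" for w
    using bij that by (auto simp: red_def bij_betw_def)
  have supp: "snd ` set w \<subseteq> X" if "w \<in> reduced_words X" for w
    using that by (auto simp: reduced_words_def)
  define \<phi> where "\<phi> u = letter_product L f (red u)" for u
  have closed: "\<phi> u \<in> carrier L" if "u \<in> carrier F" for u
    unfolding \<phi>_def using L.letter_product_closed[OF f] supp red that by blast
  have letter: "\<phi> ((if a then x else inv\<^bsub>F\<^esub> x) \<otimes>\<^bsub>F\<^esub> u) = (if a then f x else inv\<^bsub>L\<^esub> f x) \<otimes>\<^bsub>L\<^esub> \<phi> u"
    if "x \<in> X" "u \<in> carrier F" for a x u
  proof -
    have "(if a then x else inv\<^bsub>F\<^esub> x) \<otimes>\<^bsub>F\<^esub> u = letter_product F (\<lambda>x. x) (reduced_Cons (a, x) (red u))"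
      using F.letter_product_reduced_Cons[OF X supp[OF red(1)[OF that(2)]] that(1)] red(2)[OF that(2)]
      by simp
    then have "red ((if a then x else inv\<^bsub>F\<^esub> x) \<otimes>\<^bsub>F\<^esub> u) = reduced_Cons (a, x) (red u)"
      using red_eq reduced_Cons_reduced red that by metis
    then show ?thesis
      unfolding \<phi>_def using L.letter_product_reduced_Cons[OF f supp[OF red(1)[OF that(2)]] that(1)]
      by simp
  qed
  have word: "\<phi> (letter_product F (\<lambda>x. x) w \<otimes>\<^bsub>F\<^esub> u) = letter_product L f w \<otimes>\<^bsub>L\<^esub> \<phi> u"
    if "snd ` set w \<subseteq> X" "u \<in> carrier F" for w u
    using that(1)
  proof (induction w)
    case Nil
    then show ?case using that closed by (simp add: letter_product_Nil)
  next
    case (Cons l w)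
    obtain a x where l: "l = (a, x)" by (cases l)
    have x: "x \<in> X" "x \<in> carrier F" "f x \<in> carrier L" and w: "snd ` set w \<subseteq> X"
      using Cons.prems X f by (auto simp: l)
    note cl = F.letter_product_closed[OF X w] L.letter_product_closed[OF f w]
    show ?case
      using letter[OF x(1), of "letter_product F (\<lambda>x. x) w \<otimes>\<^bsub>F\<^esub> u" a] Cons.IH[OF w] that(2) cl x
        closed[OF that(2)]
      by (auto simp: l letter_product_Cons F.m_assoc L.m_assoc split: if_splits)
  qed
  have one: "\<phi> \<one>\<^bsub>F\<^esub> = \<one>\<^bsub>L\<^esub>"
    using red_eq[of "[]"] by (simp add: \<phi>_def reduced_words_def letter_product_Nil)
  show ?thesis
  proof
    show "\<phi> \<in> hom F L"
    proof (rule homI)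
      fix u v assume "u \<in> carrier F" "v \<in> carrier F"
      then show "\<phi> (u \<otimes>\<^bsub>F\<^esub> v) = \<phi> u \<otimes>\<^bsub>L\<^esub> \<phi> v"
        using word[OF supp[OF red(1)], of u v] red(2)[of u] by (simp add: \<phi>_def[of u])
    qed (rule closed)
    show "\<phi> x = f x" if "x \<in> X" for x
      using letter[OF that, of "\<one>\<^bsub>F\<^esub>" True] that X f one
      by (simp add: image_subset_iff subset_iff)
  qed
qed

text \<open>
  Free groups are projective: it suffices to lift the images of the free generators.
\<close>

proposition free_group_lift:
  assumes "free_group F" and "group L" and "group G" and \<pi>: "\<pi> \<in> epi L G" and \<theta>: "\<theta> \<in> hom F G"
  obtains \<phi> where "\<phi> \<in> hom F L" and "\<And>u. u \<in> carrier F \<Longrightarrow> \<pi> (\<phi> u) = \<theta> u"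
proof -
  obtain X where X: "free_on F X" using assms by (auto simp: free_group_def)
  interpret F: group F using X by (simp add: free_on_def)
  interpret L: group L by fact
  interpret G: group G by fact
  have XF: "X \<subseteq> carrier F" using X by (simp add: free_on_def)
  have "\<exists>y \<in> carrier L. \<pi> y = \<theta> x" if "x \<in> X" for x
  proof -
    have "\<theta> x \<in> \<pi> ` carrier L"
      using hom_in_carrier[OF \<theta>] \<pi> that XF by (auto simp: epi_def)
    then show ?thesis by force
  qed
  then obtain f where f: "\<And>x. x \<in> X \<Longrightarrow> f x \<in> carrier L" "\<And>x. x \<in> X \<Longrightarrow> \<pi> (f x) = \<theta> x"
    by metis
  then obtain \<phi> where \<phi>: "\<phi> \<in> hom F L" "\<And>x. x \<in> X \<Longrightarrow> \<phi> x = f x"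
    using free_on_universal[OF X assms(2), of f] by blast
  have \<pi>hom: "\<pi> \<in> hom L G" using \<pi> by (simp add: epi_def)
  interpret \<theta>: group_hom F G \<theta> by unfold_locales (rule \<theta>)
  interpret \<pi>\<phi>: group_hom F G "\<pi> \<circ> \<phi>"
    by unfold_locales (rule hom_compose[OF \<phi>(1) \<pi>hom])
  have "(\<pi> \<circ> \<phi>) u = \<theta> u" if "u \<in> carrier F" for u
  proof -
    have "u \<in> letter_product F (\<lambda>x. x) ` reduced_words X"
      using X that by (simp add: free_on_def bij_betw_def word_value_eq_letter_product[abs_def])
    then obtain w where w: "w \<in> reduced_words X" "u = letter_product F (\<lambda>x. x) w"
      by blast
    then have "snd ` set w \<subseteq> X" by (auto simp: reduced_words_def)
    then show ?thesis
      using \<theta>.hom_letter_product[of "\<lambda>x. x" X w] \<pi>\<phi>.hom_letter_product[of "\<lambda>x. x" X w] XF \<phi> f w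
      by (auto simp: subset_iff intro!: letter_product_cong)
  qed
  then show ?thesis using that \<phi> by auto
qed

lemma hom_factor_epi:
  assumes "group F" "group E" "group L" and \<eta>: "\<eta> \<in> epi F E" and \<psi>: "\<psi> \<in> hom F L"
    and ker: "kernel F E \<eta> \<subseteq> kernel F L \<psi>"
  obtains \<phi> where "\<phi> \<in> hom E L" "\<And>f. f \<in> carrier F \<Longrightarrow> \<phi> (\<eta> f) = \<psi> f"
proof -
  interpret F: group F by fact
  interpret E: group E by fact
  interpret L: group L by fact
  interpret \<eta>: group_hom F E \<eta> using \<eta> by unfold_locales (simp add: epi_def)
  interpret \<psi>: group_hom F L \<psi> using \<psi> by unfold_locales
  have wd: "\<psi> f = \<psi> g" if fg: "f \<in> carrier F" "g \<in> carrier F" "\<eta> f = \<eta> g" for f g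
  proof -
    have "f \<otimes>\<^bsub>F\<^esub> inv\<^bsub>F\<^esub> g \<in> kernel F E \<eta>" using fg by (simp add: kernel_def)
    then have "\<psi> (f \<otimes>\<^bsub>F\<^esub> inv\<^bsub>F\<^esub> g) = \<one>\<^bsub>L\<^esub>" using ker by (auto simp: kernel_def)
    then show ?thesis using fg by (simp add: L.inv_solve_right')
  qed
  define \<phi> where "\<phi> e = \<psi> (inv_into (carrier F) \<eta> e)" for e
  have \<phi>: "\<phi> (\<eta> f) = \<psi> f" if "f \<in> carrier F" for f
    unfolding \<phi>_def using that by (intro wd) (auto intro: inv_into_into f_inv_into_f)
  have "\<phi> \<in> hom E L"
  proof (rule homI)
    fix e e' assume "e \<in> carrier E" "e' \<in> carrier E"
    then obtain f f' where f: "f \<in> carrier F" "f' \<in> carrier F" "e = \<eta> f" "e' = \<eta> f'"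
      using \<eta> unfolding epi_def by blast
    then show "\<phi> e \<in> carrier L" "\<phi> (e \<otimes>\<^bsub>E\<^esub> e') = \<phi> e \<otimes>\<^bsub>L\<^esub> \<phi> e'"
      using \<phi>[of "f \<otimes>\<^bsub>F\<^esub> f'"] by (auto simp: \<phi>)
  qed
  then show ?thesis using \<phi> that by blast
qed

locale free_central_presentation = central_presentation +
  assumes free: "free_group F"
begin

text \<open>
  The universal property of \<open>F / [F, N]\<close>: a lift of \<open>F \<rightarrow> G\<close> maps \<open>N\<close> into the central kernel, so it
  is trivial on \<open>[F, N]\<close>.
\<close>

proposition lift_to_central_extension:
  assumes "central_extension L G \<mu>"
  obtains \<phi> where "\<phi> \<in> hom E L" "\<And>e. e \<in> carrier E \<Longrightarrow> \<mu> (\<phi> e) = \<rho> e"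
proof -
  interpret L: central_extension L G \<mu> by fact
  obtain \<psi> where \<psi>: "\<psi> \<in> hom F L" "\<And>f. f \<in> carrier F \<Longrightarrow> \<mu> (\<psi> f) = \<rho> (\<eta> f)"
    by (rule free_group_lift[OF free L.E.is_group G.is_group L.epi \<rho>\<eta>.homh]) (rule that, assumption, simp)
  interpret \<psi>: group_hom F L \<psi> using \<psi>(1) by unfold_locales
  have "C \<subseteq> kernel F L \<psi>"
  proof (rule C_minimal[OF \<psi>.normal_kernel])
    show "mixed_commutators F N \<subseteq> kernel F L \<psi>"
      using \<psi>(2) L.commutator_central
      by (auto simp: mixed_commutators_def kernel_def N_iff)
  qed
  then obtain \<phi> where \<phi>: "\<phi> \<in> hom E L" "\<And>f. f \<in> carrier F \<Longrightarrow> \<phi> (\<eta> f) = \<psi> f"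
    by (rule hom_factor_epi[OF F.is_group E.is_group L.E.is_group \<eta>_epi \<psi>(1)]) (rule that, assumption, simp)
  have "\<mu> (\<phi> e) = \<rho> e" if "e \<in> carrier E" for e
  proof -
    from that obtain f where "f \<in> carrier F" "e = \<eta> f" unfolding \<eta>_surj[symmetric] by blast
    then show ?thesis using \<phi>(2) \<psi>(2) by simp
  qed
  then show ?thesis using \<phi>(1) that by blast
qed

end

section \<open>The Hopf formula\<close>

lemma (in comm_group) quotient_of_quotients:
  assumes "a \<in> carrier G" "b \<in> carrier G" "c \<in> carrier G" "d \<in> carrier G"
  shows "(a \<otimes> inv b) \<otimes> inv (d \<otimes> inv c) = (a \<otimes> c) \<otimes> inv (d \<otimes> b)"
  using assms by (simp add: inv_mult m_ac)

lemma (in comm_group) move_quotient: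
  assumes "a \<in> carrier G" "b \<in> carrier G" "c \<in> carrier G" "d \<in> carrier G"
  shows "(b \<otimes> inv (c \<otimes> inv a)) \<otimes> d = (a \<otimes> b \<otimes> d) \<otimes> inv c"
  using assms by (simp add: inv_mult m_ac)

lemma keys_diff_subset:
  "\<lbrakk>Poly_Mapping.keys a \<subseteq> S; Poly_Mapping.keys b \<subseteq> S\<rbrakk> \<Longrightarrow> Poly_Mapping.keys (a - b) \<subseteq> S"
  for a b :: "'a \<Rightarrow>\<^sub>0 int"
  using keys_diff[of a b] by blast

lemma (in group) hom_free_Abelian_group_diff:
  assumes "h \<in> hom (free_Abelian_group S) G" "Poly_Mapping.keys a \<subseteq> S" "Poly_Mapping.keys b \<subseteq> S"
  shows "h (a - b) = h a \<otimes> inv h b"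
proof -
  interpret h: group_hom "free_Abelian_group S" G h
    using assms by (intro group_hom.intro group_hom_axioms.intro) (auto intro: is_group)
  show ?thesis
    using h.hom_mult[of a "- b"] h.hom_inv[of b] assms by simp
qed

lemma (in group) hom_free_Abelian_group_eqI:
  assumes h: "h \<in> hom (free_Abelian_group S) G" and k: "k \<in> hom (free_Abelian_group S) G"
    and "\<And>x. x \<in> S \<Longrightarrow> h (frag_of x) = k (frag_of x)" and "Poly_Mapping.keys z \<subseteq> S"
  shows "h z = k z"
proof (rule free_Abelian_group_induct[OF assms(4)])
  show "h 0 = k 0"
    using hom_one[OF h _ is_group] hom_one[OF k _ is_group] by simp
  show "h (x - y) = k (x - y)"
    if "Poly_Mapping.keys x \<subseteq> S" "Poly_Mapping.keys y \<subseteq> S" "h x = k x" "h y = k y" for x y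
    using that by (simp add: hom_free_Abelian_group_diff[OF h] hom_free_Abelian_group_diff[OF k])
qed (use assms(3) in auto)

lemma frag_extend_hom:
  assumes "\<And>x. x \<in> S \<Longrightarrow> Poly_Mapping.keys (f x) \<subseteq> T"
  shows "frag_extend f \<in> hom (free_Abelian_group S) (free_Abelian_group T)"
proof (rule homI)
  fix z assume "z \<in> carrier (free_Abelian_group S)"
  then have "(\<Union>x\<in>Poly_Mapping.keys z. Poly_Mapping.keys (f x)) \<subseteq> T" using assms by auto
  then show "frag_extend f z \<in> carrier (free_Abelian_group T)"
    using order_trans[OF keys_frag_extend] by simp
qed (simp add: frag_extend_add)

context group
begin

abbreviation bar1 :: "('a \<Rightarrow>\<^sub>0 int) monoid" where
  "bar1 \<equiv> free_Abelian_group (carrier G)"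
abbreviation bar2 :: "('a \<times> 'a \<Rightarrow>\<^sub>0 int) monoid" where
  "bar2 \<equiv> free_Abelian_group (carrier G \<times> carrier G)"
abbreviation bar3 :: "('a \<times> 'a \<times> 'a \<Rightarrow>\<^sub>0 int) monoid" where
  "bar3 \<equiv> free_Abelian_group (carrier G \<times> carrier G \<times> carrier G)"

abbreviation bar_cycles :: "('a \<times> 'a \<Rightarrow>\<^sub>0 int) set" where
  "bar_cycles \<equiv> kernel bar2 bar1 (bar_boundary2 G)"

lemma bar_boundary2_hom: "bar_boundary2 G \<in> hom bar2 bar1"
  unfolding bar_boundary2_def
  by (rule frag_extend_hom) (auto dest!: subsetD[OF keys_add] subsetD[OF keys_diff])

lemma bar_boundary3_hom: "bar_boundary3 G \<in> hom bar3 bar2"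
  unfolding bar_boundary3_def
  by (rule frag_extend_hom) (auto dest!: subsetD[OF keys_add] subsetD[OF keys_diff])

lemma bar_boundary2_frag_of [simp]:
  "bar_boundary2 G (frag_of (x, y)) = frag_of y - frag_of (x \<otimes> y) + frag_of x"
  by (simp add: bar_boundary2_def)

lemma bar_boundary3_frag_of [simp]:
  "bar_boundary3 G (frag_of (x, y, z)) =
    frag_of (y, z) - frag_of (x \<otimes> y, z) + frag_of (x, y \<otimes> z) - frag_of (x, y)"
  by (simp add: bar_boundary3_def)

lemma bar_boundary2_boundary3:
  assumes "Poly_Mapping.keys z \<subseteq> carrier G \<times> carrier G \<times> carrier G"
  shows "bar_boundary2 G (bar_boundary3 G z) = 0"
proof -
  have "(bar_boundary2 G \<circ> bar_boundary3 G) z = (\<lambda>_. 0) z"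
  proof (rule group.hom_free_Abelian_group_eqI[OF group_free_Abelian_group _ _ _ assms])
    show "bar_boundary2 G \<circ> bar_boundary3 G \<in> hom bar3 bar1"
      by (rule Group.hom_compose[OF bar_boundary3_hom bar_boundary2_hom])
    show "(\<lambda>_. 0) \<in> hom bar3 bar1" by (auto simp: hom_def)
    fix t assume "t \<in> carrier G \<times> carrier G \<times> carrier G"
    then obtain x y z where "t = (x, y, z)" "x \<in> carrier G" "y \<in> carrier G" "z \<in> carrier G"
      by auto
    then show "(bar_boundary2 G \<circ> bar_boundary3 G) (frag_of t) = 0"
      by (simp add: bar_boundary2_def frag_extend_add frag_extend_diff m_assoc)
  qed
  then show ?thesis by simp
qed

end

context central_extension
begin

definition factor_set :: "'a \<Rightarrow> 'a \<Rightarrow> 'e" where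
  "factor_set x y = section_map x \<otimes> section_map y \<otimes> inv section_map (x \<otimes>\<^bsub>G\<^esub> y)"

lemma section_map_closed [simp, intro]: "x \<in> carrier G \<Longrightarrow> section_map x \<in> carrier E"
  and \<rho>_section_map [simp]: "x \<in> carrier G \<Longrightarrow> \<rho> (section_map x) = x"
  using section_map by auto

lemma factor_set_facts:
  assumes "x \<in> carrier G" "y \<in> carrier G"
  shows "factor_set x y \<in> carrier E" "\<rho> (factor_set x y) = \<one>\<^bsub>G\<^esub>" "factor_set x y \<in> kernel E G \<rho>"
    "factor_set x y \<otimes> section_map (x \<otimes>\<^bsub>G\<^esub> y) = section_map x \<otimes> section_map y"
proof -
  show "factor_set x y \<in> carrier E" "\<rho> (factor_set x y) = \<one>\<^bsub>G\<^esub>"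
    using assms by (auto simp: factor_set_def)
  then show "factor_set x y \<in> kernel E G \<rho>" by (simp add: kernel_def)
  show "factor_set x y \<otimes> section_map (x \<otimes>\<^bsub>G\<^esub> y) = section_map x \<otimes> section_map y"
    using assms by (simp add: factor_set_def E.m_assoc)
qed

lemma factor_set_cocycle:
  assumes "x \<in> carrier G" "y \<in> carrier G" "z \<in> carrier G"
  shows "factor_set x y \<otimes> factor_set (x \<otimes>\<^bsub>G\<^esub> y) z = factor_set y z \<otimes> factor_set x (y \<otimes>\<^bsub>G\<^esub> z)"
proof -
  let ?s = section_map
  have xyz: "?s (x \<otimes>\<^bsub>G\<^esub> y \<otimes>\<^bsub>G\<^esub> z) \<in> carrier E" using assms by simp
  have "factor_set x y \<otimes> factor_set (x \<otimes>\<^bsub>G\<^esub> y) z \<otimes> ?s (x \<otimes>\<^bsub>G\<^esub> y \<otimes>\<^bsub>G\<^esub> z) = ?s x \<otimes> ?s y \<otimes> ?s z"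
    using assms factor_set_facts(1)[of x y] factor_set_facts(1)[of "x \<otimes>\<^bsub>G\<^esub> y" z]
      factor_set_facts(4)[of "x \<otimes>\<^bsub>G\<^esub> y" z]
    by (simp add: E.m_assoc) (simp add: factor_set_facts(4) E.m_assoc[symmetric])
  also have "\<dots> = ?s x \<otimes> (factor_set y z \<otimes> ?s (y \<otimes>\<^bsub>G\<^esub> z))"
    using assms by (simp add: factor_set_facts(4) E.m_assoc)
  also have "\<dots> = factor_set y z \<otimes> (?s x \<otimes> ?s (y \<otimes>\<^bsub>G\<^esub> z))"
    using assms factor_set_facts(1,2)[of y z] kernel_commute[of "factor_set y z" "?s x"]
    by (simp add: E.m_assoc[symmetric])
  also have "\<dots> = factor_set y z \<otimes> factor_set x (y \<otimes>\<^bsub>G\<^esub> z) \<otimes> ?s (x \<otimes>\<^bsub>G\<^esub> y \<otimes>\<^bsub>G\<^esub> z)"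
    using assms factor_set_facts[of y z] factor_set_facts[of x "y \<otimes>\<^bsub>G\<^esub> z"] by (simp add: E.m_assoc G.m_assoc)
  finally show ?thesis
    using assms xyz factor_set_facts(1)[of x y] factor_set_facts(1)[of "x \<otimes>\<^bsub>G\<^esub> y" z]
      factor_set_facts(1)[of y z] factor_set_facts(1)[of x "y \<otimes>\<^bsub>G\<^esub> z"]
    by simp
qed

text \<open>
  Commutators are values of the factor set on the cycles \<open>(x, y) - (y, x)\<close>.
\<close>

lemma pairing_eq_factor_sets:
  assumes "x \<in> carrier G" "y \<in> carrier G"
  shows "pairing x y = factor_set x y \<otimes> inv factor_set y x"
  using assms
  by (simp add: pairing_def factor_set_def G.m_comm[of y x] E.inv_mult_group E.m_assoc)
    (simp add: E.m_assoc[symmetric])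

end

proposition extension_group_central:
  assumes "comm_group G" "comm_group Q"
    and f: "\<And>x y. \<lbrakk>x \<in> carrier G; y \<in> carrier G\<rbrakk> \<Longrightarrow> f x y \<in> carrier Q"
    and cocycle: "\<And>x y z. \<lbrakk>x \<in> carrier G; y \<in> carrier G; z \<in> carrier G\<rbrakk> \<Longrightarrow>
      f x y \<otimes>\<^bsub>Q\<^esub> f (x \<otimes>\<^bsub>G\<^esub> y) z = f y z \<otimes>\<^bsub>Q\<^esub> f x (y \<otimes>\<^bsub>G\<^esub> z)"
  shows "central_extension (extension_group G Q f) G fst"
    and "x \<in> carrier G \<Longrightarrow> f \<one>\<^bsub>G\<^esub> x = f \<one>\<^bsub>G\<^esub> \<one>\<^bsub>G\<^esub>"
proof -
  interpret G: comm_group G by fact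
  interpret Q: comm_group Q by fact
  show f1: "f \<one>\<^bsub>G\<^esub> x = f \<one>\<^bsub>G\<^esub> \<one>\<^bsub>G\<^esub>" if "x \<in> carrier G" for x
    using cocycle[of "\<one>\<^bsub>G\<^esub>" "\<one>\<^bsub>G\<^esub>" x] that f by simp
  have f2: "f x \<one>\<^bsub>G\<^esub> = f \<one>\<^bsub>G\<^esub> \<one>\<^bsub>G\<^esub>" if "x \<in> carrier G" for x
    using cocycle[of x "\<one>\<^bsub>G\<^esub>" "\<one>\<^bsub>G\<^esub>"] that f by simp
  show "central_extension (extension_group G Q f) G fst"
  proof (intro central_extension.intro central_extension_axioms.intro)
    show "group (extension_group G Q f)"
      by (rule extension_group_is_group[OF G.is_group assms(2) f cocycle])
    show "comm_group G" by fact
    show "fst \<in> epi (extension_group G Q f) G"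
      using Q.one_closed by (force simp: epi_def hom_def)
    show "kernel (extension_group G Q f) G fst \<subseteq> center (extension_group G Q f)"
    proof
      fix t assume "t \<in> kernel (extension_group G Q f) G fst"
      then obtain a where t: "t = (\<one>\<^bsub>G\<^esub>, a)" "a \<in> carrier Q" by (auto simp: kernel_def)
      have "t \<otimes>\<^bsub>extension_group G Q f\<^esub> u = u \<otimes>\<^bsub>extension_group G Q f\<^esub> t"
        if u: "u \<in> carrier (extension_group G Q f)" for u
      proof -
        obtain x b where "u = (x, b)" "x \<in> carrier G" "b \<in> carrier Q" using u by auto
        then show ?thesis using t f1[of x] f2[of x] by (simp add: Q.m_comm)
      qed
      then show "t \<in> center (extension_group G Q f)"
        using t by (simp add: center_def del: extension_group_simps(2))
    qed
  qed
qed

text \<open>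
  The factor set as a homomorphism on bar 2-chains; on cycles it will induce the isomorphism from
  \<open>H\<^sub>2(G, \<int>)\<close> to \<open>[E, E]\<close>.
\<close>

definition (in central_extension) extends_factor_set :: "(('a \<times> 'a \<Rightarrow>\<^sub>0 int) \<Rightarrow> 'e) \<Rightarrow> bool" where
  "extends_factor_set \<Psi> \<longleftrightarrow> \<Psi> \<in> hom G.bar2 kernel_group \<and>
    (\<forall>x\<in>carrier G. \<forall>y\<in>carrier G. \<Psi> (frag_of (x, y)) = factor_set x y)"

lemma (in central_extension) extends_factor_setD:
  assumes "extends_factor_set \<Psi>"
  shows "\<Psi> \<in> hom G.bar2 kernel_group"
    and "\<lbrakk>x \<in> carrier G; y \<in> carrier G\<rbrakk> \<Longrightarrow> \<Psi> (frag_of (x, y)) = factor_set x y"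
  using assms by (auto simp: extends_factor_set_def)

lemma (in central_extension) extends_factor_set_exists: "\<exists>\<Psi>. extends_factor_set \<Psi>"
proof -
  interpret A: comm_group kernel_group by (rule comm_group_kernel)
  have "(\<lambda>(x, y). factor_set x y) ` (carrier G \<times> carrier G) \<subseteq> carrier kernel_group"
    using factor_set_facts(3) by auto
  from A.free_Abelian_group_universal[OF this] obtain \<Psi> where "\<Psi> \<in> hom G.bar2 kernel_group"
    "\<And>t. t \<in> carrier G \<times> carrier G \<Longrightarrow> \<Psi> (frag_of t) = (\<lambda>(x, y). factor_set x y) t"
    by blast
  then show ?thesis unfolding extends_factor_set_def by (intro exI[of _ \<Psi>]) simp
qed

text \<open>
  In the abelianisation of \<open>E\<close> the factor set becomes the coboundary of the section, so the image
  of a chain there depends only on its boundary.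
\<close>

lemma (in central_extension) chain_map_cycle:
  assumes "extends_factor_set \<Psi>"
    and z: "z \<in> G.bar_cycles"
  shows "\<Psi> z \<in> derived E (carrier E)"
proof -
  note \<Psi> = extends_factor_setD[OF assms(1)]
  let ?D = "derived E (carrier E)"
  interpret Q: comm_group "E Mod ?D" by (rule E.derived_quot_is_comm_group)
  interpret D: normal ?D E by (rule E.derived_self_is_normal)
  interpret A: comm_group kernel_group by (rule comm_group_kernel)
  interpret p: group_hom E "E Mod ?D" "\<lambda>e. ?D #> e"
    by unfold_locales (rule D.r_coset_hom_Mod)
  have "(\<lambda>x. ?D #> section_map x) ` carrier G \<subseteq> carrier (E Mod ?D)"
    using p.hom_closed by auto
  from Q.free_Abelian_group_universal[OF this] obtain \<beta> where \<beta>: "\<beta> \<in> hom G.bar1 (E Mod ?D)"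
    "\<And>x. x \<in> carrier G \<Longrightarrow> \<beta> (frag_of x) = ?D #> section_map x"
    by blast
  have zk: "Poly_Mapping.keys z \<subseteq> carrier G \<times> carrier G" and z0: "bar_boundary2 G z = 0"
    using z by (auto simp: kernel_def)
  have \<Psi>E: "\<Psi> \<in> hom G.bar2 E"
    using \<Psi>(1) by (auto simp: hom_def kernel_def)
  have "((\<lambda>e. ?D #> e) \<circ> \<Psi>) z = (\<beta> \<circ> bar_boundary2 G) z"
  proof (rule Q.hom_free_Abelian_group_eqI[OF _ _ _ zk])
    show "(\<lambda>e. ?D #> e) \<circ> \<Psi> \<in> hom G.bar2 (E Mod ?D)"
      by (rule Group.hom_compose[OF \<Psi>E p.homh])
    show "\<beta> \<circ> bar_boundary2 G \<in> hom G.bar2 (E Mod ?D)"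
      by (rule Group.hom_compose[OF G.bar_boundary2_hom \<beta>(1)])
    fix t assume "t \<in> carrier G \<times> carrier G"
    then obtain x y where t: "t = (x, y)" "x \<in> carrier G" "y \<in> carrier G" by auto
    define a b c where "a = ?D #> section_map x" and "b = ?D #> section_map y"
      and "c = ?D #> section_map (x \<otimes>\<^bsub>G\<^esub> y)"
    have abc: "a \<in> carrier (E Mod ?D)" "b \<in> carrier (E Mod ?D)" "c \<in> carrier (E Mod ?D)"
      unfolding a_def b_def c_def using t by (blast intro: p.hom_closed)+
    have "((\<lambda>e. ?D #> e) \<circ> \<Psi>) (frag_of t) =
        a \<otimes>\<^bsub>E Mod ?D\<^esub> b \<otimes>\<^bsub>E Mod ?D\<^esub> inv\<^bsub>E Mod ?D\<^esub> c"
      using t by (simp add: \<Psi>(2) factor_set_def a_def b_def c_def del: mult_FactGroup)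
    moreover have "(\<beta> \<circ> bar_boundary2 G) (frag_of t) =
        b \<otimes>\<^bsub>E Mod ?D\<^esub> inv\<^bsub>E Mod ?D\<^esub> c \<otimes>\<^bsub>E Mod ?D\<^esub> a"
    proof -
      have k: "Poly_Mapping.keys (frag_of y - frag_of (x \<otimes>\<^bsub>G\<^esub> y)) \<subseteq> carrier G"
        using t by (auto dest!: subsetD[OF keys_diff])
      have "\<beta> (frag_of y - frag_of (x \<otimes>\<^bsub>G\<^esub> y) + frag_of x) =
          \<beta> (frag_of y - frag_of (x \<otimes>\<^bsub>G\<^esub> y)) \<otimes>\<^bsub>E Mod ?D\<^esub> \<beta> (frag_of x)"
        using Group.hom_mult[OF \<beta>(1), of "frag_of y - frag_of (x \<otimes>\<^bsub>G\<^esub> y)" "frag_of x"] t k by simp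
      then show ?thesis
        using t \<beta>(2) Q.hom_free_Abelian_group_diff[OF \<beta>(1), of "frag_of y" "frag_of (x \<otimes>\<^bsub>G\<^esub> y)"]
        by (simp add: a_def b_def c_def del: mult_FactGroup)
    qed
    ultimately show "((\<lambda>e. ?D #> e) \<circ> \<Psi>) (frag_of t) = (\<beta> \<circ> bar_boundary2 G) (frag_of t)"
      using abc by (simp add: Q.m_ac del: mult_FactGroup)
  qed
  then have "?D #> \<Psi> z = ?D"
    using z0 Group.hom_one[OF \<beta>(1) group_free_Abelian_group Q.is_group] by simp
  moreover have "\<Psi> z \<in> carrier E" using hom_in_carrier[OF \<Psi>E] zk by simp
  ultimately show ?thesis using E.coset_join1[OF _ _ derived_subgroup] by blast
qed

text \<open>
  This is the cocycle identity for the factor set.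
\<close>

lemma (in central_extension) chain_map_boundary:
  assumes "extends_factor_set \<Psi>"
    and z: "Poly_Mapping.keys z \<subseteq> carrier G \<times> carrier G \<times> carrier G"
  shows "\<Psi> (bar_boundary3 G z) = \<one>"
proof -
  note \<Psi> = extends_factor_setD[OF assms(1)]
  interpret A: comm_group kernel_group by (rule comm_group_kernel)
  have "(\<Psi> \<circ> bar_boundary3 G) z = (\<lambda>_. \<one>\<^bsub>kernel_group\<^esub>) z"
  proof (rule A.hom_free_Abelian_group_eqI[OF _ _ _ z])
    show "\<Psi> \<circ> bar_boundary3 G \<in> hom G.bar3 kernel_group"
      by (rule Group.hom_compose[OF G.bar_boundary3_hom \<Psi>(1)])
    show "(\<lambda>_. \<one>\<^bsub>kernel_group\<^esub>) \<in> hom G.bar3 kernel_group"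
      using A.one_closed by (auto simp: hom_def)
    fix t assume "t \<in> carrier G \<times> carrier G \<times> carrier G"
    then obtain x y z where t: "t = (x, y, z)" "x \<in> carrier G" "y \<in> carrier G" "z \<in> carrier G"
      by auto
    define a b c d where "a = factor_set y z" and "b = factor_set (x \<otimes>\<^bsub>G\<^esub> y) z"
      and "c = factor_set x (y \<otimes>\<^bsub>G\<^esub> z)" and "d = factor_set x y"
    have abcd: "a \<in> carrier kernel_group" "b \<in> carrier kernel_group" "c \<in> carrier kernel_group"
        "d \<in> carrier kernel_group"
      using t factor_set_facts(3) by (auto simp: a_def b_def c_def d_def)
    have "\<Psi> (bar_boundary3 G (frag_of t)) =
        \<Psi> ((frag_of (y, z) - frag_of (x \<otimes>\<^bsub>G\<^esub> y, z)) - (frag_of (x, y) - frag_of (x, y \<otimes>\<^bsub>G\<^esub> z)))"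
      using t by (simp add: algebra_simps)
    also have "\<dots> = (a \<otimes>\<^bsub>kernel_group\<^esub> inv\<^bsub>kernel_group\<^esub> b) \<otimes>\<^bsub>kernel_group\<^esub>
        inv\<^bsub>kernel_group\<^esub> (d \<otimes>\<^bsub>kernel_group\<^esub> inv\<^bsub>kernel_group\<^esub> c)"
      using t A.hom_free_Abelian_group_diff[OF \<Psi>(1)]
      by (simp add: keys_diff_subset \<Psi>(2) a_def b_def c_def d_def)
    also have "\<dots> = (a \<otimes>\<^bsub>kernel_group\<^esub> c) \<otimes>\<^bsub>kernel_group\<^esub> inv\<^bsub>kernel_group\<^esub> (d \<otimes>\<^bsub>kernel_group\<^esub> b)"
      by (rule A.quotient_of_quotients[OF abcd])
    also have "a \<otimes>\<^bsub>kernel_group\<^esub> c = d \<otimes>\<^bsub>kernel_group\<^esub> b"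
      using t factor_set_cocycle[of x y z] by (simp add: a_def b_def c_def d_def)
    finally show "(\<Psi> \<circ> bar_boundary3 G) (frag_of t) = \<one>\<^bsub>kernel_group\<^esub>"
      using A.r_inv[OF A.m_closed[OF abcd(4,2)]] by simp
  qed
  then show ?thesis by simp
qed

lemma (in central_extension) chain_map_onto:
  assumes "extends_factor_set \<Psi>"
  shows "derived E (carrier E) \<subseteq> \<Psi> ` G.bar_cycles"
proof -
  note \<Psi> = extends_factor_setD[OF assms(1)]
  interpret A: comm_group kernel_group by (rule comm_group_kernel)
  have \<Psi>E: "\<Psi> \<in> hom G.bar2 E"
    using \<Psi>(1) by (auto simp: hom_def kernel_def)
  interpret \<Psi>: group_hom G.bar2 E \<Psi>
    using \<Psi>E by (intro group_hom.intro group_hom_axioms.intro) auto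
  interpret \<delta>: group_hom G.bar2 G.bar1 "bar_boundary2 G"
    using G.bar_boundary2_hom by (intro group_hom.intro group_hom_axioms.intro) auto
  have "pairing x y \<in> \<Psi> ` G.bar_cycles"
    if "x \<in> carrier G" "y \<in> carrier G" for x y
  proof (rule image_eqI)
    show "frag_of (x, y) - frag_of (y, x) \<in> G.bar_cycles"
      using that
      by (simp add: keys_diff_subset kernel_def bar_boundary2_def frag_extend_diff G.m_comm[of y x])
    show "pairing x y = \<Psi> (frag_of (x, y) - frag_of (y, x))"
      using that E.hom_free_Abelian_group_diff[OF \<Psi>E]
      by (simp add: \<Psi>(2) pairing_eq_factor_sets)
  qed
  then show ?thesis
    unfolding derived_generated_by_pairing
    by (intro E.generate_subgroup_incl \<Psi>.subgroup_img_is_subgroup[OF \<delta>.subgroup_kernel]) auto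
qed

context free_central_presentation
begin

text \<open>
  The projection of bar 2-chains to chains modulo boundaries is a cocycle \<open>f\<close>, the universal
  one.  A homomorphism \<open>\<phi>\<close> from \<open>E\<close> to the extension of \<open>G\<close> by \<open>f\<close> recovers the class of a chain from
  its image under \<open>\<Psi>\<close>, up to a term that depends only on the boundary of the chain.  For a cycle
  that term vanishes, so \<open>\<Psi>(z) = 1\<close> forces the class of \<open>z\<close> to be zero.
\<close>

lemma cycle_is_boundary:
  assumes "extends_factor_set \<Psi>"
    and z: "z \<in> G.bar_cycles" and \<Psi>z: "\<Psi> z = \<one>"
  shows "z \<in> bar_boundary3 G ` carrier G.bar3"
proof -
  note \<Psi> = extends_factor_setD[OF assms(1)]
  interpret A: comm_group kernel_group by (rule comm_group_kernel)
  interpret C2: comm_group G.bar2 by (rule abelian_free_Abelian_group)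
  interpret \<delta>: group_hom G.bar3 G.bar2 "bar_boundary3 G"
    using G.bar_boundary3_hom by (intro group_hom.intro group_hom_axioms.intro) auto
  define B where "B = bar_boundary3 G ` carrier G.bar3"
  have B: "subgroup B G.bar2" unfolding B_def by (rule \<delta>.img_is_subgroup)
  interpret B: normal B G.bar2 by (rule C2.subgroup_imp_normal[OF B])
  define Q where "Q = G.bar2 Mod B"
  interpret Q: comm_group Q unfolding Q_def by (rule C2.abelian_FactGroup[OF B])
  define q where "q z = B #>\<^bsub>G.bar2\<^esub> z" for z
  have q: "q \<in> hom G.bar2 Q"
    using B.r_coset_hom_Mod by (simp add: q_def[abs_def] Q_def)
  have qB: "q b = \<one>\<^bsub>Q\<^esub>" if "b \<in> B" for b
  proof -
    have "b \<in> carrier G.bar2" using B.subset that by (rule subsetD)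
    from C2.coset_join2[OF this B that] show ?thesis by (simp add: q_def Q_def)
  qed
  define f where "f x y = q (frag_of (x, y))" for x y
  have f: "f x y \<in> carrier Q" if "x \<in> carrier G" "y \<in> carrier G" for x y
    using hom_in_carrier[OF q] that by (simp add: f_def)
  have cocycle: "f x y \<otimes>\<^bsub>Q\<^esub> f (x \<otimes>\<^bsub>G\<^esub> y) z = f y z \<otimes>\<^bsub>Q\<^esub> f x (y \<otimes>\<^bsub>G\<^esub> z)"
    if xyz: "x \<in> carrier G" "y \<in> carrier G" "z \<in> carrier G" for x y z
  proof -
    have "bar_boundary3 G (frag_of (x, y, z)) \<in> B"
      using xyz unfolding B_def by (intro imageI) simp
    then have "q (bar_boundary3 G (frag_of (x, y, z))) = \<one>\<^bsub>Q\<^esub>" by (rule qB)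
    also have "bar_boundary3 G (frag_of (x, y, z)) =
        (frag_of (y, z) - frag_of (x \<otimes>\<^bsub>G\<^esub> y, z)) - (frag_of (x, y) - frag_of (x, y \<otimes>\<^bsub>G\<^esub> z))"
      by (simp add: algebra_simps)
    also have "q \<dots> = (f y z \<otimes>\<^bsub>Q\<^esub> inv\<^bsub>Q\<^esub> f (x \<otimes>\<^bsub>G\<^esub> y) z) \<otimes>\<^bsub>Q\<^esub>
        inv\<^bsub>Q\<^esub> (f x y \<otimes>\<^bsub>Q\<^esub> inv\<^bsub>Q\<^esub> f x (y \<otimes>\<^bsub>G\<^esub> z))"
      using xyz by (simp add: Q.hom_free_Abelian_group_diff[OF q] keys_diff_subset f_def)
    also have "\<dots> = (f y z \<otimes>\<^bsub>Q\<^esub> f x (y \<otimes>\<^bsub>G\<^esub> z)) \<otimes>\<^bsub>Q\<^esub> inv\<^bsub>Q\<^esub> (f x y \<otimes>\<^bsub>Q\<^esub> f (x \<otimes>\<^bsub>G\<^esub> y) z)"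
      using xyz f by (intro Q.quotient_of_quotients) auto
    finally show ?thesis
      using xyz f by (simp add: Q.inv_solve_right')
  qed
  let ?L = "extension_group G Q f"
  have L: "central_extension ?L G fst" and f1: "\<And>x. x \<in> carrier G \<Longrightarrow> f \<one>\<^bsub>G\<^esub> x = f \<one>\<^bsub>G\<^esub> \<one>\<^bsub>G\<^esub>"
    using extension_group_central[OF G.comm_group_axioms Q.comm_group_axioms f cocycle] by blast+
  interpret L: central_extension ?L G fst by (rule L)
  obtain \<phi> where \<phi>: "\<phi> \<in> hom E ?L" "\<And>e. e \<in> carrier E \<Longrightarrow> fst (\<phi> e) = \<rho> e"
    by (rule lift_to_central_extension[OF L]) (rule that, assumption, simp)
  have \<phi>Q: "snd (\<phi> e) \<in> carrier Q" if "e \<in> carrier E" for e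
    using hom_in_carrier[OF \<phi>(1) that] by (auto simp: mem_Times_iff)
  \<comment> \<open>The identity of the extension is \<open>(1, f(1, 1)\<^sup>-\<^sup>1)\<close>; the factor \<open>f(1, 1)\<close> makes \<open>u\<close> a homomorphism.\<close>
  define u where "u a = snd (\<phi> a) \<otimes>\<^bsub>Q\<^esub> f \<one>\<^bsub>G\<^esub> \<one>\<^bsub>G\<^esub>" for a
  have f11: "f \<one>\<^bsub>G\<^esub> \<one>\<^bsub>G\<^esub> \<in> carrier Q" by (rule f) auto
  have snd_mult: "snd (\<phi> (a \<otimes> b)) = snd (\<phi> a) \<otimes>\<^bsub>Q\<^esub> snd (\<phi> b) \<otimes>\<^bsub>Q\<^esub> f (\<rho> a) (\<rho> b)"
    if "a \<in> carrier E" "b \<in> carrier E" for a b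
  proof -
    have "\<phi> (a \<otimes> b) = \<phi> a \<otimes>\<^bsub>?L\<^esub> \<phi> b"
      by (rule Group.hom_mult[OF \<phi>(1) that])
    then show ?thesis
      using \<phi>(2)[OF that(1)] \<phi>(2)[OF that(2)] by (cases "\<phi> a"; cases "\<phi> b") simp
  qed
  have u: "u \<in> hom kernel_group Q"
  proof (rule homI)
    fix a b assume ab: "a \<in> carrier kernel_group" "b \<in> carrier kernel_group"
    then have "a \<in> carrier E" "b \<in> carrier E" "\<rho> a = \<one>\<^bsub>G\<^esub>" "\<rho> b = \<one>\<^bsub>G\<^esub>" by (auto simp: kernel_def)
    then show "u a \<in> carrier Q" "u (a \<otimes>\<^bsub>kernel_group\<^esub> b) = u a \<otimes>\<^bsub>Q\<^esub> u b"
      using snd_mult \<phi>Q f11 by (auto simp: u_def Q.m_ac)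
  qed
  define c where "c x = snd (\<phi> (section_map x))" for x
  have c: "c x \<in> carrier Q" if "x \<in> carrier G" for x
    using \<phi>Q that by (simp add: c_def)
  \<comment> \<open>Compare \<open>\<phi>\<close> on the two sides of \<open>\<sigma>(x, y) s(x y) = s(x) s(y)\<close>.\<close>
  have u_factor_set: "u (factor_set x y) \<otimes>\<^bsub>Q\<^esub> c (x \<otimes>\<^bsub>G\<^esub> y) = c x \<otimes>\<^bsub>Q\<^esub> c y \<otimes>\<^bsub>Q\<^esub> f x y"
    if xy: "x \<in> carrier G" "y \<in> carrier G" for x y
  proof -
    have "snd (\<phi> (factor_set x y)) \<otimes>\<^bsub>Q\<^esub> c (x \<otimes>\<^bsub>G\<^esub> y) \<otimes>\<^bsub>Q\<^esub> f \<one>\<^bsub>G\<^esub> (x \<otimes>\<^bsub>G\<^esub> y) =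
        c x \<otimes>\<^bsub>Q\<^esub> c y \<otimes>\<^bsub>Q\<^esub> f x y"
      using xy snd_mult[of "factor_set x y" "section_map (x \<otimes>\<^bsub>G\<^esub> y)"]
        snd_mult[of "section_map x" "section_map y"] factor_set_facts[OF xy]
      by (simp add: c_def)
    then show ?thesis
      using xy f1[of "x \<otimes>\<^bsub>G\<^esub> y"] f11 c \<phi>Q[OF factor_set_facts(1)[OF xy]]
      by (simp add: u_def Q.m_ac)
  qed
  have "c ` carrier G \<subseteq> carrier Q" using c by auto
  from Q.free_Abelian_group_universal[OF this] obtain c' where
    c': "c' \<in> hom G.bar1 Q" "\<And>x. x \<in> carrier G \<Longrightarrow> c' (frag_of x) = c x" by blast
  have zk: "Poly_Mapping.keys z \<subseteq> carrier G \<times> carrier G" and z0: "bar_boundary2 G z = 0"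
    using z by (auto simp: kernel_def)
  have "(u \<circ> \<Psi>) z = (\<lambda>z. c' (bar_boundary2 G z) \<otimes>\<^bsub>Q\<^esub> q z) z"
  proof (rule Q.hom_free_Abelian_group_eqI[OF _ _ _ zk])
    show "u \<circ> \<Psi> \<in> hom G.bar2 Q" by (rule Group.hom_compose[OF \<Psi>(1) u])
    have "c' \<circ> bar_boundary2 G \<in> hom G.bar2 Q"
      by (rule Group.hom_compose[OF G.bar_boundary2_hom c'(1)])
    then show "(\<lambda>z. c' (bar_boundary2 G z) \<otimes>\<^bsub>Q\<^esub> q z) \<in> hom G.bar2 Q"
      using Q.hom_group_mult[OF _ q] by (simp add: comp_def)
    fix t assume "t \<in> carrier G \<times> carrier G"
    then obtain x y where t: "t = (x, y)" "x \<in> carrier G" "y \<in> carrier G" by auto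
    have xy: "c x \<in> carrier Q" "c y \<in> carrier Q" "c (x \<otimes>\<^bsub>G\<^esub> y) \<in> carrier Q" "f x y \<in> carrier Q"
      "u (factor_set x y) \<in> carrier Q"
      using t c f hom_in_carrier[OF u] factor_set_facts(3)[of x y] by auto
    have \<delta>t: "bar_boundary2 G (frag_of t) = frag_of y - (frag_of (x \<otimes>\<^bsub>G\<^esub> y) - frag_of x)"
      using t by simp
    have c't: "c' (frag_of y - (frag_of (x \<otimes>\<^bsub>G\<^esub> y) - frag_of x)) = c y \<otimes>\<^bsub>Q\<^esub> inv\<^bsub>Q\<^esub> (c (x \<otimes>\<^bsub>G\<^esub> y) \<otimes>\<^bsub>Q\<^esub> inv\<^bsub>Q\<^esub> c x)"
      using t by (simp add: Q.hom_free_Abelian_group_diff[OF c'(1)] keys_diff_subset c'(2) del: diff_diff_eq2)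
    have "c' (bar_boundary2 G (frag_of t)) \<otimes>\<^bsub>Q\<^esub> q (frag_of t) =
        (c x \<otimes>\<^bsub>Q\<^esub> c y \<otimes>\<^bsub>Q\<^esub> f x y) \<otimes>\<^bsub>Q\<^esub> inv\<^bsub>Q\<^esub> c (x \<otimes>\<^bsub>G\<^esub> y)"
      unfolding \<delta>t c't using Q.move_quotient[OF xy(1-4)] by (simp add: f_def t(1))
    also have "\<dots> = u (factor_set x y)"
      unfolding u_factor_set[OF t(2,3), symmetric] using xy by (simp add: Q.m_assoc)
    finally show "(u \<circ> \<Psi>) (frag_of t) = c' (bar_boundary2 G (frag_of t)) \<otimes>\<^bsub>Q\<^esub> q (frag_of t)"
      using t by (simp add: \<Psi>(2))
  qed
  moreover have "u \<one> = \<one>\<^bsub>Q\<^esub>"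
    using Group.hom_one[OF u A.is_group Q.is_group] by simp
  moreover have "c' 0 = \<one>\<^bsub>Q\<^esub>"
    using Group.hom_one[OF c'(1) group_free_Abelian_group Q.is_group] by simp
  moreover have "q z \<in> carrier Q" using hom_in_carrier[OF q] zk by simp
  ultimately have "q z = \<one>\<^bsub>Q\<^esub>" by (simp add: z0 \<Psi>z)
  then have "z \<in> B"
    using C2.coset_join1[OF _ _ B, of z] zk by (simp add: q_def Q_def)
  then show ?thesis by (simp add: B_def)
qed

text \<open>
  Usually stated as \<open>H\<^sub>2(G, \<int>) = (N \<inter> [F, F]) / [F, N]\<close>; here \<open>[F, F] \<le> N\<close>, as \<open>G\<close> is abelian.
\<close>

theorem Hopf_formula: "commutator_group \<cong> H2_int G"
proof -
  obtain \<Psi> where ext: "extends_factor_set \<Psi>" using extends_factor_set_exists by blast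
  note \<Psi> = extends_factor_setD[OF ext]
  let ?C = "G.bar2\<lparr>carrier := G.bar_cycles\<rparr>"
  interpret \<delta>: group_hom G.bar2 G.bar1 "bar_boundary2 G"
    using G.bar_boundary2_hom by (intro group_hom.intro group_hom_axioms.intro) auto
  have ZC: "group ?C"
    by (rule group.subgroup_imp_group[OF _ \<delta>.subgroup_kernel]) simp
  have "\<Psi> \<in> hom ?C commutator_group"
    using \<Psi>(1) chain_map_cycle[OF ext] by (auto simp: hom_def kernel_def)
  then interpret \<Psi>: group_hom ?C commutator_group \<Psi>
    using ZC comm_group_derived by (intro group_hom.intro group_hom_axioms.intro) (auto simp: comm_group_def)
  have "kernel ?C commutator_group \<Psi> = bar_boundary3 G ` carrier G.bar3"
  proof
    show "kernel ?C commutator_group \<Psi> \<subseteq> bar_boundary3 G ` carrier G.bar3"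
      using cycle_is_boundary[OF ext] unfolding kernel_def[of ?C] by auto
    show "bar_boundary3 G ` carrier G.bar3 \<subseteq> kernel ?C commutator_group \<Psi>"
      using chain_map_boundary[OF ext] G.bar_boundary2_boundary3 hom_in_carrier[OF G.bar_boundary3_hom]
      by (simp add: kernel_def image_subset_iff)
  qed
  moreover have "\<Psi> ` carrier ?C = carrier commutator_group"
    using chain_map_cycle[OF ext] chain_map_onto[OF ext] by auto
  ultimately have "H2_int G \<cong> commutator_group"
    using \<Psi>.FactGroup_iso by (simp add: H2_int_def Let_def)
  moreover have "group (H2_int G)"
  proof -
    have "group (?C Mod kernel ?C commutator_group \<Psi>)"
      by (rule normal.factorgroup_is_group[OF \<Psi>.normal_kernel])
    then show ?thesis
      using \<open>kernel ?C commutator_group \<Psi> = _\<close> by (simp add: H2_int_def Let_def)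
  qed
  ultimately show ?thesis by (rule group.iso_sym[rotated])
qed

end

section \<open>Characters of abelian groups\<close>

text \<open>
  Only the values on \<open>B\<close> matter, so a character of a subgroup can be extended without changing
  the type.
\<close>

definition character_on :: "('a, 'm) monoid_scheme \<Rightarrow> 'a set \<Rightarrow> ('a \<Rightarrow> complex) \<Rightarrow> bool" where
  "character_on G B \<chi> \<longleftrightarrow>
    (\<forall>a\<in>B. \<chi> a \<noteq> 0) \<and> (\<forall>a\<in>B. \<forall>b\<in>B. \<chi> (a \<otimes>\<^bsub>G\<^esub> b) = \<chi> a * \<chi> b)"

context comm_group
begin

lemma character_on_one:
  assumes "character_on G B \<chi>" "subgroup B G"
  shows "\<chi> \<one> = 1"
proof -
  have "\<one> \<in> B" using assms(2) by (rule subgroup.one_closed)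
  then have "\<chi> (\<one> \<otimes> \<one>) = \<chi> \<one> * \<chi> \<one>" "\<chi> \<one> \<noteq> 0"
    using assms(1) unfolding character_on_def by blast+
  then show ?thesis by simp
qed

lemma character_on_inv:
  assumes "character_on G B \<chi>" "subgroup B G" "a \<in> B"
  shows "\<chi> (inv a) = inverse (\<chi> a)"
proof -
  have a: "a \<in> carrier G" "inv a \<in> B"
    using subgroup.mem_carrier[OF assms(2,3)] subgroup.m_inv_closed[OF assms(2,3)] by auto
  then have "\<chi> (a \<otimes> inv a) = \<chi> a * \<chi> (inv a)" "\<chi> a \<noteq> 0"
    using assms(1,3) unfolding character_on_def by blast+
  then show ?thesis
    using a character_on_one[OF assms(1,2)] by (simp add: field_simps)
qed

lemma character_on_nat_pow:
  assumes "character_on G B \<chi>" "subgroup B G" "a \<in> B"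
  shows "\<chi> (a [^] (k::nat)) = \<chi> a ^ k"
proof (induction k)
  case 0
  then show ?case using character_on_one[OF assms(1,2)] by simp
next
  case (Suc k)
  have "a [^] k \<in> B"
    using subgroup_int_pow_closed[OF assms(2,3), of "int k"] by (simp only: int_pow_int)
  then show ?case
    using Suc assms(1,3) by (simp add: character_on_def)
qed

lemma character_on_int_pow:
  assumes "character_on G B \<chi>" "subgroup B G" "a \<in> B"
  shows "\<chi> (a [^] (k::int)) = \<chi> a powi k"
proof (cases "k \<ge> 0")
  case True
  then show ?thesis
    using character_on_nat_pow[OF assms, of "nat k"] by (simp add: power_int_def flip: int_pow_int)
next
  case False
  have a: "a \<in> carrier G" using assms(2,3) by (rule subgroup.mem_carrier)
  have p: "a [^] nat (- k) \<in> B"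
    using subgroup_int_pow_closed[OF assms(2,3), of "int (nat (- k))"] by (simp only: int_pow_int)
  have "a [^] k = inv (a [^] nat (- k))"
    using False by (subst int_pow_def2) simp
  then show ?thesis
    using False character_on_nat_pow[OF assms, of "nat (- k)"] character_on_inv[OF assms(1,2) p]
    unfolding power_int_def by (simp only: power_inverse if_False)
qed

definition adjoin :: "'a set \<Rightarrow> 'a \<Rightarrow> 'a set" where
  "adjoin B x = {b \<otimes> x [^] k |b k. b \<in> B \<and> k \<in> (UNIV :: int set)}"

lemma adjoin_subgroup:
  assumes "subgroup B G" "x \<in> carrier G"
  shows "subgroup (adjoin B x) G" "B \<subseteq> adjoin B x" "x \<in> adjoin B x"
proof -
  interpret B: subgroup B G by fact
  have BG: "b \<in> carrier G" if "b \<in> B" for b using that B.subset by auto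
  show "subgroup (adjoin B x) G"
  proof (rule subgroupI)
    show "adjoin B x \<subseteq> carrier G" using BG assms(2) by (auto simp: adjoin_def)
    show "adjoin B x \<noteq> {}" unfolding adjoin_def using B.one_closed by blast
    fix a assume "a \<in> adjoin B x"
    then obtain b k where a: "b \<in> B" "a = b \<otimes> x [^] (k::int)" by (auto simp: adjoin_def)
    then have "inv a = inv b \<otimes> x [^] (- k)"
      using BG assms(2) by (simp add: inv_mult int_pow_neg)
    then show "inv a \<in> adjoin B x" using a(1) by (auto simp: adjoin_def)
  next
    fix a a' assume "a \<in> adjoin B x" "a' \<in> adjoin B x"
    then obtain b k b' k' where a: "b \<in> B" "a = b \<otimes> x [^] (k::int)" "b' \<in> B" "a' = b' \<otimes> x [^] (k'::int)"
      by (auto simp: adjoin_def)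
    then have "a \<otimes> a' = (b \<otimes> b') \<otimes> x [^] (k + k')"
      using BG assms(2) by (simp add: int_pow_mult m_ac)
    then show "a \<otimes> a' \<in> adjoin B x" using a(1,3) unfolding adjoin_def by blast
  qed
  show "B \<subseteq> adjoin B x"
  proof
    fix b assume "b \<in> B"
    then have "b = b \<otimes> x [^] (0::int)" using BG by simp
    then show "b \<in> adjoin B x" using \<open>b \<in> B\<close> unfolding adjoin_def by blast
  qed
  have "x = \<one> \<otimes> x [^] (1::int)" using assms(2) by simp
  then show "x \<in> adjoin B x" using B.one_closed unfolding adjoin_def by blast
qed

text \<open>
  The value \<open>w\<close> at \<open>x\<close> determines the extension; it exists iff \<open>w\<close> is compatible with the powers
  of \<open>x\<close> that already lie in \<open>B\<close>.
\<close>

lemma character_extend_root: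
  assumes B: "subgroup B G" and x: "x \<in> carrier G" and \<chi>: "character_on G B \<chi>" and w: "w \<noteq> 0"
    and root: "\<And>k::int. x [^] k \<in> B \<Longrightarrow> \<chi> (x [^] k) = w powi k"
  obtains \<chi>' where "character_on G (adjoin B x) \<chi>'" "\<And>b. b \<in> B \<Longrightarrow> \<chi>' b = \<chi> b" "\<chi>' x = w"
proof -
  interpret B: subgroup B G by fact
  have BG: "b \<in> carrier G" if "b \<in> B" for b using that B.subset by auto
  have \<chi>m: "\<chi> (a \<otimes> b) = \<chi> a * \<chi> b" if "a \<in> B" "b \<in> B" for a b
    using \<chi> that by (simp add: character_on_def)
  have wd: "\<chi> b * w powi k = \<chi> b' * w powi k'"
    if "b \<in> B" "b' \<in> B" "b \<otimes> x [^] k = b' \<otimes> x [^] k'" for b b' and k k' :: int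
  proof -
    have "x [^] (k - k') = x [^] k \<otimes> inv (x [^] k')" using x by (simp add: int_pow_diff)
    also have "x [^] k = inv b \<otimes> (b \<otimes> x [^] k)" using BG[OF that(1)] x by (simp add: m_assoc[symmetric])
    also have "\<dots> \<otimes> inv (x [^] k') = inv b \<otimes> b'"
      unfolding that(3) using BG[OF that(1)] BG[OF that(2)] x by (simp add: m_assoc)
    finally have "x [^] (k - k') = inv b \<otimes> b'" .
    then have "\<chi> b * w powi (k - k') = \<chi> b * \<chi> (inv b \<otimes> b')"
      using root[of "k - k'"] that by auto
    also have "\<dots> = \<chi> (b \<otimes> (inv b \<otimes> b'))" using that by (simp add: \<chi>m)
    also have "\<dots> = \<chi> b'" using that BG by (simp add: m_assoc[symmetric])
    finally show ?thesis using w by (simp add: power_int_diff field_simps)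
  qed
  define \<chi>' where "\<chi>' y = (case SOME p. fst p \<in> B \<and> y = fst p \<otimes> x [^] (snd p :: int) of
      (b, k) \<Rightarrow> \<chi> b * w powi k)" for y
  have \<chi>': "\<chi>' (b \<otimes> x [^] k) = \<chi> b * w powi k" if "b \<in> B" for b and k :: int
  proof -
    let ?P = "\<lambda>p. fst p \<in> B \<and> b \<otimes> x [^] k = fst p \<otimes> x [^] (snd p :: int)"
    have "?P (b, k)" using that by simp
    then have "?P (SOME p. ?P p)" by (rule someI)
    then show ?thesis
      unfolding \<chi>'_def using wd[OF _ that] by (simp add: case_prod_beta)
  qed
  show ?thesis
  proof
    show "character_on G (adjoin B x) \<chi>'"
      unfolding character_on_def
    proof (intro conjI ballI)
      fix a assume "a \<in> adjoin B x"
      then show "\<chi>' a \<noteq> 0"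
        using \<chi> w by (auto simp: adjoin_def \<chi>' character_on_def)
      fix a' assume "a' \<in> adjoin B x"
      with \<open>a \<in> adjoin B x\<close> obtain b k b' k'
        where a: "b \<in> B" "a = b \<otimes> x [^] (k::int)" "b' \<in> B" "a' = b' \<otimes> x [^] (k'::int)"
        by (auto simp: adjoin_def)
      then have "a \<otimes> a' = (b \<otimes> b') \<otimes> x [^] (k + k')"
        using BG x by (simp add: int_pow_mult m_ac)
      then show "\<chi>' (a \<otimes> a') = \<chi>' a * \<chi>' a'"
        using a w by (simp add: \<chi>' \<chi>m power_int_add)
    qed
    show "\<chi>' b = \<chi> b" if "b \<in> B" for b
      using \<chi>'[OF that, of 0] BG[OF that] by simp
    show "\<chi>' x = w"
      using \<chi>'[OF B.one_closed, of 1] x character_on_one[OF \<chi> B] by simp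
  qed
qed

lemma relative_order:
  assumes B: "subgroup B G" and x: "x \<in> carrier G" and k: "x [^] (k::int) \<in> B" "k \<noteq> 0"
  obtains m :: nat where "m > 0" "\<And>k::int. x [^] k \<in> B \<longleftrightarrow> int m dvd k"
proof -
  interpret B: subgroup B G by fact
  have pow: "(x [^] i) [^] (j::int) \<in> B" if "x [^] i \<in> B" for i j :: int
    by (rule subgroup_int_pow_closed[OF B that])
  define P where "P m \<longleftrightarrow> m > 0 \<and> x [^] (int m) \<in> B" for m :: nat
  have "P (nat \<bar>k\<bar>)"
  proof (cases "k > 0")
    case True
    then show ?thesis using k by (simp add: P_def)
  next
    case False
    then have "inv (x [^] k) = x [^] int (nat \<bar>k\<bar>)" using x by (simp add: int_pow_neg)
    then show ?thesis using B.m_inv_closed[OF k(1)] k(2) by (simp add: P_def)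
  qed
  then have m: "P (LEAST m. P m)" by (rule LeastI)
  define m where "m = (LEAST m. P m)"
  have m: "m > 0" "x [^] (int m) \<in> B" using m by (auto simp: P_def m_def)
  have "x [^] k \<in> B \<longleftrightarrow> int m dvd k" for k :: int
  proof
    assume "int m dvd k"
    then obtain q where "k = int m * q" by auto
    then show "x [^] k \<in> B" using pow[OF m(2), of q] x by (simp add: int_pow_pow)
  next
    assume kB: "x [^] k \<in> B"
    have "x [^] (k mod int m) = x [^] k \<otimes> (x [^] int m) [^] (- (k div int m))"
      using x by (simp add: int_pow_pow minus_mult_div_eq_mod flip: int_pow_mult)
    then have "x [^] (k mod int m) \<in> B" using kB pow[OF m(2)] by simp
    moreover have "k mod int m \<ge> 0" "k mod int m < int m" using m(1) by auto
    ultimately have "nat (k mod int m) = 0"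
    proof -
      have "\<not> P (nat (k mod int m))"
        using \<open>k mod int m < int m\<close> \<open>k mod int m \<ge> 0\<close> unfolding m_def by (intro not_less_Least) (simp add: nat_less_iff)
      then show ?thesis
        using \<open>x [^] (k mod int m) \<in> B\<close> \<open>k mod int m \<ge> 0\<close> by (auto simp: P_def)
    qed
    then show "int m dvd k" using \<open>k mod int m \<ge> 0\<close> by (simp add: dvd_eq_mod_eq_0)
  qed
  then show ?thesis using m(1) that by blast
qed

lemma character_root_condition:
  assumes B: "subgroup B G" and x: "x \<in> carrier G" and \<chi>: "character_on G B \<chi>"
    and m: "\<And>k::int. x [^] k \<in> B \<longleftrightarrow> int m dvd k" and w: "w ^ m = \<chi> (x [^] (int m))"
    and k: "x [^] (k::int) \<in> B"
  shows "\<chi> (x [^] k) = w powi k"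
proof -
  obtain q where q: "k = int m * q" using k m by auto
  have "\<chi> (x [^] k) = \<chi> ((x [^] (int m)) [^] q)" using x by (simp add: q int_pow_pow)
  also have "\<dots> = \<chi> (x [^] (int m)) powi q"
    using character_on_int_pow[OF \<chi> B] m by simp
  also have "\<dots> = w powi k" by (simp add: q power_int_mult flip: w)
  finally show ?thesis .
qed

text \<open>
  Divisibility of the multiplicative group of \<open>\<complex>\<close>: if \<open>m > 0\<close> is least with \<open>x\<^sup>m \<in> B\<close>, any \<open>m\<close>-th
  root of \<open>\<chi>(x\<^sup>m)\<close> will do.
\<close>

lemma character_extend_adjoin:
  assumes B: "subgroup B G" and x: "x \<in> carrier G" and \<chi>: "character_on G B \<chi>"
  obtains \<chi>' where "character_on G (adjoin B x) \<chi>'" "\<And>b. b \<in> B \<Longrightarrow> \<chi>' b = \<chi> b"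
proof (cases "\<exists>k::int. k \<noteq> 0 \<and> x [^] k \<in> B")
  case True
  then obtain m where m: "m > 0" "\<And>k::int. x [^] k \<in> B \<longleftrightarrow> int m dvd k"
    using relative_order[OF B x] by metis
  define c where "c = \<chi> (x [^] (int m))"
  have c: "c \<noteq> 0" using \<chi> m by (simp add: c_def character_on_def)
  have "card {w. w ^ m = c} = m" using c m(1) by (rule card_nth_roots)
  then have "{w. w ^ m = c} \<noteq> {}" using m(1) by (metis card.empty less_irrefl)
  then obtain w where w: "w ^ m = c" by auto
  then have "w \<noteq> 0" using c m(1) by (auto simp: power_0_left)
  then show ?thesis
    using character_extend_root[OF B x \<chi> \<open>w \<noteq> 0\<close>] character_root_condition[OF B x \<chi> m(2) w[unfolded c_def]] that
    by metis
next
  case False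
  have "\<chi> (x [^] k) = 1 powi k" if "x [^] k \<in> B" for k :: int
    using False that character_on_one[OF \<chi> B] by (cases "k = 0") auto
  then show ?thesis
    using character_extend_root[OF B x \<chi>, of 1] that by (metis one_neq_zero)
qed

lemma character_extend_finite:
  assumes "finite S" "S \<subseteq> carrier G" and B: "subgroup B G" and \<chi>: "character_on G B \<chi>"
  shows "\<exists>B' \<chi>'. subgroup B' G \<and> B \<union> S \<subseteq> B' \<and> character_on G B' \<chi>' \<and> (\<forall>b\<in>B. \<chi>' b = \<chi> b)"
  using assms(1,2)
proof (induction S)
  case empty
  then show ?case using B \<chi> by auto
next
  case (insert x S)
  then obtain B1 \<chi>1 where 1: "subgroup B1 G" "B \<union> S \<subseteq> B1" "character_on G B1 \<chi>1" "\<forall>b\<in>B. \<chi>1 b = \<chi> b"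
    by auto
  have x: "x \<in> carrier G" using insert.prems by auto
  obtain \<chi>2 where 2: "character_on G (adjoin B1 x) \<chi>2" "\<And>b. b \<in> B1 \<Longrightarrow> \<chi>2 b = \<chi>1 b"
    using character_extend_adjoin[OF 1(1) x 1(3)] by metis
  have "B \<union> insert x S \<subseteq> adjoin B1 x"
    using 1(2) adjoin_subgroup(2,3)[OF 1(1) x] by auto
  then show ?case
    using 1 2 adjoin_subgroup(1)[OF 1(1) x]
    by (intro exI[of _ "adjoin B1 x"] exI[of _ \<chi>2]) (auto simp: subset_iff)
qed

lemma adjoin_finite:
  assumes B: "subgroup B G" "finite B" and x: "x \<in> carrier G" and m: "m > 0" "x [^] (int m) \<in> B"
  shows "finite (adjoin B x)" "card (adjoin B x) \<le> m * card B"
proof -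
  interpret B: subgroup B G by fact
  have sub: "adjoin B x \<subseteq> (\<lambda>(b, j). b \<otimes> x [^] (int j)) ` (B \<times> {..<m})"
  proof
    fix a assume "a \<in> adjoin B x"
    then obtain b k where a: "b \<in> B" "a = b \<otimes> x [^] (k::int)" by (auto simp: adjoin_def)
    have bG: "b \<in> carrier G" using a(1) by simp
    have "(x [^] (int m)) [^] (k div int m) \<in> B"
      by (rule subgroup_int_pow_closed[OF B(1) m(2)])
    moreover have "x [^] k = (x [^] (int m)) [^] (k div int m) \<otimes> x [^] (k mod int m)"
      using x by (simp add: int_pow_pow flip: int_pow_mult)
    moreover have "int (nat (k mod int m)) = k mod int m" "nat (k mod int m) < m"
      using m(1) by (auto simp: nat_less_iff)
    ultimately have "a = (b \<otimes> (x [^] (int m)) [^] (k div int m)) \<otimes> x [^] int (nat (k mod int m))"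
        "b \<otimes> (x [^] (int m)) [^] (k div int m) \<in> B" "nat (k mod int m) < m"
      using a bG x by (auto simp: m_assoc)
    then show "a \<in> (\<lambda>(b, j). b \<otimes> x [^] (int j)) ` (B \<times> {..<m})" by force
  qed
  have fin: "finite (B \<times> {..<m})" using B by simp
  show "finite (adjoin B x)" using finite_subset[OF sub] fin by simp
  have "card (adjoin B x) \<le> card (B \<times> {..<m})"
    using card_mono[OF finite_imageI[OF fin] sub] card_image_le[OF fin] by (rule le_trans)
  then show "card (adjoin B x) \<le> m * card B" by (simp add: card_cartesian_product mult.commute)
qed

text \<open>
  If \<open>x\<^sup>m\<close> is the first power of \<open>x\<close> in \<open>B\<close>, the subgroup grows at most by the factor \<open>m\<close> when \<open>x\<close>
  is adjoined, while each character of \<open>B\<close> has \<open>m\<close> extensions, one for each root.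
\<close>

proposition enough_characters:
  assumes "finite S" "S \<subseteq> carrier G" and "\<And>x. x \<in> S \<Longrightarrow> \<exists>m>0. x [^] (m::nat) = \<one>"
  shows "\<exists>B X. subgroup B G \<and> S \<subseteq> B \<and> finite B \<and> finite X \<and> card B \<le> card X \<and>
    (\<forall>\<chi>\<in>X. character_on G B \<chi> \<and> \<chi> \<in> extensional B)"
  using assms
proof (induction S)
  case empty
  show ?case
    using triv_subgroup by (intro exI[of _ "{\<one>}"] exI[of _ "{\<lambda>_\<in>{\<one>}. 1}"])
      (simp add: character_on_def extensional_def)
next
  case (insert x S)
  then obtain B X where B: "subgroup B G" "S \<subseteq> B" "finite B" and X: "finite X" "card B \<le> card X"
      "\<And>\<chi>. \<chi> \<in> X \<Longrightarrow> character_on G B \<chi> \<and> \<chi> \<in> extensional B"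
    by auto
  have x: "x \<in> carrier G" using insert.prems by auto
  obtain m0 :: nat where m0: "m0 > 0" "x [^] m0 = \<one>" using insert.prems by auto
  then have "x [^] (int m0) \<in> B" using subgroup.one_closed[OF B(1)] by (simp add: int_pow_int)
  then obtain m where m: "m > 0" "\<And>k::int. x [^] k \<in> B \<longleftrightarrow> int m dvd k"
    using relative_order[OF B(1) x, of "int m0"] m0(1) by auto
  have "\<exists>\<chi>'. character_on G (adjoin B x) \<chi>' \<and> (\<forall>b\<in>B. \<chi>' b = \<chi> b) \<and> \<chi>' x = w"
    if \<chi>: "\<chi> \<in> X" and w: "w ^ m = \<chi> (x [^] (int m))" for \<chi> w
  proof -
    have \<chi>B: "character_on G B \<chi>" using X \<chi> by auto
    have "\<chi> (x [^] (int m)) \<noteq> 0" using \<chi>B m(2) by (simp add: character_on_def)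
    then have "w \<noteq> 0" using w m(1) by (auto simp: power_0_left)
    then show ?thesis
      using character_extend_root[OF B(1) x \<chi>B _ character_root_condition[OF B(1) x \<chi>B m(2) w]] by metis
  qed
  then obtain e where e: "\<And>\<chi> w. \<lbrakk>\<chi> \<in> X; w ^ m = \<chi> (x [^] (int m))\<rbrakk> \<Longrightarrow>
      character_on G (adjoin B x) (e \<chi> w) \<and> (\<forall>b\<in>B. e \<chi> w b = \<chi> b) \<and> e \<chi> w x = w"
    by metis
  note adj = adjoin_subgroup[OF B(1) x]
  define P where "P = (SIGMA \<chi>:X. {w. w ^ m = \<chi> (x [^] (int m))})"
  define f where "f = (\<lambda>(\<chi>, w). restrict (e \<chi> w) (adjoin B x))"
  have card_roots: "card {w. w ^ m = \<chi> (x [^] (int m))} = m" if "\<chi> \<in> X" for \<chi>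
    using X(3)[OF that] m by (intro card_nth_roots) (auto simp: character_on_def)
  have finite_roots: "finite {w. w ^ m = \<chi> (x [^] (int m))}" if "\<chi> \<in> X" for \<chi>
    using card_roots[OF that] m(1) by (metis card.infinite less_irrefl)
  have P: "finite P" "card P = m * card X"
    using X(1) finite_roots by (auto simp: P_def card_roots)
  have "inj_on f P"
  proof (rule inj_onI)
    fix p p' assume "p \<in> P" "p' \<in> P" and eq: "f p = f p'"
    then obtain \<chi> w \<chi>' w' where p: "p = (\<chi>, w)" "\<chi> \<in> X" "w ^ m = \<chi> (x [^] (int m))"
        and p': "p' = (\<chi>', w')" "\<chi>' \<in> X" "w' ^ m = \<chi>' (x [^] (int m))"
      by (auto simp: P_def)
    have eq': "e \<chi> w b = e \<chi>' w' b" if "b \<in> adjoin B x" for b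
      using fun_cong[OF eq, of b] that by (simp add: f_def p p')
    have "\<chi> = \<chi>'"
      using X(3)[OF p(2)] X(3)[OF p'(2)] e[OF p(2,3)] e[OF p'(2,3)] eq' adj(2)
      by (intro extensionalityI[of _ B]) (auto simp: subset_iff)
    moreover have "w = w'" using e[OF p(2,3)] e[OF p'(2,3)] eq'[OF adj(3)] by simp
    ultimately show "p = p'" by (simp add: p p')
  qed
  then have card: "card (f ` P) = m * card X" using P by (simp add: card_image)
  have chars: "character_on G (adjoin B x) \<chi> \<and> \<chi> \<in> extensional (adjoin B x)" if \<chi>P: "\<chi> \<in> f ` P" for \<chi>
  proof -
    obtain \<chi>0 w where "\<chi>0 \<in> X" "w ^ m = \<chi>0 (x [^] (int m))" "\<chi> = restrict (e \<chi>0 w) (adjoin B x)"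
      using \<chi>P by (auto simp: P_def f_def)
    then show ?thesis
      using e[of \<chi>0 w] subgroup.m_closed[OF adj(1)] by (auto simp: character_on_def)
  qed
  have fin: "finite (adjoin B x)" "card (adjoin B x) \<le> m * card B"
    using adjoin_finite[OF B(1,3) x m(1)] m(2) by auto
  have "card (adjoin B x) \<le> card (f ` P)"
    using fin(2) X(2) by (simp add: card) (meson le_trans mult_le_mono2)
  then show ?case
    using adj B(2) fin(1) P(1) chars
    by (intro exI[of _ "adjoin B x"] exI[of _ "f ` P"]) auto
qed

end

section \<open>Covers\<close>

lemma complex_units_simps [simp]:
  "carrier complex_units = - {0}" "a \<otimes>\<^bsub>complex_units\<^esub> b = a * b" "\<one>\<^bsub>complex_units\<^esub> = 1"
  by (simp_all add: complex_units_def)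

lemma complex_units_group: "comm_group complex_units"
proof (rule group.group_comm_groupI)
  show "group complex_units"
  proof (rule groupI)
    fix x assume "x \<in> carrier complex_units"
    then show "\<exists>y\<in>carrier complex_units. y \<otimes>\<^bsub>complex_units\<^esub> x = \<one>\<^bsub>complex_units\<^esub>"
      by (intro bexI[of _ "inverse x"]) auto
  qed auto
qed auto

lemma complex_units_inv [simp]: "a \<noteq> 0 \<Longrightarrow> inv\<^bsub>complex_units\<^esub> a = inverse a"
  using comm_group.axioms(2)[OF complex_units_group]
  by (intro group.inv_equality) auto

context central_extension
begin

text \<open>
  Since \<open>G\<close> is abelian, the antisymmetric part of a 2-cocycle depends only on its cohomology
  class.  For cocycles that come from characters of \<open>[E, E]\<close> it determines the character on
  commutators.
\<close>

lemma coboundary_symmetric: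
  assumes "f \<in> coboundary1 G complex_units ` carrier (product_group (carrier G) (\<lambda>_. complex_units))"
    and "x \<in> carrier G" "y \<in> carrier G"
  shows "f (x, y) = f (y, x)"
  using assms by (auto simp: coboundary1_def G.m_comm[of y x] mult_ac PiE_iff)

lemma enough_characters_of_derived:
  assumes fin: "finite (carrier G)"
  obtains X where "finite (derived E (carrier E))" "finite X" "card (derived E (carrier E)) \<le> card X"
    "\<And>\<chi>. \<chi> \<in> X \<Longrightarrow> character_on commutator_group (derived E (carrier E)) \<chi>"
    "\<And>\<chi>. \<chi> \<in> X \<Longrightarrow> \<chi> \<in> extensional (derived E (carrier E))"
proof -
  let ?D = "derived E (carrier E)"
  define S where "S = commutators"
  have S: "S = (\<lambda>(x, y). pairing x y) ` (carrier G \<times> carrier G)" by (auto simp: S_def)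
  have SD: "S \<subseteq> ?D" using pairing.closed by (auto simp: S_def)
  have torsion: "\<exists>m>0. s [^]\<^bsub>commutator_group\<^esub> (m::nat) = \<one>\<^bsub>commutator_group\<^esub>" if s: "s \<in> S" for s
  proof -
    obtain x y where xy: "s = pairing x y" "x \<in> carrier G" "y \<in> carrier G" using s by (auto simp: S_def)
    have "s [^]\<^bsub>commutator_group\<^esub> order G = \<one>\<^bsub>commutator_group\<^esub>"
      unfolding xy(1) pairing.pow_left[OF xy(2,3), symmetric] G.pow_order_eq_1[OF xy(2)]
      using xy(3) by simp
    moreover have "order G > 0" using fin by (simp add: G.order_gt_0_iff_finite)
    ultimately show ?thesis by blast
  qed
  obtain B X where B: "subgroup B commutator_group" "S \<subseteq> B" "finite B" and X: "finite X" "card B \<le> card X"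
    and chars: "\<forall>\<chi>\<in>X. character_on commutator_group B \<chi> \<and> \<chi> \<in> extensional B"
    using pairing.H.enough_characters[of S] SD torsion fin by (auto simp: S)
  have "subgroup B E" using E.incl_subgroup[OF derived_subgroup B(1)] .
  then have "?D \<subseteq> B"
    unfolding derived_generated_by_pairing S_def[symmetric] using B(2) by (rule E.generate_subgroup_incl[rotated])
  then have BD: "B = ?D" using subgroup.subset[OF B(1)] by auto
  show ?thesis
    by (rule that[of X]) (use B(3) X chars in \<open>auto simp: BD\<close>)
qed

lemma derived_finite:
  assumes "finite (carrier G)"
  shows "finite (derived E (carrier E))"
  using enough_characters_of_derived[OF assms] by metis

text \<open>
  A character \<open>\<chi>\<close> of \<open>[E, E]\<close> extends to a subgroup of the kernel that contains the values of the
  factor set, and composing with the factor set gives a cocycle.  Its antisymmetric part is \<open>\<chi>\<close> on the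
  commutators, so different characters have different classes.
\<close>

lemma card_derived_le_cohomology:
  assumes fin: "finite (carrier G)" and cohom: "finite (carrier (schur_multiplier G))"
  shows "card (derived E (carrier E)) \<le> card (carrier (schur_multiplier G))"
proof -
  interpret A: comm_group kernel_group by (rule comm_group_kernel)
  let ?D = "derived E (carrier E)"
  define S where "S = commutators"
  have SD: "S \<subseteq> ?D" using pairing.closed by (auto simp: S_def)
  obtain X where X: "finite X" "card ?D \<le> card X"
    and chi: "\<And>\<chi>. \<chi> \<in> X \<Longrightarrow> character_on commutator_group ?D \<chi>"
      "\<And>\<chi>. \<chi> \<in> X \<Longrightarrow> \<chi> \<in> extensional ?D"
    using enough_characters_of_derived[OF fin] by metis
  let ?F = "(\<lambda>(x, y). factor_set x y) ` (carrier G \<times> carrier G)"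
  have finite_F: "finite ?F" using fin by simp
  have F_kernel: "?F \<subseteq> carrier kernel_group" using factor_set_facts(3) by auto
  have DA: "subgroup ?D kernel_group"
    using E.subgroup_incl[OF derived_subgroup subgroup_kernel derived_sub_kernel] .
  have extend: "\<exists>\<chi>'. (\<forall>a\<in>?D. \<chi>' a = \<chi> a) \<and> (\<exists>B'. subgroup B' kernel_group \<and> ?D \<union> ?F \<subseteq> B' \<and> character_on kernel_group B' \<chi>')"
    if "\<chi> \<in> X" for \<chi>
  proof -
    have "character_on kernel_group ?D \<chi>" using chi(1)[OF that] by (simp add: character_on_def)
    then show ?thesis
      using A.character_extend_finite[OF finite_F F_kernel DA] by blast
  qed
  then obtain xt where xt: "\<And>\<chi>. \<chi> \<in> X \<Longrightarrow> \<forall>a\<in>?D. xt \<chi> a = \<chi> a"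
    and xtB: "\<And>\<chi>. \<chi> \<in> X \<Longrightarrow> \<exists>B'. subgroup B' kernel_group \<and> ?D \<union> ?F \<subseteq> B' \<and> character_on kernel_group B' (xt \<chi>)"
    by metis
  let ?C2 = "product_group (carrier G \<times> carrier G) (\<lambda>_. complex_units)"
  let ?C3 = "product_group (carrier G \<times> carrier G \<times> carrier G) (\<lambda>_. complex_units)"
  define R where "R = coboundary1 G complex_units ` carrier (product_group (carrier G) (\<lambda>_. complex_units))"
  define K where "K = kernel ?C2 ?C3 (coboundary2 G complex_units)"
  define f where "f \<chi> = (\<lambda>(x, y)\<in>carrier G \<times> carrier G. xt \<chi> (factor_set x y))" for \<chi>
  have f_apply: "f \<chi> (x, y) = xt \<chi> (factor_set x y)" if "x \<in> carrier G" "y \<in> carrier G" for \<chi> x y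
    using that by (simp add: f_def)
  have xt_nz: "xt \<chi> (factor_set x y) \<noteq> 0" if "\<chi> \<in> X" "x \<in> carrier G" "y \<in> carrier G" for \<chi> x y
    using xtB[OF that(1)] that(2,3) by (auto simp: character_on_def)
  have fK: "f \<chi> \<in> K" if \<chi>: "\<chi> \<in> X" for \<chi>
  proof -
    obtain B' where B': "subgroup B' kernel_group" "?D \<union> ?F \<subseteq> B'" "character_on kernel_group B' (xt \<chi>)"
      using xtB[OF \<chi>] by blast
    have fB': "factor_set x y \<in> B'" if "x \<in> carrier G" "y \<in> carrier G" for x y
      using B'(2) that by auto
    have mult: "xt \<chi> (a \<otimes> b) = xt \<chi> a * xt \<chi> b" if "a \<in> B'" "b \<in> B'" for a b
      using B'(3) that by (simp add: character_on_def)
    have "coboundary2 G complex_units (f \<chi>) t = 1" if "t \<in> carrier G \<times> carrier G \<times> carrier G" for t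
    proof -
      obtain x y z where t: "t = (x, y, z)" "x \<in> carrier G" "y \<in> carrier G" "z \<in> carrier G"
        using \<open>t \<in> _\<close> by auto
      have "xt \<chi> (factor_set x y) * xt \<chi> (factor_set (x \<otimes>\<^bsub>G\<^esub> y) z) =
          xt \<chi> (factor_set y z) * xt \<chi> (factor_set x (y \<otimes>\<^bsub>G\<^esub> z))"
        using t fB' factor_set_cocycle[of x y z] by (simp flip: mult)
      then show ?thesis
        using t xt_nz[OF \<chi>] by (simp add: coboundary2_def f_apply) (simp add: field_simps)
    qed
    then have "coboundary2 G complex_units (f \<chi>) = \<one>\<^bsub>?C3\<^esub>"
      by (intro ext) (auto simp: coboundary2_def)
    then show ?thesis
      using xt_nz[OF \<chi>] by (auto simp: K_def kernel_def f_def)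
  qed
  let ?C = "?C2\<lparr>carrier := K\<rparr>"
  have one_R: "\<one>\<^bsub>?C2\<^esub> \<in> R"
    unfolding R_def
  proof
    show "\<one>\<^bsub>?C2\<^esub> = coboundary1 G complex_units \<one>\<^bsub>product_group (carrier G) (\<lambda>_. complex_units)\<^esub>"
      by (auto simp: coboundary1_def fun_eq_iff)
  qed auto
  have "inj_on (\<lambda>\<chi>. R #>\<^bsub>?C\<^esub> f \<chi>) X"
  proof (rule inj_onI)
    fix \<chi> \<psi> assume \<chi>: "\<chi> \<in> X" and \<psi>: "\<psi> \<in> X" and eq: "R #>\<^bsub>?C\<^esub> f \<chi> = R #>\<^bsub>?C\<^esub> f \<psi>"
    have "\<one>\<^bsub>?C2\<^esub> \<otimes>\<^bsub>?C2\<^esub> f \<chi> = f \<chi>"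
      by (auto simp: f_def fun_eq_iff)
    moreover have coset: "u \<in> R #>\<^bsub>?C\<^esub> v \<longleftrightarrow> (\<exists>r\<in>R. u = r \<otimes>\<^bsub>?C2\<^esub> v)" for u v
      by (simp add: r_coset_def)
    ultimately have "f \<chi> \<in> R #>\<^bsub>?C\<^esub> f \<chi>"
      unfolding coset by (intro bexI[OF _ one_R]) (rule sym)
    then obtain r where r: "r \<in> R" "f \<chi> = r \<otimes>\<^bsub>?C2\<^esub> f \<psi>"
      unfolding eq coset by blast
    have rel: "xt \<chi> (factor_set x y) = r (x, y) * xt \<psi> (factor_set x y)"
      if "x \<in> carrier G" "y \<in> carrier G" for x y
      using fun_cong[OF r(2), of "(x, y)"] that by (simp add: f_apply)
    have sym: "r (x, y) = r (y, x)" if "x \<in> carrier G" "y \<in> carrier G" for x y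
      using coboundary_symmetric[of r x y] r(1) that by (simp add: R_def)
    have on_S: "\<chi> (pairing x y) = \<psi> (pairing x y)" if xy: "x \<in> carrier G" "y \<in> carrier G" for x y
    proof -
      have eval: "\<theta> (pairing x y) * xt \<theta> (factor_set y x) = xt \<theta> (factor_set x y)" if \<theta>: "\<theta> \<in> X" for \<theta>
      proof -
        obtain B' where B': "subgroup B' kernel_group" "?D \<union> ?F \<subseteq> B'" "character_on kernel_group B' (xt \<theta>)"
          using xtB[OF \<theta>] by blast
        have "pairing x y \<in> ?D" using xy pairing.closed by simp
        then have "\<theta> (pairing x y) = xt \<theta> (pairing x y)" "pairing x y \<in> B'"
          using xt[OF \<theta>] B'(2) by auto
        moreover have "factor_set y x \<in> B'" using xy B'(2) by auto
        moreover have "pairing x y \<otimes> factor_set y x = factor_set x y"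
          using xy factor_set_facts(1) by (simp add: pairing_eq_factor_sets E.m_assoc)
        moreover have "xt \<theta> (a \<otimes> b) = xt \<theta> a * xt \<theta> b" if "a \<in> B'" "b \<in> B'" for a b
          using B'(3) that by (simp add: character_on_def)
        ultimately show ?thesis by metis
      qed
      have "\<chi> (pairing x y) * (r (y, x) * xt \<psi> (factor_set y x)) = r (x, y) * xt \<psi> (factor_set x y)"
        using eval[OF \<chi>] rel xy by simp
      also have "\<dots> = \<psi> (pairing x y) * (r (y, x) * xt \<psi> (factor_set y x))"
        using eval[OF \<psi>] sym[OF xy] by (simp add: mult_ac)
      finally show ?thesis
        using rel[OF xy(2,1)] xt_nz[OF \<chi> xy(2,1)] by simp
    qed
    have "subgroup {a \<in> ?D. \<chi> a = \<psi> a} E"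
    proof (rule E.subgroupI)
      show "{a \<in> ?D. \<chi> a = \<psi> a} \<subseteq> carrier E" using derived_facts by auto
      have "\<one> \<in> {a \<in> ?D. \<chi> a = \<psi> a}"
        using pairing.H.character_on_one[OF chi(1)[OF \<chi>]] pairing.H.character_on_one[OF chi(1)[OF \<psi>]]
          pairing.H.subgroup_self subgroup.one_closed[OF derived_subgroup] by simp
      then show "{a \<in> ?D. \<chi> a = \<psi> a} \<noteq> {}" by blast
      fix a assume "a \<in> {a \<in> ?D. \<chi> a = \<psi> a}"
      then have a: "a \<in> ?D" "\<chi> a = \<psi> a" by auto
      have "inv\<^bsub>commutator_group\<^esub> a = inv a"
        using E.m_inv_consistent[OF derived_subgroup a(1)] .
      then show "inv a \<in> {a \<in> ?D. \<chi> a = \<psi> a}"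
        using a subgroup.m_inv_closed[OF derived_subgroup a(1)] pairing.H.subgroup_self
          pairing.H.character_on_inv[OF chi(1)[OF \<chi>], of a] pairing.H.character_on_inv[OF chi(1)[OF \<psi>], of a] by simp
      fix b assume "b \<in> {a \<in> ?D. \<chi> a = \<psi> a}"
      then show "a \<otimes> b \<in> {a \<in> ?D. \<chi> a = \<psi> a}"
        using a chi(1)[OF \<chi>] chi(1)[OF \<psi>] subgroup.m_closed[OF derived_subgroup]
        by (simp add: character_on_def)
    qed
    moreover have "\<chi> s = \<psi> s" if "s \<in> S" for s using on_S that by (auto simp: S_def)
    then have "S \<subseteq> {a \<in> ?D. \<chi> a = \<psi> a}" using SD by blast
    ultimately have "generate E S \<subseteq> {a \<in> ?D. \<chi> a = \<psi> a}"
      by (intro E.generate_subgroup_incl)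
    then have "?D \<subseteq> {a \<in> ?D. \<chi> a = \<psi> a}"
      using derived_generated_by_pairing unfolding S_def[symmetric] by (simp only:)
    then show "\<chi> = \<psi>"
      using chi(2)[OF \<chi>] chi(2)[OF \<psi>] by (intro extensionalityI[of _ ?D]) auto
  qed
  moreover have schur: "schur_multiplier G = ?C Mod R"
    by (simp add: schur_multiplier_def cohomology2_def Let_def R_def K_def)
  then have "(\<lambda>\<chi>. R #>\<^bsub>?C\<^esub> f \<chi>) ` X \<subseteq> carrier (schur_multiplier G)"
    using fK by (auto simp: carrier_FactGroup)
  ultimately have "card X \<le> card (carrier (schur_multiplier G))"
    using cohom by (rule card_inj_on_le)
  then show "card ?D \<le> card (carrier (schur_multiplier G))" using X(2) by simp
qed

end

context free_central_presentation
begin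

text \<open>
  The map \<open>E \<rightarrow> L\<close> takes \<open>[E, E]\<close> onto \<open>[L, L]\<close>, which is the kernel of the cover and hence as large as
  \<open>H\<^sup>2(G, \<complex>\<^sup>*)\<close>.  By \<open>card_derived_le_cohomology\<close> it is injective there, so it respects
  triviality of commutators in both directions.
\<close>

proposition radical_eq_center_of_cover:
  assumes fin: "finite (carrier G)" and cover: "is_cover G L \<mu>"
  shows "pairing.radical = \<mu> ` center L"
proof -
  have L: "central_extension L G \<mu>"
    using cover G.comm_group_axioms
    by (intro central_extension.intro central_extension_axioms.intro) (auto simp: is_cover_def)
  interpret L: central_extension L G \<mu> by (rule L)
  let ?M = "kernel L G \<mu>"
  obtain \<phi> where \<phi>: "\<phi> \<in> hom E L" "\<And>e. e \<in> carrier E \<Longrightarrow> \<mu> (\<phi> e) = \<rho> e"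
    by (rule lift_to_central_extension[OF L]) (rule that, assumption, simp)
  interpret \<phi>: group_hom E L \<phi> using \<phi>(1) by unfold_locales
  have \<phi>_pairing: "\<phi> (pairing x y) = L.pairing x y" if "x \<in> carrier G" "y \<in> carrier G" for x y
  proof -
    have "L.pairing (\<mu> (\<phi> (section_map x))) (\<mu> (\<phi> (section_map y))) =
        L.commutator (\<phi> (section_map x)) (\<phi> (section_map y))"
      using that by (intro L.pairing_commutator) auto
    then show ?thesis using that by (simp add: \<phi>(2) pairing_def)
  qed
  let ?D = "derived E (carrier E)"
  have gens: "\<phi> ` commutators = L.commutators"
    using \<phi>_pairing by (force simp: image_def)
  have "commutators \<subseteq> carrier E"
    using derived_facts pairing.closed by auto
  then have "\<phi> ` ?D = derived L (carrier L)"
    using \<phi>.generate_img unfolding derived_generated_by_pairing L.derived_generated_by_pairing gens[symmetric]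
    by blast
  also have "\<dots> = ?M"
    using L.derived_sub_kernel cover by (auto simp: is_cover_def)
  finally have img: "\<phi> ` ?D = ?M" .
  have "L\<lparr>carrier := ?M\<rparr> \<cong> schur_multiplier G" using cover by (simp add: is_cover_def)
  then obtain g where g: "bij_betw g ?M (carrier (schur_multiplier G))"
    by (auto simp: is_iso_def iso_def)
  have "finite ?D" by (rule derived_finite[OF fin])
  then have "finite ?M" using img by (metis finite_imageI)
  then have "finite (carrier (schur_multiplier G))" using g bij_betw_finite by blast
  then have "card ?D \<le> card (carrier (schur_multiplier G))"
    by (rule card_derived_le_cohomology[OF fin])
  also have "\<dots> = card (\<phi> ` ?D)" using g img by (simp add: bij_betw_same_card)
  finally have "card (\<phi> ` ?D) = card ?D" using card_image_le[OF \<open>finite ?D\<close>, of \<phi>] by simp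
  then have inj: "inj_on \<phi> ?D" by (rule eq_card_imp_inj_on[OF \<open>finite ?D\<close>])
  have "pairing x y = \<one> \<longleftrightarrow> L.pairing x y = \<one>\<^bsub>L\<^esub>" if "x \<in> carrier G" "y \<in> carrier G" for x y
  proof -
    have "pairing x y \<in> ?D" "\<one> \<in> ?D"
      using that pairing.closed subgroup.one_closed[OF derived_subgroup] by auto
    then have "\<phi> (pairing x y) = \<phi> \<one> \<longleftrightarrow> pairing x y = \<one>"
      using inj by (simp only: inj_on_eq_iff)
    then show ?thesis using that by (simp add: \<phi>_pairing)
  qed
  then have "pairing.radical = L.pairing.radical"
    by (auto simp: pairing.radical_def L.pairing.radical_def)
  then show ?thesis by (simp add: L.radical_eq_image_center)
qed

end

section \<open>From a presentation to a central extension\<close>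

text \<open>
  Here \<open>F / [F, N]\<close> is realised by cosets.  The projection \<open>F \<rightarrow> G\<close> factors through it, because
  \<open>[F, N] \<le> N\<close>, and the kernel is central, because commutators with elements of \<open>N\<close> are divided out.
\<close>

lemma presentation_central_extension:
  fixes F :: "('f, 'k) monoid_scheme"
  assumes "comm_group G" and "presentation G F N"
  obtains E :: "'f set monoid" and \<rho> \<eta> where "free_central_presentation E G \<rho> F \<eta> N"
proof -
  interpret G: comm_group G by fact
  have free: "free_group F" and N: "N \<lhd> F" and iso: "F Mod N \<cong> G"
    using assms(2) by (auto simp: presentation_def)
  have F: "group F" using N by (rule normal.axioms(2))
  interpret F: group F by fact
  interpret N: normal N F by fact
  obtain h where h: "h \<in> iso (F Mod N) G" using iso by (auto simp: is_iso_def)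
  interpret h: group_hom "F Mod N" G h
    using h N.factorgroup_is_group by (intro group_hom.intro group_hom_axioms.intro) (auto simp: iso_def)
  define \<theta> where "\<theta> f = h (N #>\<^bsub>F\<^esub> f)" for f
  have \<theta>: "\<theta> \<in> hom F G"
    using Group.hom_compose[OF N.r_coset_hom_Mod h.homh] by (simp add: \<theta>_def[abs_def] comp_def)
  interpret \<theta>: group_hom F G \<theta> by unfold_locales (rule \<theta>)
  have \<theta>_surj: "\<theta> ` carrier F = carrier G"
    using h by (simp add: \<theta>_def[abs_def] iso_def bij_betw_def carrier_FactGroup image_image)
  have \<theta>_ker: "\<theta> f = \<one>\<^bsub>G\<^esub> \<longleftrightarrow> f \<in> N" if f: "f \<in> carrier F" for f
  proof -
    have "N #>\<^bsub>F\<^esub> f \<in> carrier (F Mod N)" using f by (simp add: carrier_FactGroup)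
    moreover have "\<one>\<^bsub>F Mod N\<^esub> \<in> carrier (F Mod N)"
      by (rule monoid.one_closed[OF group.is_monoid[OF N.factorgroup_is_group]])
    ultimately have "\<theta> f = h \<one>\<^bsub>F Mod N\<^esub> \<longleftrightarrow> N #>\<^bsub>F\<^esub> f = \<one>\<^bsub>F Mod N\<^esub>"
      unfolding \<theta>_def using h by (intro inj_on_eq_iff[of h "carrier (F Mod N)"]) (auto simp: iso_def bij_betw_def)
    moreover have "N #>\<^bsub>F\<^esub> f = N \<longleftrightarrow> f \<in> N"
      using F.coset_join1[OF _ f N.subgroup_axioms] F.coset_join2[OF f N.subgroup_axioms] by blast
    ultimately show ?thesis unfolding h.hom_one by simp
  qed
  define C where "C = mixed_commutator_subgroup F N"
  have comm_carrier: "mixed_commutators F N \<subseteq> carrier F"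
    using N.subset by (auto simp: mixed_commutators_def)
  have C: "C \<lhd> F"
    unfolding C_def mixed_commutator_subgroup_def by (rule F.normal_closure_normal[OF comm_carrier])
  interpret C: normal C F by (rule C)
  have comm_N: "mixed_commutators F N \<subseteq> N"
  proof -
    have "f \<otimes>\<^bsub>F\<^esub> x \<otimes>\<^bsub>F\<^esub> inv\<^bsub>F\<^esub> f \<otimes>\<^bsub>F\<^esub> inv\<^bsub>F\<^esub> x \<in> N" if "f \<in> carrier F" "x \<in> N" for f x
      using N.inv_op_closed2[OF that] that(2) by blast
    then show ?thesis by (auto simp: mixed_commutators_def)
  qed
  have CN: "C \<subseteq> N"
    unfolding C_def mixed_commutator_subgroup_def by (rule normal_closure_minimal[OF N comm_N])
  define E where "E = F Mod C"
  define \<eta> where "\<eta> f = C #>\<^bsub>F\<^esub> f" for f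
  have E: "group E" unfolding E_def by (rule C.factorgroup_is_group)
  have \<eta>: "\<eta> \<in> epi F E"
    using C.r_coset_hom_Mod by (simp add: epi_def E_def \<eta>_def[abs_def] carrier_FactGroup)
  interpret \<eta>: group_hom F E \<eta>
    using \<eta> F E by (intro group_hom.intro group_hom_axioms.intro) (auto simp: epi_def)
  have \<eta>_surj: "\<eta> ` carrier F = carrier E" using \<eta> by (simp add: epi_def)
  have \<eta>_ker: "kernel F E \<eta> = C"
  proof -
    have "\<eta> f = \<one>\<^bsub>E\<^esub> \<longleftrightarrow> f \<in> C" if "f \<in> carrier F" for f
      using F.coset_join1[OF _ that C.subgroup_axioms] F.coset_join2[OF that C.subgroup_axioms]
      by (auto simp: \<eta>_def E_def)
    then show ?thesis using C.subset by (auto simp: kernel_def)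
  qed
  have "kernel F E \<eta> \<subseteq> kernel F G \<theta>"
    using CN N.subset \<theta>_ker unfolding \<eta>_ker by (auto simp: kernel_def)
  then obtain \<rho> where \<rho>: "\<rho> \<in> hom E G" "\<And>f. f \<in> carrier F \<Longrightarrow> \<rho> (\<eta> f) = \<theta> f"
    by (rule hom_factor_epi[OF F E G.is_group \<eta> \<theta>]) (rule that, assumption, simp)
  interpret \<rho>: group_hom E G \<rho> using \<rho>(1) E by (intro group_hom.intro group_hom_axioms.intro) auto
  have "central_extension E G \<rho>"
  proof (intro central_extension.intro central_extension_axioms.intro)
    show "\<rho> \<in> epi E G"
      using \<rho> \<theta>_surj by (simp add: epi_def image_image flip: \<eta>_surj)
    show "kernel E G \<rho> \<subseteq> center E"
    proof
      fix z assume "z \<in> kernel E G \<rho>"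
      then obtain x where x: "x \<in> carrier F" "z = \<eta> x" "\<theta> x = \<one>\<^bsub>G\<^esub>"
        using \<rho>(2) unfolding kernel_def \<eta>_surj[symmetric] by auto
      then have xN: "x \<in> N" using \<theta>_ker by simp
      have "z \<otimes>\<^bsub>E\<^esub> e = e \<otimes>\<^bsub>E\<^esub> z" if e: "e \<in> carrier E" for e
      proof -
        obtain f where f: "f \<in> carrier F" "e = \<eta> f"
          using e unfolding \<eta>_surj[symmetric] by blast
        have "f \<otimes>\<^bsub>F\<^esub> x \<otimes>\<^bsub>F\<^esub> inv\<^bsub>F\<^esub> f \<otimes>\<^bsub>F\<^esub> inv\<^bsub>F\<^esub> x \<in> mixed_commutators F N"
          unfolding mixed_commutators_def using f(1) xN by blast
        then have "f \<otimes>\<^bsub>F\<^esub> x \<otimes>\<^bsub>F\<^esub> inv\<^bsub>F\<^esub> f \<otimes>\<^bsub>F\<^esub> inv\<^bsub>F\<^esub> x \<in> kernel F E \<eta>"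
          unfolding \<eta>_ker C_def mixed_commutator_subgroup_def by (rule subsetD[OF normal_closure_incl])
        then have "e \<otimes>\<^bsub>E\<^esub> z \<otimes>\<^bsub>E\<^esub> inv\<^bsub>E\<^esub> e \<otimes>\<^bsub>E\<^esub> inv\<^bsub>E\<^esub> z = \<one>\<^bsub>E\<^esub>"
          using f x by (simp add: kernel_def)
        then show ?thesis
          using f x by (simp add: group.inv_solve_right'[OF E])
      qed
      then show "z \<in> center E" using x by (auto simp: center_def)
    qed
  qed (fact E assms(1))+
  then have "free_central_presentation E G \<rho> F \<eta> N"
    using F \<eta> \<eta>_ker free \<rho>(2) \<theta>_ker N.subset
    by (intro free_central_presentation.intro central_presentation.intro
        central_presentation_axioms.intro free_central_presentation_axioms.intro)
      (auto simp: kernel_def C_def)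
  then show ?thesis by (rule that)
qed

section \<open>The structure of the twisted power groups\<close>

theorem proposition4p7:
  fixes p n :: nat
    and G :: "'a monoid" and Gstar :: "'e monoid" and \<pi> :: "'e \<Rightarrow> 'a"
    and F :: "'f monoid" and N :: "'f set"
  assumes "prime p"
    and "comm_group G" and "finite (carrier G)" and "\<exists>k. order G = p ^ k"
    and "n \<ge> 3"
    and "is_cover G Gstar \<pi>"
    and "presentation G F N"
  shows "(group_exponent G dvd n \<longrightarrow> K_tilde F N n \<cong> G \<times>\<times> K_tilde F N (n - 1)) \<and>
    (\<not> p dvd n \<longrightarrow>
      (K_tilde F N n)\<lparr>carrier := center (K_tilde F N n)\<rparr> \<cong>
        H2_int G \<times>\<times> K_group (G\<lparr>carrier := \<pi> ` center Gstar\<rparr>) n)"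
proof -
  obtain E :: "'f set monoid" and \<rho> \<eta> where "free_central_presentation E G \<rho> F \<eta> N"
    using presentation_central_extension[OF assms(2,7)] .
  then interpret free_central_presentation E G \<rho> F \<eta> N .
  obtain m where m: "n = Suc m" "m \<ge> 2" using assms(5) by (cases n) auto
  have K_n: "group (K_tilde F N n)" "K_tilde F N n \<cong> pairing.twisted_group n"
    using K_tilde_iso_twisted_group[of n] assms(5) by auto
  have K_m: "pairing.twisted_group m \<cong> K_tilde F N m"
    using K_tilde_iso_twisted_group[OF m(2)] by (rule group.iso_sym)
  show ?thesis
  proof (intro conjI impI)
    assume "group_exponent G dvd n"
    then have "x [^]\<^bsub>G\<^esub> Suc m = \<one>\<^bsub>G\<^esub>" if "x \<in> carrier G" for x
      using G.pow_eq_one_if_exponent_dvd[of n x] that m(1) by blast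
    then have "pairing.twisted_group n \<cong> G \<times>\<times> pairing.twisted_group m"
      unfolding m(1) by (rule pairing.twisted_group_split[OF assms(3)])
    also have "G \<times>\<times> pairing.twisted_group m \<cong> G \<times>\<times> K_tilde F N m"
      by (rule group.DirProd_iso_trans[OF G.is_group iso_refl K_m])
    finally show "K_tilde F N n \<cong> G \<times>\<times> K_tilde F N (n - 1)"
      using K_n(2) iso_trans m(1) by fastforce
  next
    assume "\<not> p dvd n"
    then have "coprime n (order G)"
      using assms(1,4) by (metis coprime_commute coprime_power_left_iff prime_imp_coprime)
    then have "(pairing.twisted_group n)\<lparr>carrier := center (pairing.twisted_group n)\<rparr> \<cong>
        commutator_group \<times>\<times> K_group (G\<lparr>carrier := pairing.radical\<rparr>) n"
      using pairing.center_twisted_group_iso assms(3,5) by simp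
    then have "(K_tilde F N n)\<lparr>carrier := center (K_tilde F N n)\<rparr> \<cong>
        commutator_group \<times>\<times> K_group (G\<lparr>carrier := pairing.radical\<rparr>) n"
      by (rule iso_trans[OF iso_center[OF K_n(1) pairing.twisted_group_group K_n(2)]])
    also have "commutator_group \<times>\<times> K_group (G\<lparr>carrier := pairing.radical\<rparr>) n \<cong>
        H2_int G \<times>\<times> K_group (G\<lparr>carrier := pairing.radical\<rparr>) n"
      by (rule group.DirProd_iso_trans[OF comm_group.axioms(2)[OF comm_group_derived] Hopf_formula iso_refl])
    finally show "(K_tilde F N n)\<lparr>carrier := center (K_tilde F N n)\<rparr> \<cong>
        H2_int G \<times>\<times> K_group (G\<lparr>carrier := \<pi> ` center Gstar\<rparr>) n"
      using radical_eq_center_of_cover[OF assms(3,6)] by simp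
  qed
qed

end
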